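(* Let $\alpha>0$ and let $U(0,\varepsilon)$ be the disk of sufficiently small radius $\varepsilon>0$ centered at the origin. As $n\to\infty$, uniformly for $z\in U(0,\varepsilon)\cap\mathbb C_+$, $$\begin{aligned}\pi_n (n^{-1/2}z)=&\frac{\Gamma(\alpha)}{\sqrt{2\pi}}\,n^{1/2-n/2-\alpha}\,e^{n/2}\,(4-z^2)^{-1/4}\\&\times\left[e^{i\pi(1/4-\alpha)-n\phi(z)}\varphi(z/2)^{2\alpha-1/2}\left(1+O(1/n)\right)+e^{-i\pi(1/4-\alpha)+n\phi(z)}\varphi(z/2)^{-2\alpha+1/2}\left(1+O(1/n)\right)\right],\end{aligned}$$ where the branches are such that $\arg(z+2),\arg(2-z)\in(-\pi,\pi)$, and $\varphi(z)=z+\sqrt{z^2-1}$ is analytic in $\mathbb C\setminus[-1,1]$ and behaves like $2z$ at infinity. The formula for $z\in U(0,\varepsilon)\cap\mathbb C_-$ is obtained from this one by taking complex conjugates.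
   Context: **Polynomials.** For $\alpha>0$ the Tricomi–Carlitz polynomials $f_n^{(\alpha)}$ are defined by $f_0^{(\alpha)}(x)=1$, $f_1^{(\alpha)}(x)=\alpha x$ and $(n+1)f_{n+1}^{(\alpha)}(x)-(n+\alpha)x f_n^{(\alpha)}(x)+f_{n-1}^{(\alpha)}(x)=0$ for $n\ge1$. The leading coefficient of $f_n^{(\alpha)}$ is $\gamma_n=\frac{\Gamma(n+\alpha)}{\Gamma(\alpha)\Gamma(n+1)}$, and $\pi_n=f_n^{(\alpha)}/\gamma_n$ is the monic polynomial. **Auxiliary functions.** $\mathbb C_\pm$ denote the open upper and lower half planes. Let $$\psi(x)=\frac1\pi\left(\frac{4\arctan(|x|/\sqrt{4-x^2})}{|x|^3}-\frac{\sqrt{4-x^2}}{x^2}\right)\ (|x|\le2),\qquad \psi(x)=\frac{2}{|x|^3}\ (|x|>2),$$ $g(z)=\int_{-\infty}^\infty\log(z-s)\psi(s)\,ds$ for $z\in\mathbb C\setminus\mathbb R$ with $\arg(z-s)\in(-\pi,\pi)$, $l=2\int_{-\infty}^\infty\log|2-s|\,\psi(s)\,ds$, and $\phi(z)=l/2-g(z)$ for $z\in\mathbb C_\pm$. Powers of $\varphi(z/2)$ are principal (for $z\in\mathbb C_+$ one has $\varphi(z/2)\in\mathbb C_+$). *)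

theory Defs
  imports
    "HOL-Analysis.Analysis"
    "HOL-Computational_Algebra.Polynomial"
begin

fun tricomi_carlitz :: "real \<Rightarrow> nat \<Rightarrow> real poly" where
  "tricomi_carlitz \<alpha> 0 = 1"
| "tricomi_carlitz \<alpha> (Suc 0) = [:0, \<alpha>:]"
| "tricomi_carlitz \<alpha> (Suc (Suc n)) =
     smult (1 / (real n + 2))
       (smult (real n + 1 + \<alpha>) ([:0, 1:] * tricomi_carlitz \<alpha> (Suc n)) - tricomi_carlitz \<alpha> n)"

definition tc_gamma :: "real \<Rightarrow> nat \<Rightarrow> real" where
  "tc_gamma \<alpha> n = Gamma (real n + \<alpha>) / (Gamma \<alpha> * Gamma (real n + 1))"

definition tc_monic :: "real \<Rightarrow> nat \<Rightarrow> real poly" where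
  "tc_monic \<alpha> n = smult (1 / tc_gamma \<alpha> n) (tricomi_carlitz \<alpha> n)"

lemma tc_gamma_Suc:
  assumes "\<alpha> > 0"
  shows "tc_gamma \<alpha> (Suc n) = (real n + \<alpha>) / (real n + 1) * tc_gamma \<alpha> n"
proof -
  have "Gamma (real n + \<alpha> + 1) = (real n + \<alpha>) * Gamma (real n + \<alpha>)"
    using assms by (intro Gamma_plus1) (auto elim!: nonpos_Ints_cases)
  moreover have "Gamma (real n + 1 + 1) = (real n + 1) * Gamma (real n + 1)"
    by (intro Gamma_plus1) (auto elim!: nonpos_Ints_cases)
  ultimately show ?thesis
    by (simp add: tc_gamma_def add_ac)
qed

lemma tricomi_carlitz_degree_lead_coeff:
  assumes "\<alpha> > 0"
  shows "degree (tricomi_carlitz \<alpha> n) \<le> n \<and> coeff (tricomi_carlitz \<alpha> n) n = tc_gamma \<alpha> n"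
  using assms
proof (induction \<alpha> n rule: tricomi_carlitz.induct)
  case (1 \<alpha>)
  then have "Gamma \<alpha> \<noteq> 0"
    using Gamma_real_pos less_irrefl by metis
  then show ?case
    by (simp add: tc_gamma_def)
next
  case (2 \<alpha>)
  then have "Gamma \<alpha> \<noteq> 0"
    using Gamma_real_pos less_irrefl by metis
  then have "tc_gamma \<alpha> 0 = 1"
    by (simp add: tc_gamma_def)
  then show ?case
    using tc_gamma_Suc[OF 2, of 0] by simp
next
  case (3 \<alpha> n)
  let ?p = "tricomi_carlitz \<alpha> (Suc n)" and ?q = "tricomi_carlitz \<alpha> n"
  have p: "degree ?p \<le> Suc n" "coeff ?p (Suc n) = tc_gamma \<alpha> (Suc n)"
    and q: "degree ?q \<le> n"
    using 3 by auto
  have "degree (smult (real n + 1 + \<alpha>) ([:0, 1:] * ?p) - ?q) \<le> Suc (Suc n)"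
    using p q by (intro degree_diff_le order.trans[OF degree_smult_le]) (auto simp: degree_pCons_eq_if)
  then have "degree (tricomi_carlitz \<alpha> (Suc (Suc n))) \<le> Suc (Suc n)"
    by simp
  moreover have "coeff ?q (Suc (Suc n)) = 0"
    using q by (intro coeff_eq_0) auto
  then have "coeff (tricomi_carlitz \<alpha> (Suc (Suc n))) (Suc (Suc n)) = tc_gamma \<alpha> (Suc (Suc n))"
    using p tc_gamma_Suc[OF 3(3), of "Suc n"] by (simp add: algebra_simps add_divide_distrib)
  ultimately show ?case
    by blast
qed

text \<open>
  In the first branch, the point \<open>x = 0\<close> is a removable singularity with limit \<open>1 / (3 * pi)\<close>,
  which division by zero replaces by \<open>0\<close>. At \<open>\<bar>x\<bar> = 2\<close> both branches have the (limit) value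
  \<open>1 / 4\<close>; these points are put into the second branch because there the first one would divide by
  zero. Only integrals of \<open>psi\<close> against Lebesgue measure are used, so neither matters.
\<close>
definition psi :: "real \<Rightarrow> real" where
  "psi x =
     (if \<bar>x\<bar> < 2
      then 1 / pi * (4 * arctan (\<bar>x\<bar> / sqrt (4 - x\<^sup>2)) / \<bar>x\<bar> ^ 3 - sqrt (4 - x\<^sup>2) / x\<^sup>2)
      else 2 / \<bar>x\<bar> ^ 3)"

text \<open>\<open>Ln\<close> is the principal branch, with argument in \<open>(-pi, pi)\<close> at the non-real points \<open>z - s\<close>.\<close>
definition g_fun :: "complex \<Rightarrow> complex" where
  "g_fun z = (LINT s|lborel. Ln (z - of_real s) * of_real (psi s))"

definition l_const :: real where
  "l_const = 2 * (LINT s|lborel. ln \<bar>2 - s\<bar> * psi s)"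

definition phi_fun :: "complex \<Rightarrow> complex" where
  "phi_fun z = of_real (l_const / 2) - g_fun z"

text \<open>
  The product of the two principal roots is the square root of \<open>z\<^sup>2 - 1\<close> that is analytic
  outside \<open>[-1, 1]\<close> (the two jumps on \<open>(-\<infinity>, -1)\<close> cancel) and behaves like \<open>z\<close> at infinity.
\<close>
definition varphi :: "complex \<Rightarrow> complex" where
  "varphi z = z + csqrt (z - 1) * csqrt (z + 1)"

text \<open>
  The right-hand side of the expansion, with \<open>e1\<close> and \<open>e2\<close> in place of the two \<open>O(1/n)\<close> terms.
  Splitting \<open>(4 - z\<^sup>2) powr (-1/4)\<close> into principal powers of \<open>2 - z\<close> and \<open>z + 2\<close> fixes its branch.
\<close>
definition tc_expansion :: "real \<Rightarrow> nat \<Rightarrow> complex \<Rightarrow> complex \<Rightarrow> complex \<Rightarrow> complex" where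
  "tc_expansion \<alpha> n z e1 e2 =
     of_real (Gamma \<alpha> / sqrt (2 * pi) * real n powr (1/2 - real n / 2 - \<alpha>) * exp (real n / 2)) *
     ((2 - z) powr (-1/4) * (z + 2) powr (-1/4)) *
     (exp (\<i> * of_real (pi * (1/4 - \<alpha>)) - of_nat n * phi_fun z) *
        varphi (z / 2) powr of_real (2 * \<alpha> - 1/2) * (1 + e1) +
      exp (- \<i> * of_real (pi * (1/4 - \<alpha>)) + of_nat n * phi_fun z) *
        varphi (z / 2) powr of_real (- 2 * \<alpha> + 1/2) * (1 + e2))"

end

theory Submission
  imports Defs "HOL-Probability.Distributions" "HOL-Real_Asymp.Real_Asymp" "HOL-Complex_Analysis.Complex_Analysis"
begin

text \<open>
  The function \<open>F u = exp (n * u / z + (n / z\<^sup>2 - \<alpha>) * Ln (1 - z * u))\<close> satisfies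
  \<open>(1 - z * u) * F' = (\<alpha> * z - n * u) * F\<close>, so its Taylor coefficients are the Tricomi-Carlitz polynomials at
  \<open>z / sqrt n\<close> up to powers of \<open>sqrt n\<close>. The \<open>n\<close>-th one is the mean of \<open>F (exp (\<i> * \<theta>)) * exp (- \<i> * n * \<theta>)\<close> over a period.
  The exponent has the two saddles \<open>u = U\<close> and \<open>u = 1 / U\<close> with \<open>U + 1 / U = z\<close>, \<open>U = varphi (z / 2)\<close>, close to \<open>\<i>\<close> and \<open>- \<i>\<close>,
  and it is regular at \<open>z = 0\<close> although each of its terms is singular there; Laplace's method is therefore uniform
  in \<open>z\<close>. The critical values are \<open>1/2 + phi_fun z\<close> and \<open>1/2 - phi_fun z\<close>: writing \<open>psi\<close> as a mixture of truncated powers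
  and applying the mean value property to \<open>Ln (z - 2 cos f) = Ln U + Ln (1 - exp (\<i> * f) / U) + Ln (1 - exp (- \<i> * f) / U)\<close>
  gives \<open>g_fun\<close> in closed form.
\<close>

section \<open>A Laplace estimate\<close>

text \<open>Near the real axis the two summands of the expansion are of comparable size and may
  cancel, so an error relative to their sum is out of reach; errors are measured against the larger
  summand. The product of the summands does not depend on \<open>n\<close> and is close to 1/2 for
  small \<open>z\<close>. Hence the larger one is bounded below, and any bounded part of the contour
  integral is negligible after the normalisation by \<open>sqrt n * exp (- n / 2)\<close>. For
  uniformity down to \<open>z = 0\<close> the path is chosen in the angle plane: two straight
  segments of length about \<open>pi\<close> through the saddles, which lie near
  \<open>- pi / 2\<close> and \<open>pi / 2\<close>. Their directions are close to 1 and are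
  normalised so that the quadratic term of the phase is exactly \<open>- t\<^sup>2\<close>. Together
  they almost fill a period, and the remaining gaps lie near the angles 0 and \<open>pi\<close>,
  where the integrand is bounded independently of \<open>n\<close>. These directions are the source
  of the factor \<open>(4 - z\<^sup>2) powr (-1/4)\<close> and of the half power of
  \<open>varphi (z / 2)\<close>.\<close>

lemma norm_exp_diff_linear:
  fixes w :: complex
  shows "norm (exp w - 1 - w) \<le> max 1 (exp (Re w)) * norm w ^ 2"
proof -
  have "cmod (exp w - (\<Sum>i\<le>1. exp 0 * (w - 0) ^ i / fact i))
      \<le> max 1 (exp (Re w)) * cmod (w - 0) ^ Suc 1 / fact 1"
  proof (rule complex_Taylor[where S = "closed_segment 0 w" and f = "\<lambda>_. exp" and n = 1 and w = 0 and z = w])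
    fix x assume "x \<in> closed_segment 0 w"
    then obtain u where u: "0 \<le> u" "u \<le> 1" "x = of_real u * w"
      by (auto simp: in_segment scaleR_conv_of_real)
    \<comment> \<open>Real parts on the segment interpolate between 0 and \<open>Re w\<close>, so
      only the two end points matter for the size of \<open>exp\<close>.\<close>
    have "Re x \<le> max 0 (Re w)"
    proof (cases "Re w \<ge> 0")
      case True
      then show ?thesis using u mult_right_mono[of u 1 "Re w"] by simp
    next
      case False
      then show ?thesis using u by (simp add: mult_nonneg_nonpos)
    qed
    then show "cmod (exp x) \<le> max 1 (exp (Re w))"
      by (auto simp: max_def split: if_splits)
  next
    fix i x
    show "(exp has_field_derivative exp x) (at x within closed_segment 0 w)"
      by (auto intro!: derivative_eq_intros)
  qed auto
  then show ?thesis by (simp add: power2_eq_square algebra_simps)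
qed

text \<open>Half of the exponential decay is spent on the polynomial: \<open>1 + s\<close> is at
  most \<open>6 / k * exp (k * s / 6)\<close>, and cubing triples the exponent. The cube is the
  highest power of \<open>s = n * t\<^sup>2\<close> that occurs in the Laplace error.\<close>

lemma power3_le_exp:
  fixes s k :: real
  assumes "0 \<le> s" "0 < k" "k \<le> 1"
  shows "(1 + s) ^ 3 \<le> (6 / k) ^ 3 * exp (k * s / 2)"
proof -
  have "1 + s \<le> 6 / k * (1 + k * s / 6)"
    using assms by (simp add: field_simps)
  also have "\<dots> \<le> 6 / k * exp (k * s / 6)"
    using assms by (intro mult_left_mono) (auto intro: exp_ge_add_one_self)
  finally have "(1 + s) ^ 3 \<le> (6 / k * exp (k * s / 6)) ^ 3"
    using assms by (intro power_mono) auto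
  also have "\<dots> = (6 / k) ^ 3 * exp (k * s / 2)"
    by (simp only: power_mult_distrib exp_of_nat_mult[symmetric]) simp
  finally show ?thesis .
qed

text \<open>Normalisation of the normal density with variance \<open>1 / (2 * c)\<close>.\<close>

lemma has_integral_gaussian:
  fixes c :: real
  assumes "c > 0"
  shows "((\<lambda>x::real. exp (- c * x\<^sup>2)) has_integral sqrt (pi / c)) UNIV"
proof -
  define \<sigma> where "\<sigma> = 1 / sqrt (2 * c)"
  have \<sigma>: "\<sigma> > 0" "2 * \<sigma>\<^sup>2 = 1 / c"
    using assms by (auto simp: \<sigma>_def power_divide)
  have nd: "normal_density 0 \<sigma> x = exp (- c * x\<^sup>2) * (1 / sqrt (pi / c))" for x
  proof -
    have "2 * pi * \<sigma>\<^sup>2 = pi / c" using \<sigma>(2) by (simp add: field_simps)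
    moreover have "x\<^sup>2 / (2 * \<sigma>\<^sup>2) = c * x\<^sup>2" using assms by (simp only: \<sigma>(2)) simp
    ultimately show ?thesis by (simp add: normal_density_def)
  qed
  have "has_bochner_integral lborel (normal_density 0 \<sigma>) 1"
    using \<sigma>(1) by (simp add: has_bochner_integral_iff)
  then have "(normal_density 0 \<sigma> has_integral 1) UNIV"
    using has_integral_integral_lborel[of "normal_density 0 \<sigma>"] \<sigma>(1) by (simp add: has_bochner_integral_iff)
  then have "((\<lambda>x. normal_density 0 \<sigma> x * sqrt (pi / c)) has_integral 1 * sqrt (pi / c)) UNIV"
    by (rule has_integral_mult_left)
  then show ?thesis
    using assms by (simp add: nd)
qed

lemma integral_odd_eq_0:
  fixes f :: "real \<Rightarrow> complex"
  assumes "\<And>t. f (- t) = - f t"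
  shows "integral {-h..h} f = 0"
proof -
  have "integral {-h..h} f = integral {-h..h} (\<lambda>t. f (- t))"
    using Henstock_Kurzweil_Integration.integral_reflect_real[of h "-h" f] by simp
  also have "\<dots> = - integral {-h..h} f"
    by (simp add: assms)
  finally show ?thesis by simp
qed

text \<open>
  The terms \<open>c1 * t\<close> and \<open>n * c3 * t ^ 3\<close> are too large for the error, but they are odd and integrate to zero
  against the Gaussian.
\<close>

lemma laplace_pointwise:
  fixes P R c1 c3 :: complex and t h \<kappa> M s :: real and n :: nat
  assumes "n > 0" and k: "0 < \<kappa>" "\<kappa> \<le> 1" and h: "\<bar>t\<bar> \<le> h" and M: "norm c1 \<le> M" "norm c3 \<le> M"
    and P: "norm (P + t\<^sup>2 - c3 * t ^ 3) \<le> M * t ^ 4" "Re P \<le> - \<kappa> * t\<^sup>2"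
    and R: "norm (R - 1 - c1 * t) \<le> M * t\<^sup>2"
  shows "norm (exp (n * P) * R - exp (- (real n * t\<^sup>2)) * (1 + (c1 * t + n * c3 * t ^ 3)))
    \<le> ((6 / \<kappa>) ^ 3 * (M + (1 + M * h) * (M\<^sup>2 * (1 + h)\<^sup>2 + M) + M\<^sup>2)) / n * exp (- (n * \<kappa> / 2) * t\<^sup>2)"
proof -
  define s where "s = n * t\<^sup>2"
  define q where "q = P + t\<^sup>2"
  have s: "s \<ge> 0" by (simp add: s_def)
  have M0: "M \<ge> 0" using M(1) norm_ge_zero order.trans by blast
  have h0: "h \<ge> 0" using h by linarith
  have n0: "real n > 0" using assms(1) by simp
  have nt2: "t\<^sup>2 = s / n" using n0 by (simp add: s_def)
  have nt4: "t ^ 4 = s\<^sup>2 / n\<^sup>2" using n0 by (simp add: s_def power_mult_distrib flip: power_mult)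
  have nt6: "t ^ 6 = s ^ 3 / n ^ 3" using n0 by (simp add: s_def power_mult_distrib flip: power_mult)
  have eP: "norm (exp (n * P)) \<le> exp (- \<kappa> * s)"
  proof -
    have "n * Re P \<le> n * (- \<kappa> * t\<^sup>2)" using P(2) n0 by (intro mult_left_mono) auto
    then show ?thesis by (simp add: s_def algebra_simps)
  qed
  have es: "exp (- s) \<le> exp (- \<kappa> * s)" using k s mult_right_mono[of \<kappa> 1 s] by simp
  have q: "norm q \<le> M * (1 + h) * \<bar>t\<bar> ^ 3"
  proof -
    have "norm q \<le> norm (P + t\<^sup>2 - c3 * t ^ 3) + norm (c3 * t ^ 3)"
      unfolding q_def by (metis norm_triangle_ineq diff_add_cancel)
    also have "\<dots> \<le> M * t ^ 4 + M * \<bar>t\<bar> ^ 3"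
      using P(1) M(2) by (intro add_mono) (auto simp: norm_mult norm_power intro!: mult_right_mono)
    also have "t ^ 4 = \<bar>t\<bar> * \<bar>t\<bar> ^ 3" by (simp add: power_abs eval_nat_numeral flip: abs_mult)
    also have "M * (\<bar>t\<bar> * \<bar>t\<bar> ^ 3) \<le> M * (h * \<bar>t\<bar> ^ 3)"
      using h M0 by (intro mult_left_mono mult_right_mono) auto
    finally show ?thesis by (simp add: algebra_simps)
  qed
  have q2: "norm (n * q) ^ 2 \<le> M\<^sup>2 * (1 + h)\<^sup>2 * s ^ 3 / n"
  proof -
    have "norm (n * q) ^ 2 \<le> (n * (M * (1 + h) * \<bar>t\<bar> ^ 3)) ^ 2"
      using q n0 by (intro power_mono) (auto simp: norm_mult)
    also have "\<dots> = n\<^sup>2 * (M\<^sup>2 * (1 + h)\<^sup>2 * t ^ 6)"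
      by (simp add: power_mult_distrib power_abs flip: power_mult)
    also have "\<dots> = M\<^sup>2 * (1 + h)\<^sup>2 * s ^ 3 / n"
      using n0 by (simp add: nt6 power2_eq_square power3_eq_cube)
    finally show ?thesis .
  qed
  have nq: "n * P = of_real (- s) + n * q"
    by (simp add: q_def s_def algebra_simps)
  \<comment> \<open>The factor \<open>exp (- s) * max 1 (exp (Re (n * q)))\<close> is the maximum of
    \<open>exp (- s)\<close> and \<open>norm (exp (n * P))\<close>. Both are at most
    \<open>exp (- \<kappa> * s)\<close>, so \<open>Re q\<close> is never estimated by
    itself.\<close>
  have A: "norm (exp (n * P) - exp (- s) * (1 + n * q)) \<le> exp (- \<kappa> * s) * (M\<^sup>2 * (1 + h)\<^sup>2 * s ^ 3 / n)"
  proof -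
    have "exp (n * P) - exp (- s) * (1 + n * q) = exp (- s) * (exp (n * q) - 1 - n * q)"
      unfolding nq exp_add exp_of_real by (simp add: algebra_simps)
    also have "norm \<dots> = exp (- s) * norm (exp (n * q) - 1 - n * q)"
      by (simp add: norm_mult)
    also have "\<dots> \<le> exp (- s) * (max 1 (exp (Re (n * q))) * norm (n * q) ^ 2)"
      by (intro mult_left_mono norm_exp_diff_linear) auto
    also have "\<dots> = max (exp (- s)) (exp (- s) * exp (Re (n * q))) * norm (n * q) ^ 2"
      by (simp add: max_mult_distrib_left)
    also have "exp (- s) * exp (Re (n * q)) = norm (exp (n * P))"
      unfolding norm_exp_eq_Re nq by (simp flip: exp_add)
    also have "max (exp (- s)) (norm (exp (n * P))) * norm (n * q) ^ 2 \<le> exp (- \<kappa> * s) * (M\<^sup>2 * (1 + h)\<^sup>2 * s ^ 3 / n)"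
      using es eP q2 by (intro mult_mono) (auto simp del: norm_exp_eq_Re)
    finally show ?thesis .
  qed
  have B: "norm (exp (- s) * (1 + n * q) - exp (- s) * (1 + n * c3 * t ^ 3)) \<le> exp (- \<kappa> * s) * (M * s\<^sup>2 / n)"
  proof -
    have "exp (- s) * (1 + n * q) - exp (- s) * (1 + n * c3 * t ^ 3) = exp (- s) * (n * (P + t\<^sup>2 - c3 * t ^ 3))"
      by (simp add: q_def algebra_simps)
    also have "norm \<dots> = exp (- s) * (n * norm (P + t\<^sup>2 - c3 * t ^ 3))"
      by (simp add: norm_mult)
    also have "\<dots> \<le> exp (- \<kappa> * s) * (n * (M * t ^ 4))"
      using es P(1) by (intro mult_mono) auto
    also have "n * (M * t ^ 4) = M * s\<^sup>2 / n"
      using n0 by (simp add: nt4 power2_eq_square)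
    finally show ?thesis .
  qed
  have C: "norm (1 + c1 * t) \<le> 1 + M * h"
  proof -
    have "norm (1 + c1 * t) \<le> norm (1::complex) + norm (c1 * t)" by (rule norm_triangle_ineq)
    also have "norm (c1 * t) \<le> M * h" using M h M0 by (auto simp: norm_mult intro!: mult_mono)
    finally show ?thesis by simp
  qed
  have D: "norm (exp (- s) * (n * c3 * t ^ 3) * (c1 * t)) \<le> exp (- \<kappa> * s) * (M\<^sup>2 * s\<^sup>2 / n)"
  proof -
    have "norm (exp (- s) * (n * c3 * t ^ 3) * (c1 * t)) = exp (- s) * (n * (norm c3 * norm c1) * t ^ 4)"
      by (simp add: norm_mult norm_power eval_nat_numeral flip: abs_mult)
    also have "\<dots> \<le> exp (- \<kappa> * s) * (n * (M * M) * t ^ 4)"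
      using es M M0 by (intro mult_mono mult_left_mono mult_right_mono) auto
    also have "n * (M * M) * t ^ 4 = M\<^sup>2 * s\<^sup>2 / n"
      using n0 by (simp add: nt4 power2_eq_square)
    finally show ?thesis .
  qed
  have E: "norm (exp (n * P) * (R - 1 - c1 * t)) \<le> exp (- \<kappa> * s) * (M * s / n)"
  proof -
    have "norm (exp (n * P) * (R - 1 - c1 * t)) \<le> exp (- \<kappa> * s) * (M * t\<^sup>2)"
      unfolding norm_mult using eP R by (intro mult_mono) (auto simp del: norm_exp_eq_Re)
    then show ?thesis by (simp add: nt2)
  qed
  define Q where "Q = M\<^sup>2 * (1 + h)\<^sup>2"
  have Q0: "Q \<ge> 0" by (simp add: Q_def)
  \<comment> \<open>The three parts are the amplitude remainder, the phase remainder times the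
    linear amplitude, and the even product of the two odd corrections. The last one is not part of
    the subtracted odd term and is itself of order \<open>1 / n\<close>.\<close>
  have "exp (n * P) * R - exp (- (real n * t\<^sup>2)) * (1 + (c1 * t + n * c3 * t ^ 3)) =
      exp (n * P) * (R - 1 - c1 * t) +
      ((exp (n * P) - exp (- s) * (1 + n * q)) + (exp (- s) * (1 + n * q) - exp (- s) * (1 + n * c3 * t ^ 3))) * (1 + c1 * t) +
      exp (- s) * (n * c3 * t ^ 3) * (c1 * t)"
    by (simp add: s_def algebra_simps)
  also have "norm \<dots> \<le> exp (- \<kappa> * s) * (M * s / n) +
      (exp (- \<kappa> * s) * (M\<^sup>2 * (1 + h)\<^sup>2 * s ^ 3 / n) + exp (- \<kappa> * s) * (M * s\<^sup>2 / n)) * (1 + M * h) +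
      exp (- \<kappa> * s) * (M\<^sup>2 * s\<^sup>2 / n)"
  proof (intro norm_triangle_le add_mono D E)
    show "norm (((exp (n * P) - exp (- s) * (1 + n * q)) + (exp (- s) * (1 + n * q) - exp (- s) * (1 + n * c3 * t ^ 3))) * (1 + c1 * t))
      \<le> (exp (- \<kappa> * s) * (M\<^sup>2 * (1 + h)\<^sup>2 * s ^ 3 / n) + exp (- \<kappa> * s) * (M * s\<^sup>2 / n)) * (1 + M * h)"
      unfolding norm_mult using s M0
      by (intro mult_mono C norm_triangle_le add_mono A B) (auto intro!: add_nonneg_nonneg mult_nonneg_nonneg divide_nonneg_nonneg)
  qed
  also have "\<dots> = exp (- \<kappa> * s) / n * (M * s + (1 + M * h) * (Q * s ^ 3 + M * s\<^sup>2) + M\<^sup>2 * s\<^sup>2)"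
    using n0 by (simp add: field_simps Q_def)
  also have "\<dots> \<le> exp (- \<kappa> * s) / n * (M * (1 + s) ^ 3 + (1 + M * h) * (Q * (1 + s) ^ 3 + M * (1 + s) ^ 3) + M\<^sup>2 * (1 + s) ^ 3)"
  proof -
    have *: "s \<le> (1 + s) ^ 3" "s\<^sup>2 \<le> (1 + s) ^ 3" "s ^ 3 \<le> (1 + s) ^ 3"
      using s by (auto simp: power2_eq_square power3_eq_cube algebra_simps)
    show ?thesis
      by (intro mult_left_mono add_mono *) (auto intro!: add_nonneg_nonneg mult_nonneg_nonneg M0 h0 Q0)
  qed
  also have "\<dots> = exp (- \<kappa> * s) / n * (M + (1 + M * h) * (Q + M) + M\<^sup>2) * (1 + s) ^ 3"
    by (simp add: algebra_simps)
  also have "\<dots> \<le> exp (- \<kappa> * s) / n * (M + (1 + M * h) * (Q + M) + M\<^sup>2) * ((6 / \<kappa>) ^ 3 * exp (\<kappa> * s / 2))"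
    using s k by (intro mult_left_mono power3_le_exp) (auto intro!: add_nonneg_nonneg mult_nonneg_nonneg divide_nonneg_nonneg M0 h0 Q0)
  also have "\<dots> = ((6 / \<kappa>) ^ 3 * (M + (1 + M * h) * (Q + M) + M\<^sup>2)) / n * (exp (- \<kappa> * s) * exp (\<kappa> * s / 2))"
    by (simp add: field_simps)
  also have "exp (- \<kappa> * s) * exp (\<kappa> * s / 2) = exp (- (n * \<kappa> / 2) * t\<^sup>2)"
    by (simp add: s_def flip: exp_add)
  finally show ?thesis unfolding Q_def .
qed

text \<open>The first summand comes from the pointwise estimate inside the interval,
  \<open>(6 / \<kappa>) ^ 3 / h\<^sup>2\<close> from completing the Gaussian to the whole line. The
  factor \<open>sqrt (2 / \<kappa>)\<close> compares the integral of the majorant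
  \<open>exp (- (n * \<kappa> / 2) * t\<^sup>2)\<close> with \<open>sqrt (pi / n)\<close>.\<close>

definition laplace_const :: "real \<Rightarrow> real \<Rightarrow> real \<Rightarrow> real" where
  "laplace_const \<kappa> h M =
     ((6 / \<kappa>) ^ 3 * (M + (1 + M * h) * (M\<^sup>2 * (1 + h)\<^sup>2 + M) + M\<^sup>2) + (6 / \<kappa>) ^ 3 / h\<^sup>2) * sqrt (2 / \<kappa>)"

lemma laplace_const_nonneg:
  assumes "0 < \<kappa>" "0 < h" "0 \<le> M"
  shows "laplace_const \<kappa> h M \<ge> 0"
  using assms by (auto simp: laplace_const_def intro!: add_nonneg_nonneg mult_nonneg_nonneg divide_nonneg_nonneg)

lemma laplace_integral:
  fixes \<kappa> h M :: real and n :: nat and P R :: "real \<Rightarrow> complex" and c1 c3 :: complex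
  assumes k: "0 < \<kappa>" "\<kappa> \<le> 1" and "h > 0" and n: "n > 0"
    and cont: "continuous_on {-h..h} P" "continuous_on {-h..h} R"
    and c: "norm c1 \<le> M" "norm c3 \<le> M"
    and bnd: "\<And>t. \<bar>t\<bar> \<le> h \<Longrightarrow> norm (P t + t\<^sup>2 - c3 * t ^ 3) \<le> M * t ^ 4"
      "\<And>t. \<bar>t\<bar> \<le> h \<Longrightarrow> Re (P t) \<le> - \<kappa> * t\<^sup>2"
      "\<And>t. \<bar>t\<bar> \<le> h \<Longrightarrow> norm (R t - 1 - c1 * t) \<le> M * t\<^sup>2"
  shows "norm (integral {-h..h} (\<lambda>t. exp (n * P t) * R t) - sqrt (pi / n)) \<le> laplace_const \<kappa> h M * sqrt (pi / n) / n"
proof -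
  have "M \<ge> 0" using c(1) norm_ge_zero order.trans by blast
  define K1 where "K1 = (6 / \<kappa>) ^ 3 * (M + (1 + M * h) * (M\<^sup>2 * (1 + h)\<^sup>2 + M) + M\<^sup>2)"
  define K2 where "K2 = (6 / \<kappa>) ^ 3 / h\<^sup>2"
  define K where "K = K1 + K2"
  have K12: "K1 \<ge> 0" "K2 \<ge> 0"
    using k \<open>h > 0\<close> \<open>M \<ge> 0\<close> by (auto simp: K1_def K2_def intro!: add_nonneg_nonneg mult_nonneg_nonneg)
    define f where "f = (\<lambda>t. exp (n * P t) * R t)"
    define q where "q = (\<lambda>t::real. exp (- (real n * t\<^sup>2)) * (c1 * t + n * c3 * t ^ 3))"
    define e where "e = (\<lambda>t::real. complex_of_real (exp (- (real n * t\<^sup>2))))"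
    have "f integrable_on {-h..h}"
      unfolding f_def by (intro integrable_continuous_interval continuous_intros cont)
    then have f: "((\<lambda>t. if t \<in> {-h..h} then f t else 0) has_integral integral {-h..h} f) UNIV"
      using has_integral_restrict_UNIV by blast
    have "q integrable_on {-h..h}"
      unfolding q_def by (intro integrable_continuous_interval continuous_intros)
    moreover have "integral {-h..h} q = 0"
      by (rule integral_odd_eq_0) (simp add: q_def algebra_simps)
    ultimately have q: "((\<lambda>t. if t \<in> {-h..h} then q t else 0) has_integral 0) UNIV"
      by (metis has_integral_restrict_UNIV integrable_integral)
    have e: "(e has_integral of_real (sqrt (pi / n))) UNIV"
      unfolding e_def using has_integral_gaussian[of n] n
      by (intro has_integral_of_real) auto
    have g: "((\<lambda>t. K / n * exp (- (n * \<kappa> / 2) * t\<^sup>2)) has_integral K / n * sqrt (pi / (n * \<kappa> / 2))) UNIV"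
      using has_integral_gaussian[of "n * \<kappa> / 2"] n k by (intro has_integral_mult_right) auto
    define D where "D = (\<lambda>t. (if t \<in> {-h..h} then f t else 0) - (if t \<in> {-h..h} then q t else 0) - e t)"
    have D: "(D has_integral (integral {-h..h} f - 0 - of_real (sqrt (pi / n)))) UNIV"
      unfolding D_def by (intro has_integral_diff f q e)
    have "norm (D t) \<le> K / n * exp (- (n * \<kappa> / 2) * t\<^sup>2)" for t
    proof (cases "t \<in> {-h..h}")
      case True
      have "D t = exp (n * P t) * R t - exp (- (real n * t\<^sup>2)) * (1 + (c1 * t + n * c3 * t ^ 3))"
        using True by (simp add: D_def f_def q_def e_def algebra_simps)
      also have "norm \<dots> \<le> K1 / n * exp (- (n * \<kappa> / 2) * t\<^sup>2)"
        unfolding K1_def by (rule laplace_pointwise) (use n k True c bnd in auto)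
      also have "\<dots> \<le> K / n * exp (- (n * \<kappa> / 2) * t\<^sup>2)"
        using K12 by (auto simp: K_def intro!: mult_right_mono divide_right_mono)
      finally show ?thesis .
    next
      case False
      then have "h\<^sup>2 \<le> t\<^sup>2" using \<open>h > 0\<close> by (auto intro!: power2_le_iff_abs_le[THEN iffD2] simp: abs_le_square_iff[symmetric])
      define s where "s = n * t\<^sup>2"
      have s: "s \<ge> 0" by (simp add: s_def)
      \<comment> \<open>Inserting this factor produces \<open>s / (n * h\<^sup>2)\<close>, that is,
        the gain \<open>1 / n\<close> outside the interval; the surplus power of \<open>s\<close> is
        absorbed by the exponential.\<close>
      have 1: "1 \<le> t\<^sup>2 / h\<^sup>2" using \<open>h\<^sup>2 \<le> t\<^sup>2\<close> \<open>h > 0\<close> by simp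
      have "norm (D t) = 1 * exp (- s)" using False unfolding D_def e_def s_def by (simp only: if_False norm_minus_cancel diff_0 diff_0_right) simp
      also have "\<dots> \<le> t\<^sup>2 / h\<^sup>2 * exp (- s)" by (rule mult_right_mono[OF 1]) simp
      also have "\<dots> = s * (exp (- s) / (n * h\<^sup>2))" using n by (simp add: s_def)
      also have "\<dots> \<le> ((6 / \<kappa>) ^ 3 * exp (\<kappa> * s / 2)) * (exp (- \<kappa> * s) / (n * h\<^sup>2))"
      proof (rule mult_mono)
        have "s \<le> (1 + s) ^ 3" using s by (auto simp: power3_eq_cube algebra_simps)
        also have "\<dots> \<le> (6 / \<kappa>) ^ 3 * exp (\<kappa> * s / 2)" by (intro power3_le_exp s k)
        finally show "s \<le> (6 / \<kappa>) ^ 3 * exp (\<kappa> * s / 2)" .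
        show "exp (- s) / (n * h\<^sup>2) \<le> exp (- \<kappa> * s) / (n * h\<^sup>2)"
          using k s mult_right_mono[of \<kappa> 1 s] by (intro divide_right_mono) auto
      qed (use k in auto)
      also have "\<dots> = K2 / n * (exp (\<kappa> * s / 2) * exp (- \<kappa> * s))"
        by (simp add: K2_def mult_ac)
      also have "exp (\<kappa> * s / 2) * exp (- \<kappa> * s) = exp (- (n * \<kappa> / 2) * t\<^sup>2)"
        by (simp add: s_def flip: exp_add)
      also have "K2 / n * \<dots> \<le> K / n * exp (- (n * \<kappa> / 2) * t\<^sup>2)"
        using K12 by (auto simp: K_def intro!: mult_right_mono divide_right_mono)
      finally show ?thesis .
    qed
    then have "norm (integral UNIV D) \<le> integral UNIV (\<lambda>t. K / n * exp (- (n * \<kappa> / 2) * t\<^sup>2))"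
      using D g by (intro integral_norm_bound_integral) (auto simp: has_integral_integrable)
    also have "integral UNIV D = integral {-h..h} f - sqrt (pi / n)"
      using D by (simp add: integral_unique)
    also have "integral UNIV (\<lambda>t. K / n * exp (- (n * \<kappa> / 2) * t\<^sup>2)) = K / n * sqrt (pi / (n * \<kappa> / 2))"
      by (rule integral_unique[OF g])
    also have "\<dots> = K * sqrt (2 / \<kappa>) * sqrt (pi / n) / n"
      by (simp add: real_sqrt_divide real_sqrt_mult mult_ac)
    finally show ?thesis
      by (simp add: f_def laplace_const_def K_def K1_def K2_def)
qed

section \<open>A ratio of Gamma functions\<close>

text \<open>Wendel's inequality: the logarithm of Gamma is convex between \<open>x\<close> and
  \<open>x + 1\<close>, and Gamma grows by the factor \<open>x\<close> there.\<close>

lemma Gamma_real_Wendel_upper: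
  fixes x s :: real
  assumes "x > 0" "0 \<le> s" "s \<le> 1"
  shows "Gamma (x + s) \<le> x powr s * Gamma x"
proof -
  have pos: "Gamma x > 0" "Gamma (x + s) > 0" "Gamma (x + 1) > 0"
    using assms by (auto intro!: Gamma_real_pos)
  have "(ln \<circ> Gamma) ((1 - s) *\<^sub>R x + s *\<^sub>R (x + 1)) \<le> (1 - s) * (ln \<circ> Gamma) x + s * (ln \<circ> Gamma) (x + 1)"
    using assms by (intro convex_onD[OF log_convex_Gamma_real]) auto
  also have "(1 - s) *\<^sub>R x + s *\<^sub>R (x + 1) = x + s" by (simp add: algebra_simps)
  finally have "ln (Gamma (x + s)) \<le> (1 - s) * ln (Gamma x) + s * ln (Gamma (x + 1))"
    by simp
  also have "Gamma (x + 1) = x * Gamma x"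
    using assms by (intro Gamma_plus1) (auto elim!: nonpos_Ints_cases)
  also have "ln (x * Gamma x) = ln x + ln (Gamma x)"
    using assms pos by (intro ln_mult_pos) auto
  finally have "ln (Gamma (x + s)) \<le> ln (x powr s * Gamma x)"
    using assms pos by (subst ln_mult_pos) (auto simp: ln_powr algebra_simps)
  then show ?thesis using pos assms by simp
qed

text \<open>Wendel's bound is used twice, with the step \<open>s\<close> from \<open>x\<close> for
  the lower estimate and with the step \<open>1 - s\<close> from \<open>x + s\<close> for the upper
  one. The resulting upper bound is \<open>(1 + s / x) powr (1 - s)\<close>.\<close>

lemma Gamma_ratio_unit:
  fixes x s :: real
  assumes "x > 0" "0 \<le> s" "s \<le> 1"
  shows "\<bar>Gamma (x + 1) / Gamma (x + s) * x powr (s - 1) - 1\<bar> \<le> 1 / x"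
proof -
  have pos: "Gamma x > 0" "Gamma (x + s) > 0" "Gamma (x + 1) > 0"
    using assms by (auto intro!: Gamma_real_pos)
  have G1: "Gamma (x + 1) = x * Gamma x"
    using assms by (intro Gamma_plus1) (auto elim!: nonpos_Ints_cases)
  let ?r = "Gamma (x + 1) / Gamma (x + s) * x powr (s - 1)"
  have "1 \<le> ?r"
    using Gamma_real_Wendel_upper[OF assms] pos assms unfolding G1 by (simp add: powr_diff field_simps)
  moreover have "?r \<le> 1 + 1 / x"
  proof -
    have "Gamma (x + s + (1 - s)) \<le> (x + s) powr (1 - s) * Gamma (x + s)"
      using assms by (intro Gamma_real_Wendel_upper) auto
    then have "Gamma (x + 1) / Gamma (x + s) \<le> (x + s) powr (1 - s)"
      using pos by (simp add: field_simps)
    then have "?r \<le> (x + s) powr (1 - s) * x powr (s - 1)"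
      by (intro mult_right_mono) auto
    also have "\<dots> = (1 + s / x) powr (1 - s)"
    proof -
      have "1 + s / x = (x + s) / x" using assms by (simp add: field_simps)
      then show ?thesis using assms by (simp add: powr_divide powr_diff)
    qed
    also have "\<dots> \<le> (1 + s / x) powr 1"
      using assms by (intro powr_mono) auto
    also have "\<dots> \<le> 1 + 1 / x" using assms by (simp add: divide_right_mono)
    finally show ?thesis .
  qed
  ultimately show ?thesis by (simp add: abs_le_iff)
qed

text \<open>Raising the parameter from \<open>b\<close> to \<open>b + 1\<close> multiplies the ratio
  by \<open>x / (x + b)\<close>, which differs from 1 by at most \<open>b / x\<close>. Finitely many
  such steps lead from a parameter in the unit interval to \<open>a\<close>.\<close>

lemma Gamma_ratio_asymp:
  fixes a :: real
  assumes "a > 0"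
  shows "\<exists>C\<ge>0. \<forall>x\<ge>1. \<bar>Gamma (x + 1) / Gamma (x + a) * x powr (a - 1) - 1\<bar> \<le> C / x"
proof -
  define k where "k = nat (\<lceil>a\<rceil> - 1)"
  define s where "s = a - k"
  have s: "0 \<le> s" "s \<le> 1" using assms unfolding s_def k_def by linarith+
  have "s + real k > 0" using assms by (simp add: s_def)
  then have "\<exists>C\<ge>0. \<forall>x\<ge>1. \<bar>Gamma (x + 1) / Gamma (x + (s + k)) * x powr ((s + k) - 1) - 1\<bar> \<le> C / x"
  proof (induction k)
    case 0
    show ?case using Gamma_ratio_unit[OF _ s] by (intro exI[of _ 1]) auto
  next
    case (Suc k)
    have "\<exists>C\<ge>0. \<forall>x\<ge>1. \<bar>Gamma (x + 1) / Gamma (x + (s + k)) * x powr ((s + k) - 1) - 1\<bar> \<le> C / x"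
    proof (cases "s + real k > 0")
      case True
      then show ?thesis by (rule Suc.IH)
    next
      case False
      then have "s = 0" "k = 0" using s by auto
      then show ?thesis using Gamma_ratio_unit[of _ 0] by (intro exI[of _ 1]) auto
    qed
    then obtain C where C: "C \<ge> 0" "\<And>x. x \<ge> 1 \<Longrightarrow> \<bar>Gamma (x + 1) / Gamma (x + (s + k)) * x powr ((s + k) - 1) - 1\<bar> \<le> C / x"
      by blast
    define b where "b = s + k"
    have b: "b \<ge> 0" using s by (simp add: b_def)
    show ?case
    proof (intro exI[of _ "C + b"] conjI allI impI)
      show "C + b \<ge> 0" using C b by simp
      fix x :: real assume x: "x \<ge> 1"
      define r where "r = Gamma (x + 1) / Gamma (x + b) * x powr (b - 1)"
      define y where "y = x / (x + b)"
      have y: "0 \<le> y" "y \<le> 1" using x b by (auto simp: y_def)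
      have y1: "\<bar>y - 1\<bar> \<le> b / x"
      proof -
        have "y - 1 = - (b / (x + b))" using x b by (simp add: y_def field_simps)
        then have "\<bar>y - 1\<bar> = b / (x + b)" using x b by simp
        also have "\<dots> \<le> b / x" using x b by (intro divide_left_mono) auto
        finally show ?thesis .
      qed
      have "Gamma (x + b + 1) = (x + b) * Gamma (x + b)"
        using x b by (intro Gamma_plus1) (auto elim!: nonpos_Ints_cases)
      then have "Gamma (x + 1) / Gamma (x + (s + Suc k)) * x powr ((s + Suc k) - 1) = r * y"
        using x by (simp add: r_def y_def b_def add_ac powr_diff powr_add)
      also have "\<bar>r * y - 1\<bar> \<le> \<bar>r - 1\<bar> * y + \<bar>y - 1\<bar>"
      proof -
        have "r * y - 1 = (r - 1) * y + (y - 1)" by (simp add: algebra_simps)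
        then show ?thesis using y by (metis abs_triangle_ineq abs_mult abs_of_nonneg)
      qed
      also have "\<dots> \<le> C / x * 1 + b / x"
        using C(2)[OF x] y y1 C(1) x by (intro add_mono mult_mono) (auto simp: r_def b_def)
      finally show "\<bar>Gamma (x + 1) / Gamma (x + (s + Suc k)) * x powr ((s + Suc k) - 1) - 1\<bar> \<le> (C + b) / x"
        by (simp add: add_divide_distrib)
    qed
  qed
  then show ?thesis by (simp add: s_def)
qed

section \<open>The generating function\<close>

text \<open>Cauchy's formula on the unit circle; the derivative of the path cancels one of the
  \<open>k + 1\<close> powers, leaving a Fourier coefficient. It is used for the polynomials as well
  as for the mean values of logarithms.\<close>

lemma has_integral_circle_coeff:
  fixes h :: "complex \<Rightarrow> complex"
  assumes "h holomorphic_on ball 0 R" "R > 1"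
  shows "((\<lambda>t. h (cis t) * cis (- (real k * t))) has_integral 2 * pi * ((deriv ^^ k) h 0 / fact k)) {0..2 * pi}"
proof -
  have sub: "cball 0 1 \<subseteq> ball (0::complex) R" using assms(2) by auto
  have "((\<lambda>u. h u / (u - 0) ^ Suc k) has_contour_integral (2 * pi * \<i> / fact k * (deriv ^^ k) h 0)) (circlepath 0 1)"
    using assms sub
    by (intro Cauchy_has_contour_integral_higher_derivative_circlepath)
       (auto intro!: holomorphic_on_imp_continuous_on intro: holomorphic_on_subset)
  then have "((\<lambda>t. h (0 + complex_of_real 1 * cis t) / (0 + complex_of_real 1 * cis t - 0) ^ Suc k * complex_of_real 1 * \<i> * cis t)
      has_integral 2 * pi * \<i> / fact k * (deriv ^^ k) h 0) {0..2 * pi}"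
    unfolding circlepath_def by (subst (asm) has_contour_integral_part_circlepath_iff) auto
  then have "((\<lambda>t. - \<i> * (h (cis t) / cis t ^ Suc k * \<i> * cis t)) has_integral - \<i> * (2 * pi * \<i> / fact k * (deriv ^^ k) h 0)) {0..2 * pi}"
    by (intro has_integral_mult_right) simp
  moreover have "- \<i> * (h (cis t) / cis t ^ Suc k * \<i> * cis t) = h (cis t) * cis (- (real k * t))" for t
  proof -
    have "cis (- (real k * t)) = 1 / cis t ^ k"
      by (simp add: Complex.DeMoivre divide_inverse flip: cis_inverse)
    then show ?thesis by (simp add: field_simps)
  qed
  moreover have "- \<i> * (2 * pi * \<i> / fact k * (deriv ^^ k) h 0) = 2 * pi * ((deriv ^^ k) h 0 / fact k)"
    by (simp add: field_simps)
  ultimately show ?thesis by simp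
qed

definition tc_eval :: "real \<Rightarrow> nat \<Rightarrow> complex \<Rightarrow> complex" where
  "tc_eval a n x = poly (map_poly complex_of_real (tricomi_carlitz a n)) x"

lemma tc_eval_simps:
  "tc_eval a 0 x = 1" "tc_eval a (Suc 0) x = of_real a * x"
  "(of_nat n + 2) * tc_eval a (Suc (Suc n)) x = (of_nat n + 1 + of_real a) * x * tc_eval a (Suc n) x - tc_eval a n x"
proof -
  have sm: "map_poly complex_of_real (smult c p) = smult (of_real c) (map_poly of_real p)" for c p
    by (simp add: poly_eq_iff coeff_map_poly)
  have di: "map_poly complex_of_real (p - q) = map_poly of_real p - map_poly of_real q" for p q
    by (simp add: poly_eq_iff coeff_map_poly)
  show "tc_eval a 0 x = 1" by (simp add: tc_eval_def)
  show "tc_eval a (Suc 0) x = of_real a * x" by (simp add: tc_eval_def map_poly_pCons)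
  have "of_nat n + 2 \<noteq> (0::complex)"
    by (metis of_nat_add of_nat_eq_0_iff of_nat_numeral add_is_0 zero_neq_numeral)
  then show "(of_nat n + 2) * tc_eval a (Suc (Suc n)) x = (of_nat n + 1 + of_real a) * x * tc_eval a (Suc n) x - tc_eval a n x"
    by (simp add: tc_eval_def sm di map_poly_pCons)
qed

text \<open>The generating function \<open>exp (w / x + (1 - a * x\<^sup>2) / x\<^sup>2 * Ln (1 - x
  * w))\<close> with \<open>x = z / sqrt n\<close> and \<open>w = sqrt n * u\<close>. The argument
  \<open>n\<close> is a scaling parameter; the index of a Taylor coefficient is independent of
  it.\<close>

definition gen_fun :: "real \<Rightarrow> nat \<Rightarrow> complex \<Rightarrow> complex \<Rightarrow> complex" where
  "gen_fun a n z u = exp (of_nat n * (u / z) + (of_nat n / z\<^sup>2 - of_real a) * Ln (1 - z * u))"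

lemma one_minus_notin_nonpos_Reals:
  fixes w :: complex
  assumes "norm w < 1"
  shows "1 - w \<notin> \<real>\<^sub>\<le>\<^sub>0"
  using assms complex_Re_le_cmod[of w] by (auto simp: complex_nonpos_Reals_iff)

lemma gen_fun_has_derivative:
  fixes z u :: complex and a :: real and n :: nat
  assumes "z \<noteq> 0" "norm (z * u) < 1"
  shows "(gen_fun a n z has_field_derivative gen_fun a n z u * (of_real a * z - of_nat n * u) / (1 - z * u)) (at u)"
proof -
  have "1 - z * u \<notin> \<real>\<^sub>\<le>\<^sub>0" using assms(2) by (rule one_minus_notin_nonpos_Reals)
  moreover from this have nz: "1 - z * u \<noteq> 0" by auto
  ultimately have "(gen_fun a n z has_field_derivative
      gen_fun a n z u * (of_nat n / z + (of_nat n / z\<^sup>2 - of_real a) * (- z / (1 - z * u)))) (at u)"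
    unfolding gen_fun_def using assms(1) by (auto intro!: derivative_eq_intros simp: divide_inverse)
  also have "of_nat n / z + (of_nat n / z\<^sup>2 - of_real a) * (- z / (1 - z * u)) = (of_real a * z - of_nat n * u) / (1 - z * u)"
  proof -
    have "of_nat n / z + (of_nat n / z\<^sup>2 - of_real a) * (- z / y) = (of_real a * z - of_nat n * u) / y" if "y \<noteq> 0" "y = 1 - z * u" for y
    proof -
      have u: "u = (1 - y) / z" using that assms(1) by (simp add: field_simps)
      show ?thesis unfolding u using that(1) assms(1) by (simp add: field_simps power2_eq_square)
    qed
    then show ?thesis using nz by simp
  qed
  finally show ?thesis by simp
qed

lemma gen_fun_holomorphic:
  fixes z :: complex
  assumes "z \<noteq> 0"
  shows "gen_fun a n z holomorphic_on ball 0 (1 / norm z)"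
  unfolding holomorphic_on_def field_differentiable_def
proof
  fix u :: complex assume "u \<in> ball 0 (1 / norm z)"
  then have "norm (z * u) < 1" using assms by (simp add: norm_mult field_simps)
  then show "\<exists>f'. (gen_fun a n z has_field_derivative f') (at u within ball 0 (1 / cmod z))"
    using gen_fun_has_derivative[OF assms] has_field_derivative_at_within by blast
qed

lemma gen_fun_coeff:
  fixes z :: complex and a :: real and n m :: nat
  assumes "z \<noteq> 0" "n > 0"
  shows "(deriv ^^ m) (gen_fun a n z) 0 / fact m = of_real (real n powr (m / 2)) * tc_eval a m (of_real (real n powr (-1/2)) * z)"
proof -
  define F where "F = fps_expansion (gen_fun a n z) 0"
  define r where "r = 1 / norm z"
  have r: "r > 0" using assms by (simp add: r_def)
  have "gen_fun a n z analytic_on {0}"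
    unfolding analytic_at using gen_fun_holomorphic[OF assms(1)] r by (intro exI[of _ "ball 0 r"]) (auto simp: r_def)
  then have exp: "gen_fun a n z has_fps_expansion F"
    unfolding F_def by (rule analytic_at_imp_has_fps_expansion_0)
  have "(\<lambda>u. (1 - z * u) * deriv (gen_fun a n z) u) has_fps_expansion (1 - fps_const z * fps_X) * fps_deriv F"
    by (intro fps_expansion_intros exp)
  moreover have "eventually (\<lambda>u. (1 - z * u) * deriv (gen_fun a n z) u = (of_real a * z - of_nat n * u) * gen_fun a n z u) (nhds 0)"
    unfolding eventually_nhds
  proof (intro exI[of _ "ball 0 r"] conjI ballI)
    fix u :: complex assume "u \<in> ball 0 r"
    then have u: "norm (z * u) < 1" using assms by (simp add: norm_mult r_def field_simps)
    then have "1 - z * u \<noteq> 0" using one_minus_notin_nonpos_Reals by fastforce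
    moreover have "deriv (gen_fun a n z) u = gen_fun a n z u * (of_real a * z - of_nat n * u) / (1 - z * u)"
      by (intro DERIV_imp_deriv gen_fun_has_derivative assms u)
    ultimately show "(1 - z * u) * deriv (gen_fun a n z) u = (of_real a * z - of_nat n * u) * gen_fun a n z u"
      by simp
  qed (use r in auto)
  ultimately have "(\<lambda>u. (of_real a * z - of_nat n * u) * gen_fun a n z u) has_fps_expansion (1 - fps_const z * fps_X) * fps_deriv F"
    using has_fps_expansion_cong by fastforce
  moreover have "(\<lambda>u. (of_real a * z - of_nat n * u) * gen_fun a n z u) has_fps_expansion
      (fps_const (of_real a * z) - fps_const (of_nat n) * fps_X) * F"
    by (intro fps_expansion_intros exp)
  ultimately have eq: "(1 - fps_const z * fps_X) * fps_deriv F = (fps_const (of_real a * z) - fps_const (of_nat n) * fps_X) * F"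
    by (intro fps_ext) (metis fps_nth_fps_expansion)
  have rec: "of_nat (Suc m) * fps_nth F (Suc m) - z * (of_nat m * fps_nth F m) =
      of_real a * z * fps_nth F m - of_nat n * (if m = 0 then 0 else fps_nth F (m - 1))" for m
  proof -
    have "fps_nth ((1 - fps_const z * fps_X) * fps_deriv F) m = of_nat (Suc m) * fps_nth F (Suc m) - z * (of_nat m * fps_nth F m)"
      by (cases m) (simp_all add: algebra_simps)
    moreover have "fps_nth ((fps_const (of_real a * z) - fps_const (of_nat n) * fps_X) * F) m =
        of_real a * z * fps_nth F m - of_nat n * (if m = 0 then 0 else fps_nth F (m - 1))"
      by (cases m) (simp_all add: left_diff_distrib mult.assoc)
    ultimately show ?thesis using eq by simp
  qed
  \<comment> \<open>With \<open>z = x * y\<close> and \<open>y * y = n\<close>, pulling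
    \<open>y ^ m\<close> out of the \<open>m\<close>-th coefficient turns the recurrence
    \<open>rec\<close> into that of the polynomials at \<open>x\<close>.\<close>
  define y where "y = complex_of_real (sqrt (real n))"
  have y: "y \<noteq> 0" "y * y = of_nat n"
    using assms by (auto simp: y_def simp flip: of_real_mult)
  have ym: "of_real (real n powr (m / 2)) = y ^ m" for m
  proof -
    have "real n powr (m / 2) = (real n powr (1 / 2)) powr m" by (simp add: powr_powr)
    also have "\<dots> = sqrt (real n) ^ m" using assms by (simp add: powr_half_sqrt powr_realpow)
    finally show ?thesis by (simp add: y_def)
  qed
  have yi: "of_real (real n powr (-1/2)) = 1 / y"
    using assms by (simp add: y_def powr_minus_divide powr_half_sqrt)
  define x where "x = z / y"
  have z: "z = x * y" using y by (simp add: x_def)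
  have "fps_nth F m = y ^ m * tc_eval a m x"
  proof (induction m rule: less_induct)
    case (less m)
    consider "m = 0" | "m = 1" | k where "m = Suc (Suc k)"
      by (metis One_nat_def not0_implies_Suc)
    then show ?case
    proof cases
      case 1
      have "fps_nth F 0 = gen_fun a n z 0" by (simp add: F_def fps_expansion_def)
      then show ?thesis using 1 by (simp add: gen_fun_def tc_eval_simps)
    next
      case 2
      have "fps_nth F 0 = 1" using less.IH[of 0] 2 by (simp add: tc_eval_simps)
      then show ?thesis using 2 rec[of 0] by (simp add: tc_eval_simps z)
    next
      case 3
      have IH: "fps_nth F (Suc k) = y ^ Suc k * tc_eval a (Suc k) x" "fps_nth F k = y ^ k * tc_eval a k x"
        using less.IH 3 by auto
      have "(of_nat k + 2) * fps_nth F m = y ^ Suc (Suc k) * ((of_nat k + 1 + of_real a) * x * tc_eval a (Suc k) x - tc_eval a k x)"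
        using rec[of "Suc k"] 3 by (simp add: IH z y(2)[symmetric] algebra_simps)
      also have "\<dots> = (of_nat k + 2) * (y ^ m * tc_eval a m x)"
        using tc_eval_simps(3)[of k a x] 3 by simp
      finally show ?thesis
        by (simp add: of_nat_add[symmetric] del: of_nat_add)
           (metis of_nat_add of_nat_eq_0_iff of_nat_numeral add_is_0 zero_neq_numeral)
    qed
  qed
  then show ?thesis
    unfolding ym yi by (simp add: F_def fps_expansion_def x_def)
qed

lemma tc_monic_eval:
  assumes "a > 0"
  shows "poly (map_poly complex_of_real (tc_monic a n)) x = of_real (1 / tc_gamma a n) * tc_eval a n x"
proof -
  have sm: "map_poly complex_of_real (smult c p) = smult (of_real c) (map_poly of_real p)" for c p
    by (simp add: poly_eq_iff coeff_map_poly)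
  show ?thesis by (simp only: tc_monic_def sm poly_smult tc_eval_def)
qed

section \<open>The logarithmic potential\<close>

text \<open>The numerator \<open>1 + s\<close> majorises the linear growth allowed for the
  integrands. The exact value shows that the tail grows only like \<open>1 / c\<^sup>2\<close> as
  \<open>c\<close> tends to 0, which the factor \<open>(cos f)\<^sup>2\<close> of the mixture
  compensates.\<close>

lemma integral_inverse_cube_tail:
  fixes c :: real
  assumes "c > 0"
  shows "integrable lborel (\<lambda>s. indicator {c<..} s *\<^sub>R ((1 + s) / s ^ 3))"
    and "(LINT s|lborel. indicator {c<..} s *\<^sub>R ((1 + s) / s ^ 3)) = 1 / (2 * c\<^sup>2) + 1 / c"
proof -
  have e: "einterval (ereal c) \<infinity> = {c<..}" by (auto simp: einterval_def)
  let ?F = "\<lambda>s::real. - 1 / (2 * s\<^sup>2) - 1 / s"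
  have top: "(?F \<longlongrightarrow> 0) at_top" by real_asymp
  have c: "(?F \<longlongrightarrow> ?F c) (at_right c)"
    using assms by (intro tendsto_intros) auto
  note FTC = interval_integral_FTC_nonneg[of "ereal c" \<infinity> ?F "\<lambda>s. (1 + s) / s ^ 3" "?F c" 0, unfolded e]
  have prems: "\<And>x. ereal c < ereal x \<Longrightarrow> ereal x < \<infinity> \<Longrightarrow> DERIV ?F x :> (1 + x) / x ^ 3"
    using assms by (auto intro!: derivative_eq_intros simp: field_simps eval_nat_numeral)
  have 1: "set_integrable lborel {c<..} (\<lambda>s. (1 + s) / s ^ 3)"
    using assms prems c top
    by (intro FTC) (auto simp: ereal_tendsto_simps intro!: continuous_intros AE_I2)
  have 2: "(LBINT s=ereal c..\<infinity>. (1 + s) / s ^ 3) = 0 - ?F c"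
    using assms prems c top
    by (intro FTC) (auto simp: ereal_tendsto_simps intro!: continuous_intros AE_I2)
  show "integrable lborel (\<lambda>s. indicator {c<..} s *\<^sub>R ((1 + s) / s ^ 3))"
    using 1 by (simp add: set_integrable_def)
  show "(LINT s|lborel. indicator {c<..} s *\<^sub>R ((1 + s) / s ^ 3)) = 1 / (2 * c\<^sup>2) + 1 / c"
    using 2 by (simp add: interval_integral_Ioi set_lebesgue_integral_def)
qed

lemma integral_cos_squared:
  fixes a :: real
  assumes "a \<le> pi / 2"
  shows "(LINT f|lborel. indicator {a<..<pi/2} f *\<^sub>R (cos f)\<^sup>2) = (pi / 2 - a - sin a * cos a) / 2"
proof -
  have "(LBINT f=ereal a..ereal (pi/2). (cos f)\<^sup>2) = (pi / 2 + sin (pi / 2) * cos (pi / 2)) / 2 - (a + sin a * cos a) / 2"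
  proof (intro interval_integral_FTC_finite)
    show "continuous_on {min a (pi / 2)..max a (pi / 2)} (\<lambda>f. (cos f)\<^sup>2)"
      by (intro continuous_intros)
    fix x :: real
    have "((\<lambda>x. (x + sin x * cos x) / 2) has_real_derivative (1 + (cos x * cos x - sin x * sin x)) / 2) (at x)"
      by (auto intro!: derivative_eq_intros)
    also have "1 + (cos x * cos x - sin x * sin x) = 2 * (cos x)\<^sup>2"
      using sin_cos_squared_add3[of x] by algebra
    finally have "((\<lambda>x. (x + sin x * cos x) / 2) has_real_derivative (cos x)\<^sup>2) (at x)"
      by simp
    then show "((\<lambda>x. (x + sin x * cos x) / 2) has_vector_derivative (cos x)\<^sup>2) (at x within {min a (pi / 2)..max a (pi / 2)})"
      by (meson has_field_derivative_at_within has_real_derivative_iff_has_vector_derivative)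
  qed
  then show ?thesis
    using assms by (simp add: interval_integral_eq_integral' interval_lebesgue_integral_def set_lebesgue_integral_def field_simps)
qed

text \<open>
  The density is the mixture over \<open>c = 2 cos f\<close> of the densities \<open>s \<mapsto> c\<^sup>2 / \<bar>s\<bar> ^ 3\<close> on \<open>\<bar>s\<bar> > c\<close>, whose logarithmic
  potentials are elementary; this is what makes \<open>g_fun\<close> computable.
\<close>

lemma psi_eq_integral:
  fixes s :: real
  assumes "s > 0"
  shows "psi s = (LINT f|lborel. indicator {0<..<pi/2} f * indicator {2 * cos f<..} s * (8 / pi * (cos f)\<^sup>2 / s ^ 3))"
proof -
  \<comment> \<open>The angle at which \<open>2 * cos f\<close> equals \<open>s\<close>, cut off at
    0 once \<open>s\<close> reaches 2. The mixture at \<open>s\<close> is then an integral over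
    \<open>a < f < pi / 2\<close>, and for \<open>s < 2\<close> the arctangent in \<open>psi\<close>
    is \<open>pi / 2 - a\<close>.\<close>
  define a where "a = (if s \<ge> 2 then 0 else arccos (s / 2))"
  have a: "0 \<le> a" "a \<le> pi / 2"
    using assms arccos_le_pi2[of "s / 2"] by (auto simp: a_def intro!: arccos_lbound)
  have eq: "indicator {0<..<pi/2} f * indicator {2 * cos f<..} s = (indicator {a<..<pi/2} f :: real)" for f
  proof (cases "0 < f \<and> f < pi / 2")
    case True
    have "2 * cos f < s \<longleftrightarrow> a < f"
    proof (cases "s \<ge> 2")
      case True2: True
      have "cos f < 1" using cos_monotone_0_pi[of 0 f] True by simp
      then show ?thesis using True True2 by (simp add: a_def)
    next
      case False
      have "cos a = s / 2" using False assms by (simp add: a_def)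
      moreover have "cos f < cos a \<longleftrightarrow> a < f"
        using True a by (intro cos_mono_less_eq) auto
      ultimately show ?thesis by auto
    qed
    then show ?thesis using True by (simp add: indicator_def)
  next
    case False
    then show ?thesis using a by (auto simp: indicator_def)
  qed
  have "(LINT f|lborel. indicator {0<..<pi/2} f * indicator {2 * cos f<..} s * (8 / pi * (cos f)\<^sup>2 / s ^ 3)) =
      (LINT f|lborel. (8 / (pi * s ^ 3)) * (indicator {a<..<pi/2} f *\<^sub>R (cos f)\<^sup>2))"
    by (simp only: eq) (simp add: mult_ac)
  also have "\<dots> = 8 / (pi * s ^ 3) * ((pi / 2 - a - sin a * cos a) / 2)"
    by (simp only: integral_mult_right_zero integral_cos_squared[OF a(2)])
  also have "\<dots> = psi s"
  proof (cases "s \<ge> 2")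
    case True
    then show ?thesis by (simp add: a_def psi_def field_simps)
  next
    case False
    define y where "y = sqrt (4 - s\<^sup>2)"
    have s2: "\<bar>s / 2\<bar> \<le> 1" "-1 < s / 2" "s / 2 < 1" using False assms by auto
    have "sqrt (1 - (s / 2)\<^sup>2) = sqrt ((4 - s\<^sup>2) / 2\<^sup>2)" by (simp add: power_divide field_simps)
    also have "\<dots> = y / 2" by (simp only: real_sqrt_divide y_def) simp
    finally have y: "sqrt (1 - (s / 2)\<^sup>2) = y / 2" .
    have "arctan (s / y) = arcsin (s / 2)"
      using arcsin_arctan[OF s2(2,3)] y by simp
    also have "\<dots> = pi / 2 - a"
      using arcsin_plus_arccos[of "s / 2"] s2 False by (simp add: a_def)
    finally have 1: "arctan (s / y) = pi / 2 - a" .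
    have 2: "sin a = y / 2" "cos a = s / 2"
      using s2 False y by (auto simp: a_def sin_arccos)
    have 3: "psi s = 1 / pi * (4 * arctan (s / y) / s ^ 3 - y / s\<^sup>2)"
      using False assms by (simp add: psi_def y_def)
    show ?thesis
      unfolding 3 1 2 using assms by (simp add: field_simps power2_eq_square power3_eq_cube)
  qed
  finally show ?thesis by simp
qed

text \<open>Exchanging the integrals turns an integral against \<open>psi\<close> into an average of
  tail integrals of \<open>1 / s ^ 3\<close>. With \<open>c = 2 * cos f\<close> the weight
  \<open>8 / pi * (cos f)\<^sup>2\<close> is \<open>2 / pi * c\<^sup>2\<close>, so \<open>f\<close>
  is uniformly distributed on \<open>(0, pi / 2)\<close>. Linear growth of \<open>K\<close> is
  enough for absolute convergence.\<close>

lemma psi_Fubini: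
  fixes K :: "real \<Rightarrow> complex" and A :: real
  assumes meas[measurable]: "K \<in> borel_measurable borel"
    and bound: "\<And>s. s > 0 \<Longrightarrow> norm (K s) \<le> A * (1 + s)"
  shows "integrable lborel (\<lambda>s. indicator {0<..} s *\<^sub>R (psi s *\<^sub>R K s))"
    and "(LINT s|lborel. indicator {0<..} s *\<^sub>R (psi s *\<^sub>R K s)) =
      (LINT f|lborel. indicator {0<..<pi/2} f *\<^sub>R ((8 / pi * (cos f)\<^sup>2) *\<^sub>R
        (LINT s|lborel. indicator {2 * cos f<..} s *\<^sub>R ((1 / s ^ 3) *\<^sub>R K s))))" (is "?L = ?R")
proof -
  define k where "k = (\<lambda>f s::real. indicator {0<..<pi/2} f * (if 2 * cos f < s then 1 else 0) * (8 / pi * (cos f)\<^sup>2 / s ^ 3))"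
  define h where "h = (\<lambda>f s. k f s *\<^sub>R K s)"
  have A: "A \<ge> 0"
    using order.trans[OF norm_ge_zero bound[of 1]] by simp
  have [measurable]: "case_prod k \<in> borel_measurable (borel \<Otimes>\<^sub>M borel)"
    unfolding k_def by measurable
  have [measurable]: "case_prod h \<in> borel_measurable (borel \<Otimes>\<^sub>M borel)"
    unfolding h_def by measurable
  have bnd: "norm (h f s) \<le> (if f \<in> {0<..<pi/2} then 8 / pi * (cos f)\<^sup>2 * A * (indicator {2 * cos f<..} s *\<^sub>R ((1 + s) / s ^ 3)) else 0)" for f s
  proof (cases "f \<in> {0<..<pi/2} \<and> 2 * cos f < s")
    case True
    then have "cos f > 0" by (intro cos_gt_zero) auto
    then have "s > 0" using True by auto
    have "norm (h f s) = 8 / pi * (cos f)\<^sup>2 / s ^ 3 * norm (K s)"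
      using True \<open>s > 0\<close> by (simp add: h_def k_def)
    also have "\<dots> \<le> 8 / pi * (cos f)\<^sup>2 / s ^ 3 * (A * (1 + s))"
      using \<open>s > 0\<close> by (intro mult_left_mono bound) auto
    finally show ?thesis using True by simp
  qed (auto simp: h_def k_def)
  have int2: "integrable lborel (h f)" for f
  proof (cases "f \<in> {0<..<pi/2}")
    case True
    then have "cos f > 0" by (intro cos_gt_zero) auto
    then have "integrable lborel (\<lambda>s. 8 / pi * (cos f)\<^sup>2 * A * (indicator {2 * cos f<..} s *\<^sub>R ((1 + s) / s ^ 3)))"
      by (intro integrable_mult_right integral_inverse_cube_tail) auto
    then show ?thesis
    proof (rule Bochner_Integration.integrable_bound)
      show "AE s in lborel. norm (h f s) \<le> norm (8 / pi * (cos f)\<^sup>2 * A * (indicator {2 * cos f<..} s *\<^sub>R ((1 + s) / s ^ 3)))"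
      proof (intro AE_I2)
        fix s
        have "norm (h f s) \<le> 8 / pi * (cos f)\<^sup>2 * A * (indicator {2 * cos f<..} s *\<^sub>R ((1 + s) / s ^ 3))"
          using bnd[of f s] True by (simp only: if_True)
        also have "\<dots> \<le> norm \<dots>" unfolding real_norm_def by (rule abs_ge_self)
        finally show "norm (h f s) \<le> norm (8 / pi * (cos f)\<^sup>2 * A * (indicator {2 * cos f<..} s *\<^sub>R ((1 + s) / s ^ 3)))" .
      qed
    qed measurable
  next
    case False
    then have "h f = (\<lambda>_. 0)" by (auto simp: h_def k_def fun_eq_iff)
    then show ?thesis by simp
  qed
  have int1: "integrable lborel (\<lambda>f. LINT s|lborel. norm (h f s))"
  proof (rule Bochner_Integration.integrable_bound)
    show "integrable lborel (\<lambda>f. indicator {0<..<pi/2} f *\<^sub>R (8 / pi * A))"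
      by (simp add: integrable_real_indicator)
    show "AE f in lborel. norm (LINT s|lborel. norm (h f s)) \<le> norm (indicator {0<..<pi/2} f *\<^sub>R (8 / pi * A))"
    proof (rule AE_I2)
      fix f :: real
      show "norm (LINT s|lborel. norm (h f s)) \<le> norm (indicator {0<..<pi/2} f *\<^sub>R (8 / pi * A))"
      proof (cases "f \<in> {0<..<pi/2}")
        case True
        then have c: "cos f > 0" by (intro cos_gt_zero) auto
        have "(LINT s|lborel. norm (h f s)) \<le> (LINT s|lborel. 8 / pi * (cos f)\<^sup>2 * A * (indicator {2 * cos f<..} s *\<^sub>R ((1 + s) / s ^ 3)))"
          using c True bnd[of f]
          by (intro integral_mono integrable_norm int2 integrable_mult_right integral_inverse_cube_tail) auto
        also have "\<dots> = 8 / pi * (cos f)\<^sup>2 * A * (1 / (2 * (2 * cos f)\<^sup>2) + 1 / (2 * cos f))"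
          using c by (subst integral_mult_right_zero, subst integral_inverse_cube_tail(2)) auto
        also have "\<dots> = 8 / pi * A * (1 / 8 + cos f / 2)"
          using c by (simp add: field_simps power2_eq_square)
        also have "\<dots> \<le> 8 / pi * A * 1"
        proof (rule mult_left_mono)
          show "1 / 8 + cos f / 2 \<le> 1" using cos_le_one[of f] by linarith
        qed (use A in simp)
        finally show ?thesis using True A by (simp add: integral_nonneg)
      next
        case False
        then have "h f = (\<lambda>_. 0)" by (auto simp: h_def k_def fun_eq_iff)
        then show ?thesis by simp
      qed
    qed
  qed measurable
  have int: "integrable (lborel \<Otimes>\<^sub>M lborel) (case_prod h)"
    by (rule lborel_pair.Fubini_integrable) (use int1 int2 in auto)
  have inner: "(LINT f|lborel. h f s) = indicator {0<..} s *\<^sub>R (psi s *\<^sub>R K s)" for s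
  proof (cases "s > 0")
    case True
    have "k f s = indicator {0<..<pi/2} f * indicator {2 * cos f<..} s * (8 / pi * (cos f)\<^sup>2 / s ^ 3)" for f
      by (simp add: k_def indicator_def)
    then have "psi s = (LINT f|lborel. k f s)" using psi_eq_integral[OF True] by simp
    moreover have "integrable lborel (\<lambda>f. k f s)"
    proof (rule Bochner_Integration.integrable_bound)
      show "integrable lborel (\<lambda>f. indicator {0<..<pi/2} f *\<^sub>R (8 / pi / s ^ 3))"
        by (simp add: integrable_real_indicator)
      have "8 / pi * (cos f)\<^sup>2 / s ^ 3 \<le> 8 / pi / s ^ 3" for f
        using True by (simp add: divide_right_mono abs_square_le_1)
      then show "AE f in lborel. norm (k f s) \<le> norm (indicator {0<..<pi/2} f *\<^sub>R (8 / pi / s ^ 3))"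
        using True by (intro AE_I2) (auto simp: k_def indicator_def)
    qed (simp add: k_def)
    ultimately show ?thesis using True by (simp add: h_def)
  next
    case False
    have "h f s = 0" for f
    proof (cases "f \<in> {0<..<pi/2}")
      case True
      then have "cos f > 0" by (intro cos_gt_zero) auto
      then show ?thesis using False by (auto simp: h_def k_def)
    qed (simp add: h_def k_def)
    then show ?thesis using False by simp
  qed
  show "integrable lborel (\<lambda>s. indicator {0<..} s *\<^sub>R (psi s *\<^sub>R K s))"
    using lborel_pair.integrable_snd[OF int] by (simp add: inner)
  have "(LINT s|lborel. indicator {0<..} s *\<^sub>R (psi s *\<^sub>R K s)) = (LINT f|lborel. LINT s|lborel. h f s)"
    using lborel_pair.Fubini_integral[OF int] by (simp add: inner)
  also have "\<dots> = ?R"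
  proof (intro Bochner_Integration.integral_cong refl)
    fix f
    have "h f s = (indicator {0<..<pi/2} f * (8 / pi * (cos f)\<^sup>2)) *\<^sub>R (indicator {2 * cos f<..} s *\<^sub>R ((1 / s ^ 3) *\<^sub>R K s))" for s
      by (simp add: h_def k_def indicator_def)
    then have "(LINT s|lborel. h f s) = (indicator {0<..<pi/2} f * (8 / pi * (cos f)\<^sup>2)) *\<^sub>R
        (LINT s|lborel. indicator {2 * cos f<..} s *\<^sub>R ((1 / s ^ 3) *\<^sub>R K s))"
      by (simp only: integral_scaleR_right)
    then show "(LINT s|lborel. h f s) = indicator {0<..<pi/2} f *\<^sub>R ((8 / pi * (cos f)\<^sup>2) *\<^sub>R
        (LINT s|lborel. indicator {2 * cos f<..} s *\<^sub>R ((1 / s ^ 3) *\<^sub>R K s)))"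
      by simp
  qed
  finally show "?L = ?R" .
qed

text \<open>Since \<open>k 0 = 0\<close>, splitting \<open>k\<close> into its two half lines is a
  pointwise identity and involves no null sets.\<close>

lemma integral_fold_half_line:
  fixes k :: "real \<Rightarrow> 'a :: euclidean_space"
  assumes "integrable lborel (\<lambda>s. indicator {0<..} s *\<^sub>R k s)"
    and "integrable lborel (\<lambda>s. indicator {0<..} s *\<^sub>R k (- s))" and "k 0 = 0"
  shows "integrable lborel k"
    and "(LINT s|lborel. k s) = (LINT s|lborel. indicator {0<..} s *\<^sub>R (k s + k (- s)))"
proof -
  define u where "u = (\<lambda>s. indicator {0<..} s *\<^sub>R k (- s))"
  have k: "k = (\<lambda>s. indicator {0<..} s *\<^sub>R k s + u (- s))"
    using assms(3) by (auto simp: u_def fun_eq_iff indicator_def not_less_iff_gr_or_eq)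
  have u: "integrable lborel (\<lambda>s. u (- s))"
    using lborel_integrable_real_affine[of u "-1" 0] assms(2) by (simp add: u_def)
  have "integrable lborel (\<lambda>s. indicator {0<..} s *\<^sub>R k s + u (- s))"
    by (intro Bochner_Integration.integrable_add assms u)
  then show "integrable lborel k" using k by simp
  have "(LINT s|lborel. k s) = (LINT s|lborel. indicator {0<..} s *\<^sub>R k s + u (- s))"
    using k by simp
  also have "\<dots> = (LINT s|lborel. indicator {0<..} s *\<^sub>R k s) + (LINT s|lborel. u (- s))"
    by (intro Bochner_Integration.integral_add assms u)
  also have "(LINT s|lborel. u (- s)) = (LINT s|lborel. u s)"
    using lborel_integral_real_affine[of "-1" u 0] by simp
  also have "(LINT s|lborel. indicator {0<..} s *\<^sub>R k s) + (LINT s|lborel. u s) =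
      (LINT s|lborel. indicator {0<..} s *\<^sub>R k s + u s)"
    by (intro Bochner_Integration.integral_add[symmetric] assms) (use assms(2) in \<open>simp add: u_def\<close>)
  finally show "(LINT s|lborel. k s) = (LINT s|lborel. indicator {0<..} s *\<^sub>R (k s + k (- s)))"
    by (simp add: u_def scaleR_add_right)
qed

section \<open>Logarithms paired on the half line\<close>

lemma norm_Ln_le_Im:
  fixes w :: complex
  assumes "Im w = y" "y > 0" "norm w \<le> B" "B \<ge> 1"
  shows "norm (Ln w) \<le> \<bar>ln y\<bar> + B + pi"
proof -
  have "w \<noteq> 0" using assms by auto
  have "y \<le> norm w" using assms abs_Im_le_cmod[of w] by simp
  then have "ln y \<le> ln (norm w)" using assms(2) \<open>w \<noteq> 0\<close> by simp
  moreover have "ln (norm w) \<le> B"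
    using assms ln_le_minus_one[of "norm w"] \<open>w \<noteq> 0\<close> by simp
  ultimately have "\<bar>ln (norm w)\<bar> \<le> \<bar>ln y\<bar> + B" using assms by linarith
  moreover have "\<bar>Im (Ln w)\<bar> \<le> pi"
    using \<open>w \<noteq> 0\<close> mpi_less_Im_Ln[of w] Im_Ln_le_pi[of w] by auto
  ultimately show ?thesis
    using cmod_le[of "Ln w"] \<open>w \<noteq> 0\<close> by simp
qed

text \<open>Because \<open>psi\<close> is even, \<open>s\<close> and \<open>- s\<close> are paired.
  For \<open>z\<close> in the upper half plane the pair has a rational derivative and grows like
  \<open>2 * ln s + \<i> * pi\<close>.\<close>

definition Ln_sum :: "complex \<Rightarrow> real \<Rightarrow> complex" where
  "Ln_sum z s = Ln (z - of_real s) + Ln (z + of_real s)"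

lemma Ln_sum_has_derivative:
  assumes "Im z > 0" "s \<noteq> 0"
  shows "(Ln_sum z has_vector_derivative - 2 * of_real s / (z\<^sup>2 - (of_real s)\<^sup>2)) (at s)"
proof -
  have nz: "z - of_real s \<noteq> 0" "z + of_real s \<noteq> 0"
    using assms by (auto simp: complex_eq_iff)
  have "((\<lambda>w. Ln (z - w) + Ln (z + w)) has_field_derivative (- 1 / (z - of_real s) + 1 / (z + of_real s))) (at (of_real s))"
    using assms nz
    by (auto intro!: derivative_eq_intros simp: complex_nonpos_Reals_iff divide_inverse)
  also have "- 1 / (z - of_real s) + 1 / (z + of_real s) = - 2 * of_real s / (z\<^sup>2 - (of_real s)\<^sup>2)"
  proof -
    have "z\<^sup>2 - (of_real s)\<^sup>2 = (z - of_real s) * (z + of_real s)"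
      by (simp add: power2_eq_square algebra_simps)
    then show ?thesis using nz by (simp add: field_simps)
  qed
  finally show ?thesis
    unfolding Ln_sum_def by (rule has_vector_derivative_real_field)
qed

text \<open>The number \<open>s - z\<close> lies in the lower half plane, so passing to its negative
  adds \<open>\<i> * pi\<close> to the principal logarithm; positive factors can be split off
  freely.\<close>

lemma Ln_sum_expand:
  assumes "Im z > 0" "s > 0"
  shows "Ln_sum z s = 2 * of_real (ln s) + \<i> * pi + (Ln (1 - z / of_real s) + Ln (1 + z / of_real s))"
proof -
  have nz: "of_real s - z \<noteq> 0" "1 - z / of_real s \<noteq> 0" "1 + z / of_real s \<noteq> 0"
    using assms by (auto simp: complex_eq_iff)
  have "Ln (z - of_real s) = Ln (- (of_real s - z))" by simp
  also have "\<dots> = Ln (of_real s - z) + \<i> * pi"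
    using assms nz(1) by (subst Ln_minus) auto
  also have "of_real s - z = of_real s * (1 - z / of_real s)"
    using assms by (simp add: field_simps)
  also have "Ln \<dots> = of_real (ln s) + Ln (1 - z / of_real s)"
    using assms nz by (subst Ln_times_of_real) (auto simp: Ln_of_real)
  finally have 1: "Ln (z - of_real s) = of_real (ln s) + Ln (1 - z / of_real s) + \<i> * pi" .
  have "z + of_real s = of_real s * (1 + z / of_real s)"
    using assms by (simp add: field_simps)
  also have "Ln \<dots> = of_real (ln s) + Ln (1 + z / of_real s)"
    using assms nz by (subst Ln_times_of_real) (auto simp: Ln_of_real)
  finally show ?thesis using assms unfolding Ln_sum_def 1 by (simp add: Ln_of_real)
qed

lemma Ln_sum_measurable [measurable]: "Ln_sum z \<in> borel_measurable borel"
  unfolding Ln_sum_def by measurable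

text \<open>The points \<open>z - s\<close> and \<open>z + s\<close> stay on the horizontal line at
  height \<open>Im z\<close>, away from the singularity at 0. This bounds the logarithm of the
  modulus from below; from above it is at most linear.\<close>

lemma Ln_sum_bound:
  assumes "Im z > 0"
  shows "\<exists>A\<ge>0. \<forall>s\<ge>0. norm (Ln (z - of_real s)) \<le> A * (1 + s) \<and> norm (Ln (z + of_real s)) \<le> A * (1 + s)"
proof -
  define A where "A = \<bar>ln (Im z)\<bar> + norm z + 2 + pi"
  have "norm (Ln w) \<le> A * (1 + s)" if "s \<ge> 0" "Im w = Im z" "norm w \<le> norm z + s" for s w
  proof -
    have "norm (Ln w) \<le> \<bar>ln (Im z)\<bar> + (norm z + s + 1) + pi"
      using that assms by (intro norm_Ln_le_Im[where y = "Im z"]) auto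
    also have "\<dots> \<le> A + A * s"
      using that pi_gt_zero mult_right_mono[of 1 A s] by (auto simp: A_def)
    finally show ?thesis by (simp add: algebra_simps)
  qed
  note * = this
  show ?thesis
  proof (intro exI[of _ A] conjI allI impI *)
    show "A \<ge> 0" unfolding A_def using pi_gt_zero by (intro add_nonneg_nonneg) auto
    fix s :: real assume "s \<ge> 0"
    then show "norm (z - of_real s) \<le> norm z + s" "norm (z + of_real s) \<le> norm z + s"
      using norm_triangle_ineq4[of z "of_real s"] norm_triangle_ineq[of z "of_real s"] by auto
  qed auto
qed

text \<open>The primitive \<open>Q\<close> comes from integration by parts against
  \<open>1 / s ^ 3\<close>. What remains is the integral of
  \<open>- 1 / (s * (z\<^sup>2 - s\<^sup>2))\<close>, which partial fractions reduce to
  \<open>ln s\<close> and \<open>Ln_sum z s\<close> itself.\<close>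

lemma integral_Ln_sum_tail:
  assumes z: "Im z > 0" and c: "c > 0"
  shows "(LINT s|lborel. indicator {c<..} s *\<^sub>R ((1 / s ^ 3) *\<^sub>R Ln_sum z s)) =
    (Ln_sum z c - of_real (c\<^sup>2) / z\<^sup>2 * (Ln_sum z c - \<i> * pi - 2 * of_real (ln c))) / (2 * of_real (c\<^sup>2))"
proof -
  obtain A where A: "A \<ge> 0" "\<And>s. s \<ge> 0 \<Longrightarrow> norm (Ln (z - of_real s)) \<le> A * (1 + s)"
    "\<And>s. s \<ge> 0 \<Longrightarrow> norm (Ln (z + of_real s)) \<le> A * (1 + s)"
    using Ln_sum_bound[OF z] by blast
  have nz: "z \<noteq> 0" using z by auto
  define f where "f = (\<lambda>s. (1 / s ^ 3) *\<^sub>R Ln_sum z s)"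
  define Q where "Q = (\<lambda>s::real. - (1 / (2 * of_real s ^ 2)) * Ln_sum z s - (1 / (2 * z\<^sup>2)) * (2 * of_real (ln s) - Ln_sum z s))"
  have e: "einterval (ereal c) \<infinity> = {c<..}" by (auto simp: einterval_def)
  have int: "set_integrable lborel {c<..} f"
    unfolding set_integrable_def
  proof (rule Bochner_Integration.integrable_bound)
    show "integrable lborel (\<lambda>s. (2 * A) * (indicator {c<..} s *\<^sub>R ((1 + s) / s ^ 3)))"
      by (intro integrable_mult_right integral_inverse_cube_tail c)
    show "AE s in lborel. norm (indicator {c<..} s *\<^sub>R f s) \<le> norm ((2 * A) * (indicator {c<..} s *\<^sub>R ((1 + s) / s ^ 3)))"
    proof (rule AE_I2)
      fix s :: real
      show "norm (indicator {c<..} s *\<^sub>R f s) \<le> norm ((2 * A) * (indicator {c<..} s *\<^sub>R ((1 + s) / s ^ 3)))"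
      proof (cases "s > c")
        case True
        then have s: "s > 0" using c by simp
        have "norm (f s) = norm (Ln_sum z s) / s ^ 3" using s by (simp add: f_def)
        also have "\<dots> \<le> (A * (1 + s) + A * (1 + s)) / s ^ 3"
          unfolding Ln_sum_def using s A by (intro divide_right_mono norm_triangle_le add_mono) auto
        finally show ?thesis using True s A(1) by simp
      qed simp
    qed
  qed (simp add: f_def)
  have "(LBINT s=ereal c..\<infinity>. f s) = \<i> * pi / (2 * z\<^sup>2) - Q c"
  proof (rule interval_integral_FTC_integrable[where F = Q])
    fix s assume "ereal c < ereal s"
    then have s: "s > 0" using c by simp
    have zs: "z\<^sup>2 - (of_real s)\<^sup>2 \<noteq> 0"
    proof -
      have "z\<^sup>2 - (of_real s)\<^sup>2 = (z - of_real s) * (z + of_real s)"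
        by (simp add: power2_eq_square algebra_simps)
      moreover have "z - of_real s \<noteq> 0" "z + of_real s \<noteq> 0"
        using z by (auto simp: complex_eq_iff)
      ultimately show ?thesis by simp
    qed
    have L: "(Ln_sum z has_vector_derivative - 2 * of_real s / (z\<^sup>2 - (of_real s)\<^sup>2)) (at s)"
      using s z by (intro Ln_sum_has_derivative) auto
    have p: "((\<lambda>s::real. - (1 / (2 * (complex_of_real s) ^ 2))) has_vector_derivative 1 / of_real s ^ 3) (at s)"
      using s by (intro has_vector_derivative_real_field)
        (auto intro!: derivative_eq_intros simp: field_simps power2_eq_square power3_eq_cube)
    have l: "((\<lambda>s::real. complex_of_real (ln s)) has_vector_derivative of_real (1 / s)) (at s)"
      using s by (intro has_vector_derivative_of_real) (auto simp: has_real_derivative_iff_has_vector_derivative[symmetric] intro!: derivative_eq_intros)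
    have "(Q has_vector_derivative
        (- (1 / (2 * of_real s ^ 2))) * (- 2 * of_real s / (z\<^sup>2 - (of_real s)\<^sup>2)) + 1 / of_real s ^ 3 * Ln_sum z s
        - (1 / (2 * z\<^sup>2)) * (2 * of_real (1 / s) - (- 2 * of_real s / (z\<^sup>2 - (of_real s)\<^sup>2)))) (at s)"
      unfolding Q_def
      by (intro has_vector_derivative_diff has_vector_derivative_mult has_vector_derivative_mult_right L p l)
    moreover have "- (1 / (2 * x ^ 2)) * (- 2 * x / w) + 1 / x ^ 3 * L
        - (1 / (2 * z\<^sup>2)) * (2 * (1 / x) - (- 2 * x / w)) = 1 / x ^ 3 * L"
      if "w = z\<^sup>2 - x\<^sup>2" "w \<noteq> 0" "x \<noteq> 0" for w x L :: complex
    proof -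
      have "- (1 / (2 * x ^ 2)) * (- 2 * x / w) - (1 / (2 * z\<^sup>2)) * (2 * (1 / x) - (- 2 * x / w)) =
          (z\<^sup>2 - w - x\<^sup>2) / (w * x * z\<^sup>2)"
        using that(2,3) nz by (simp add: field_simps power2_eq_square)
      also have "\<dots> = 0" using that by simp
      finally show ?thesis by (simp add: algebra_simps)
    qed
    ultimately show "(Q has_vector_derivative f s) (at s)"
      using zs s by (simp add: f_def scaleR_conv_of_real)
    have "isCont (Ln_sum z) s"
      using L has_vector_derivative_continuous by blast
    then show "isCont f s" unfolding f_def using s by (intro continuous_intros) auto
  next
    show "set_integrable lborel (einterval (ereal c) \<infinity>) f" using int e by simp
    have "isCont (Ln_sum z) c"
      using Ln_sum_has_derivative[OF z, of c] c has_vector_derivative_continuous by blast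
    then have "isCont Q c"
      unfolding Q_def using c nz by (intro continuous_intros) auto
    then have "(Q \<longlongrightarrow> Q c) (at_right c)"
      by (simp add: continuous_at_imp_continuous_within continuous_within[symmetric])
    then show "((Q \<circ> real_of_ereal) \<longlongrightarrow> Q c) (at_right (ereal c))"
      by (simp add: ereal_tendsto_simps)
    have *: "((\<lambda>s::real. z / of_real s) \<longlongrightarrow> 0) at_top"
      by (intro tendsto_divide_0[OF tendsto_const] filterlim_of_real_at_infinity)
    have lim1: "((\<lambda>s::real. Ln (1 - z / of_real s)) \<longlongrightarrow> Ln (1 - 0)) at_top"
      by (rule tendsto_Ln, rule tendsto_diff[OF tendsto_const *]) simp
    have "((\<lambda>s::real. Ln (1 + z / of_real s)) \<longlongrightarrow> Ln (1 + 0)) at_top"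
      by (rule tendsto_Ln, rule tendsto_add[OF tendsto_const *]) simp
    moreover define W where "W = (\<lambda>s. Ln (1 - z / of_real s) + Ln (1 + z / of_real s))"
    ultimately have lim: "(W \<longlongrightarrow> 0) at_top" using tendsto_add[OF lim1] by fastforce
    \<comment> \<open>In the second part of \<open>Q\<close> the growing term
      \<open>2 * ln s\<close> cancels against that of \<open>Ln_sum\<close>, so only
      \<open>\<i> * pi\<close> survives in the limit.\<close>
    have "((\<lambda>s::real. - (1 / (2 * of_real s ^ 2)) * (2 * of_real (ln s) + \<i> * pi + W s)
        + (1 / (2 * z\<^sup>2)) * (\<i> * pi + W s)) \<longlongrightarrow>
        0 + (1 / (2 * z\<^sup>2)) * (\<i> * pi + 0)) at_top"
    proof (intro tendsto_add tendsto_mult tendsto_const lim)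
      have a: "((\<lambda>s::real. complex_of_real (- (ln s / s ^ 2))) \<longlongrightarrow> of_real 0) at_top"
        by (intro tendsto_of_real) real_asymp
      have b: "((\<lambda>s::real. complex_of_real (- (1 / (2 * s ^ 2)))) \<longlongrightarrow> of_real 0) at_top"
        by (intro tendsto_of_real) real_asymp
      have "((\<lambda>s::real. complex_of_real (- (ln s / s ^ 2)) + complex_of_real (- (1 / (2 * s ^ 2))) * (\<i> * pi + W s)) \<longlongrightarrow>
         of_real 0 + of_real 0 * (\<i> * pi + 0)) at_top"
        by (intro tendsto_add tendsto_mult tendsto_const lim a b)
      then show "((\<lambda>s::real. - (1 / (2 * of_real s ^ 2)) * (2 * of_real (ln s) + \<i> * pi + W s)) \<longlongrightarrow> 0) at_top"
        by (simp add: algebra_simps add_divide_distrib)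
    qed
    then have "(Q \<longlongrightarrow> 0 + (1 / (2 * z\<^sup>2)) * (\<i> * pi + 0)) at_top"
    proof (rule Lim_transform_eventually)
      show "eventually (\<lambda>s. - (1 / (2 * of_real s ^ 2)) * (2 * of_real (ln s) + \<i> * pi + W s)
        + (1 / (2 * z\<^sup>2)) * (\<i> * pi + W s) = Q s) at_top"
        using eventually_gt_at_top[of 0]
      proof eventually_elim
        case (elim s)
        show ?case using elim unfolding Q_def W_def Ln_sum_expand[OF z elim] by (simp add: algebra_simps Ln_of_real)
      qed
    qed
    then show "((Q \<circ> real_of_ereal) \<longlongrightarrow> \<i> * pi / (2 * z\<^sup>2)) (at_left \<infinity>)"
      by (simp add: ereal_tendsto_simps)
  qed auto
  then have "(LINT s|lborel. indicator {c<..} s *\<^sub>R f s) = \<i> * pi / (2 * z\<^sup>2) - Q c"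
    by (simp add: interval_integral_Ioi set_lebesgue_integral_def)
  also have "\<dots> = (Ln_sum z c - of_real (c\<^sup>2) / z\<^sup>2 * (Ln_sum z c - \<i> * pi - 2 * of_real (ln c))) / (2 * of_real (c\<^sup>2))"
    using c nz by (simp add: Q_def field_simps)
  finally show ?thesis by (simp add: f_def)
qed

lemma g_fun_eq_integral:
  assumes z: "Im z > 0"
  shows "integrable lborel (\<lambda>s. Ln (z - of_real s) * of_real (psi s))"
    and "g_fun z = (LINT f|lborel. indicator {0<..<pi/2} f *\<^sub>R ((Ln_sum z (2 * cos f)
      - of_real ((2 * cos f)\<^sup>2) / z\<^sup>2 * (Ln_sum z (2 * cos f) - \<i> * pi - 2 * of_real (ln (2 * cos f)))) / pi))" (is "_ = ?R")
proof -
  obtain A where A: "A \<ge> 0" "\<And>s. s \<ge> 0 \<Longrightarrow> norm (Ln (z - of_real s)) \<le> A * (1 + s)"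
    "\<And>s. s \<ge> 0 \<Longrightarrow> norm (Ln (z + of_real s)) \<le> A * (1 + s)"
    using Ln_sum_bound[OF z] by blast
  define k where "k = (\<lambda>s::real. Ln (z - of_real s) * of_real (psi s))"
  \<comment> \<open>The value at 0 comes from division by zero being zero; it makes the folding at 0
    exact.\<close>
  have psi: "psi 0 = 0" "psi (- s) = psi s" for s by (auto simp: psi_def)
  have 1: "integrable lborel (\<lambda>s. indicator {0<..} s *\<^sub>R k s)"
    using psi_Fubini(1)[of "\<lambda>s. Ln (z - of_real s)" A] A
    by (simp add: k_def scaleR_conv_of_real mult_ac)
  have 2: "integrable lborel (\<lambda>s. indicator {0<..} s *\<^sub>R k (- s))"
    using psi_Fubini(1)[of "\<lambda>s. Ln (z + of_real s)" A] A
    by (simp add: k_def psi scaleR_conv_of_real mult_ac)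
  have k0: "k 0 = 0" by (simp add: k_def psi)
  show "integrable lborel (\<lambda>s. Ln (z - of_real s) * of_real (psi s))"
    using integral_fold_half_line(1)[OF 1 2 k0] by (simp add: k_def)
  have "g_fun z = (LINT s|lborel. k s)" by (simp add: g_fun_def k_def)
  also have "\<dots> = (LINT s|lborel. indicator {0<..} s *\<^sub>R (k s + k (- s)))"
    by (rule integral_fold_half_line(2)[OF 1 2 k0])
  also have "\<dots> = (LINT s|lborel. indicator {0<..} s *\<^sub>R (psi s *\<^sub>R Ln_sum z s))"
    by (simp add: k_def psi Ln_sum_def scaleR_conv_of_real algebra_simps)
  also have "\<dots> = (LINT f|lborel. indicator {0<..<pi/2} f *\<^sub>R ((8 / pi * (cos f)\<^sup>2) *\<^sub>R
        (LINT s|lborel. indicator {2 * cos f<..} s *\<^sub>R ((1 / s ^ 3) *\<^sub>R Ln_sum z s))))"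
  proof (rule psi_Fubini(2)[where A = "2 * A"])
    fix s :: real assume "s > 0"
    then have "norm (Ln_sum z s) \<le> A * (1 + s) + A * (1 + s)"
      unfolding Ln_sum_def using A by (intro norm_triangle_le add_mono) auto
    then show "norm (Ln_sum z s) \<le> 2 * A * (1 + s)" by simp
  qed simp
  also have "\<dots> = ?R"
  proof (intro Bochner_Integration.integral_cong refl)
    fix f :: real
    show "indicator {0<..<pi/2} f *\<^sub>R ((8 / pi * (cos f)\<^sup>2) *\<^sub>R
        (LINT s|lborel. indicator {2 * cos f<..} s *\<^sub>R ((1 / s ^ 3) *\<^sub>R Ln_sum z s))) =
      indicator {0<..<pi/2} f *\<^sub>R ((Ln_sum z (2 * cos f)
      - of_real ((2 * cos f)\<^sup>2) / z\<^sup>2 * (Ln_sum z (2 * cos f) - \<i> * pi - 2 * of_real (ln (2 * cos f)))) / pi)"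
    proof (cases "f \<in> {0<..<pi/2}")
      case True
      then have c: "cos f > 0" by (intro cos_gt_zero) auto
      define X where "X = Ln_sum z (2 * cos f) - of_real ((2 * cos f)\<^sup>2) / z\<^sup>2 * (Ln_sum z (2 * cos f) - \<i> * pi - 2 * of_real (ln (2 * cos f)))"
      \<comment> \<open>The weight is \<open>2 / pi * c\<^sup>2\<close> with
        \<open>c = 2 * cos f\<close>, and the denominator of the tail integral is
        \<open>2 * c\<^sup>2\<close>.\<close>
      have "(8 / pi * (cos f)\<^sup>2) *\<^sub>R (X / (2 * of_real ((2 * cos f)\<^sup>2))) = X / pi"
        using c by (simp add: scaleR_conv_of_real field_simps)
      then show ?thesis
        using integral_Ln_sum_tail[OF z, of "2 * cos f"] c unfolding X_def by simp
    qed simp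
  qed
  finally show "g_fun z = ?R" .
qed

section \<open>Mean values on the circle\<close>

text \<open>The square of \<open>2 * cos t\<close> is
  \<open>2 + cis (2 * t) + cis (- (2 * t))\<close>. For a function holomorphic in the disk the
  constant picks out \<open>h 0\<close>, the negative frequency the second Taylor coefficient, and
  the positive frequency nothing.\<close>

lemma has_integral_circle_cos_weight:
  fixes h :: "complex \<Rightarrow> complex"
  assumes "h holomorphic_on ball 0 R" "R > 1"
  shows "((\<lambda>t. h (cis t)) has_integral 2 * pi * h 0) {0..2 * pi}"
    and "((\<lambda>t. of_real ((2 * cos t)\<^sup>2) * h (cis t)) has_integral 2 * pi * (2 * h 0 + deriv (deriv h) 0 / 2)) {0..2 * pi}"
proof -
  show 0: "((\<lambda>t. h (cis t)) has_integral 2 * pi * h 0) {0..2 * pi}"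
    using has_integral_circle_coeff[OF assms, of 0] by simp
  have 1: "((\<lambda>t. h (cis t) * cis (- (2 * t))) has_integral 2 * pi * (deriv (deriv h) 0 / 2)) {0..2 * pi}"
    using has_integral_circle_coeff[OF assms, of 2] by (simp add: eval_nat_numeral)
  have "(\<lambda>u. u\<^sup>2 * h u) holomorphic_on ball 0 R"
    by (intro holomorphic_intros assms)
  from has_integral_circle_coeff[OF this assms(2), of 0]
  have 2: "((\<lambda>t. (cis t)\<^sup>2 * h (cis t)) has_integral 0) {0..2 * pi}"
    by simp
  have eq: "of_real ((2 * cos t)\<^sup>2) * h (cis t) = 2 * h (cis t) + h (cis t) * cis (- (2 * t)) + (cis t)\<^sup>2 * h (cis t)" for t
  proof -
    have "complex_of_real (2 * cos t) = cis t + cis (- t)" by (simp add: complex_eq_iff)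
    then have "complex_of_real ((2 * cos t)\<^sup>2) = (cis t + cis (- t))\<^sup>2" by (metis of_real_power)
    also have "\<dots> = 2 + cis (- (2 * t)) + (cis t)\<^sup>2"
      by (simp add: power2_eq_square algebra_simps cis_mult)
    finally show ?thesis by (simp add: algebra_simps)
  qed
  have "((\<lambda>t. 2 * h (cis t) + h (cis t) * cis (- (2 * t)) + (cis t)\<^sup>2 * h (cis t)) has_integral
      2 * (2 * pi * h 0) + 2 * pi * (deriv (deriv h) 0 / 2) + 0) {0..2 * pi}"
    by (intro has_integral_add has_integral_mult_right 0 1 2)
  then show "((\<lambda>t. of_real ((2 * cos t)\<^sup>2) * h (cis t)) has_integral 2 * pi * (2 * h 0 + deriv (deriv h) 0 / 2)) {0..2 * pi}"
    unfolding eq by (simp add: algebra_simps)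
qed

text \<open>Only the Taylor coefficients of orders 0 and 2 enter, here \<open>c\<close> and
  \<open>- v\<^sup>2 / 2\<close>.\<close>

lemma Ln_one_minus_circle:
  fixes v c :: complex
  assumes "norm v < 1" "v \<noteq> 0"
  shows "((\<lambda>t. c + Ln (1 - v * cis t)) has_integral 2 * pi * c) {0..2 * pi}"
    and "((\<lambda>t. of_real ((2 * cos t)\<^sup>2) * (c + Ln (1 - v * cis t))) has_integral 2 * pi * (2 * c - v\<^sup>2 / 2)) {0..2 * pi}"
proof -
  define R where "R = 1 / norm v"
  have R: "R > 1" using assms by (simp add: R_def field_simps)
  define h where "h = (\<lambda>u. c + Ln (1 - v * u))"
  have nn: "1 - v * u \<notin> \<real>\<^sub>\<le>\<^sub>0" if "norm u < R" for u
    using that assms by (intro one_minus_notin_nonpos_Reals) (simp add: norm_mult R_def field_simps)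
  have hol: "h holomorphic_on ball 0 R"
    unfolding h_def using nn by (intro holomorphic_intros) auto
  have d1: "deriv h u = - v / (1 - v * u)" if "norm u < R" for u
    unfolding h_def using nn[OF that]
    by (intro DERIV_imp_deriv) (auto intro!: derivative_eq_intros simp: divide_inverse)
  have "deriv (deriv h) 0 = deriv (\<lambda>u. - v / (1 - v * u)) 0"
  proof (rule deriv_cong_ev)
    have "eventually (\<lambda>u. u \<in> ball (0::complex) R) (nhds 0)"
      using R by (intro eventually_nhds_in_open) auto
    then show "eventually (\<lambda>u. deriv h u = - v / (1 - v * u)) (nhds 0)"
      by eventually_elim (use d1 in auto)
  qed simp
  also have "\<dots> = - v\<^sup>2"
    by (intro DERIV_imp_deriv) (auto intro!: derivative_eq_intros simp: power2_eq_square)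
  finally have d2: "deriv (deriv h) 0 = - v\<^sup>2" .
  show "((\<lambda>t. c + Ln (1 - v * cis t)) has_integral 2 * pi * c) {0..2 * pi}"
    using has_integral_circle_cos_weight(1)[OF hol R] by (simp add: h_def)
  show "((\<lambda>t. of_real ((2 * cos t)\<^sup>2) * (c + Ln (1 - v * cis t))) has_integral 2 * pi * (2 * c - v\<^sup>2 / 2)) {0..2 * pi}"
    using has_integral_circle_cos_weight(2)[OF hol R] unfolding d2 by (simp add: h_def)
qed

lemma Im_Joukowski_pos:
  fixes U z :: complex
  assumes "norm U > 1" "U + 1 / U = z" "Im z > 0"
  shows "Im U > 0"
proof -
  have U: "U \<noteq> 0" using assms by auto
  have "Im z = Im U * (1 - 1 / (norm U)\<^sup>2)"
  proof -
    have "Im (1 / U) = - Im U / (norm U)\<^sup>2" by (simp add: Im_divide cmod_power2)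
    then show ?thesis by (simp add: assms(2)[symmetric] algebra_simps)
  qed
  moreover have "1 / (norm U)\<^sup>2 < 1" using assms(1) U unfolding power2_eq_square by (subst divide_less_eq_1_pos) (auto simp: less_1_mult intro: mult_pos_pos)
  ultimately show ?thesis using assms(3) by (simp add: zero_less_mult_iff)
qed

text \<open>Both sides have the same exponential, because \<open>z - 2 * cos t\<close> factors as
  \<open>U * (1 - cis t / U) * (1 - cis (- t) / U)\<close>. They agree since the imaginary part of
  the left side lies in \<open>(0, pi)\<close> and that of the right side in
  \<open>(- pi, 2 * pi)\<close>, which leaves no room for a nonzero multiple of
  \<open>2 * pi\<close>.\<close>

lemma Ln_minus_two_cos:
  fixes U z :: complex
  assumes "norm U > 1" "U + 1 / U = z" "Im z > 0"
  shows "Ln (z - of_real (2 * cos t)) = Ln U + Ln (1 - 1 / U * cis t) + Ln (1 - 1 / U * cis (- t))"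
proof -
  have U: "U \<noteq> 0" "Im U > 0" using assms Im_Joukowski_pos by auto
  define A where "A = Ln (z - of_real (2 * cos t))"
  define B where "B = Ln U + Ln (1 - 1 / U * cis t) + Ln (1 - 1 / U * cis (- t))"
  have "1 / norm U < 1" using assms(1) by (subst divide_less_eq_1_pos) auto
  then have lt: "norm (1 / U * cis s) < 1" for s by (simp add: norm_mult norm_divide)
  have nz: "1 - 1 / U * cis s \<noteq> 0" for s
    using one_minus_notin_nonpos_Reals[OF lt[of s]] by auto
  have zc: "Im (z - of_real (2 * cos t)) > 0" using assms(3) by simp
  then have zc0: "z - of_real (2 * cos t) \<noteq> 0" by auto
  have "exp B = U * (1 - 1 / U * cis t) * (1 - 1 / U * cis (- t))"
    unfolding B_def exp_add exp_Ln[OF nz] exp_Ln[OF U(1)] by (rule refl)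
  also have "\<dots> = (U + 1 / U * (cis t * cis (- t))) - (cis t + cis (- t))"
    using U by (simp add: field_simps)
  also have "cis t * cis (- t) = 1" by (simp add: cis_mult)
  also have "cis t + cis (- t) = of_real (2 * cos t)" by (simp add: complex_eq_iff)
  finally have "exp B = exp A" unfolding A_def using zc0 assms(2) by simp
  then obtain n :: int where n: "B = A + of_real (2 * n * pi) * \<i>"
    using exp_eq by metis
  have re: "Re (1 - 1 / U * cis s) > 0" for s
    using lt[of s] complex_Re_le_cmod[of "1 / U * cis s"] by simp
  have im: "\<bar>Im (Ln (1 - 1 / U * cis s))\<bar> < pi / 2" for s
    using re[of s] nz[of s] by (intro Re_Ln_pos_lt_imp)
  have A: "0 < Im A" "Im A < pi"
    unfolding A_def using zc zc0 Im_Ln_pos_lt[of "z - of_real (2 * cos t)"] by auto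
  have "0 < Im (Ln U)" "Im (Ln U) < pi"
    using U Im_Ln_pos_lt[of U] by auto
  then have B: "- pi < Im B" "Im B < 2 * pi"
    using im[of t] im[of "- t"] unfolding B_def by auto
  have "Im B = Im A + 2 * n * pi" unfolding n by simp
  then have *: "- 2 * pi < 2 * n * pi" "2 * n * pi < 2 * pi" using A B by linarith+
  have "\<not> n \<le> -1"
  proof
    assume "n \<le> -1"
    then have "2 * real_of_int n * pi \<le> - 2 * pi" by (intro mult_right_mono) auto
    then show False using * by simp
  qed
  moreover have "\<not> n \<ge> 1"
  proof
    assume "n \<ge> 1"
    then have "2 * pi \<le> 2 * real_of_int n * pi" by (intro mult_right_mono) auto
    then show False using * by simp
  qed
  ultimately have "n = 0" by simp
  then show ?thesis using n unfolding A_def B_def by simp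
qed

text \<open>Reduces a full period to the quarter period of the mixture. Pairing \<open>t\<close>
  with \<open>pi - t\<close> changes the sign of the cosine and so produces
  \<open>Ln_sum\<close>.\<close>

lemma integral_symmetric_circle:
  fixes k :: "real \<Rightarrow> complex"
  assumes cont: "continuous_on UNIV k" and sym: "\<And>t. k (2 * pi - t) = k t"
  shows "integral {0..2 * pi} k = 2 * integral {0..pi/2} (\<lambda>t. k t + k (pi - t))"
proof -
  have int: "k integrable_on {a..b}" "(\<lambda>t. k (c - t)) integrable_on {a..b}" for a b c
    by (auto intro!: integrable_continuous_interval continuous_on_compose2[OF cont] continuous_intros)
  have refl: "integral {a..b} (\<lambda>t. k (c - t)) = integral {c - b..c - a} k" for a b c
  proof -
    have "integral {a..b} (\<lambda>t. k (c - t)) = integral {- b..- a} (k \<circ> (\<lambda>t. t + c))"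
      using Henstock_Kurzweil_Integration.integral_reflect_real[of "-a" "-b" "\<lambda>t. k (t + c)"] by (simp add: o_def)
    also have "\<dots> = integral {- b + c..- a + c} k"
      by (rule integral_shift) (rule continuous_on_subset[OF cont], simp)
    finally show ?thesis by simp
  qed
  have "integral {0..2 * pi} k = integral {0..pi} k + integral {pi..2 * pi} k"
    using int by (intro Henstock_Kurzweil_Integration.integral_combine[symmetric]) auto
  also have "integral {pi..2 * pi} k = integral {0..pi} (\<lambda>t. k (2 * pi - t))"
    by (simp add: refl)
  also have "\<dots> = integral {0..pi} k" by (simp add: sym)
  also have "integral {0..pi} k = integral {0..pi/2} k + integral {pi/2..pi} k"
    using int by (intro Henstock_Kurzweil_Integration.integral_combine[symmetric]) auto
  also have "integral {pi/2..pi} k = integral {0..pi/2} (\<lambda>t. k (pi - t))"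
    by (simp add: refl)
  also have "integral {0..pi/2} k + integral {0..pi/2} (\<lambda>t. k (pi - t)) = integral {0..pi/2} (\<lambda>t. k t + k (pi - t))"
    using int by (intro Henstock_Kurzweil_Integration.integral_add[symmetric]) auto
  finally show ?thesis by simp
qed

lemma Ln_sum_mean:
  fixes U z :: complex
  assumes U: "norm U > 1" "U + 1 / U = z" and z: "Im z > 0"
  shows "has_bochner_integral lborel (\<lambda>t. indicator {0<..<pi/2} t *\<^sub>R Ln_sum z (2 * cos t)) (pi * Ln U)"
    and "has_bochner_integral lborel (\<lambda>t. indicator {0<..<pi/2} t *\<^sub>R (of_real ((2 * cos t)\<^sup>2) * Ln_sum z (2 * cos t)))
      (pi * (2 * Ln U - 1 / U\<^sup>2))"
proof -
  define v where "v = 1 / U"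
  have "1 / norm U < 1" using U(1) by (subst divide_less_eq_1_pos) auto
  then have v: "norm v < 1" "v \<noteq> 0" using U(1) by (auto simp: v_def norm_divide)
  define k where "k = (\<lambda>t. Ln (z - of_real (2 * cos t)))"
  have cont: "continuous_on S k" for S
    unfolding k_def using z by (intro continuous_intros) (auto simp: complex_nonpos_Reals_iff)
  have kk: "k t + k (pi - t) = Ln_sum z (2 * cos t)" for t
    by (simp add: k_def Ln_sum_def)
  have cw: "continuous_on S (\<lambda>t. of_real ((2 * cos t)\<^sup>2) * k t)" for S
    by (intro continuous_intros cont)
  \<comment> \<open>The factor with \<open>cis (- t)\<close> is not boundary data of a function
    holomorphic in the disk, but its conjugate is, with \<open>cnj v\<close> in place of
    \<open>v\<close>.\<close>
  have k: "k t = (Ln U + Ln (1 - v * cis t)) + cnj (0 + Ln (1 - cnj v * cis t))" for t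
  proof -
    have "norm (cnj v * cis t) < 1" using v by (simp add: norm_mult)
    then have "cnj (Ln (1 - cnj v * cis t)) = Ln (cnj (1 - cnj v * cis t))"
      by (intro cnj_Ln one_minus_notin_nonpos_Reals)
    also have "cnj (1 - cnj v * cis t) = 1 - v * cis (- t)" by (simp add: cis_cnj)
    finally show ?thesis
      using Ln_minus_two_cos[OF U z, of t] by (simp add: k_def v_def)
  qed
  have cn: "((\<lambda>t. cnj (f t)) has_integral cnj I) S" if "(f has_integral I) S" for f and I :: complex and S :: "real set"
    using has_integral_linear[OF that bounded_linear_cnj] by (simp add: o_def)
  have v': "norm (cnj v) < 1" "cnj v \<noteq> 0" using v by auto
  have "(k has_integral 2 * pi * Ln U + cnj 0) {0..2 * pi}"
    unfolding k
    by (intro has_integral_add Ln_one_minus_circle(1)[OF v] cn) (use Ln_one_minus_circle(1)[OF v', of 0] in simp)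
  then have 1: "integral {0..2 * pi} k = 2 * pi * Ln U"
    by (simp add: integral_unique)
  have "((\<lambda>t. of_real ((2 * cos t)\<^sup>2) * (Ln U + Ln (1 - v * cis t)) + cnj (of_real ((2 * cos t)\<^sup>2) * (0 + Ln (1 - cnj v * cis t))))
     has_integral 2 * pi * (2 * Ln U - v\<^sup>2 / 2) + cnj (2 * pi * (2 * 0 - (cnj v)\<^sup>2 / 2))) {0..2 * pi}"
    by (intro has_integral_add Ln_one_minus_circle(2)[OF v] cn Ln_one_minus_circle(2)[OF v'])
  then have "((\<lambda>t. of_real ((2 * cos t)\<^sup>2) * k t) has_integral 2 * pi * (2 * Ln U - v\<^sup>2)) {0..2 * pi}"
    unfolding k by (simp add: algebra_simps)
  then have 2: "integral {0..2 * pi} (\<lambda>t. of_real ((2 * cos t)\<^sup>2) * k t) = 2 * pi * (2 * Ln U - v\<^sup>2)"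
    by (simp add: integral_unique)
  have per: "k (2 * pi - t) = k t" for t
    by (simp add: k_def cos_diff)
  have conv: "has_bochner_integral lborel (\<lambda>t. indicator {0<..<pi/2} t *\<^sub>R q t) (integral {0..pi/2} q)"
    if "continuous_on UNIV q" for q :: "real \<Rightarrow> complex"
  proof -
    have si: "set_integrable lborel {0..pi/2} q"
      using that by (intro borel_integrable_atLeastAtMost') (auto intro: continuous_on_subset)
    have "set_integrable lborel {0<..<pi/2} q"
      by (rule set_integrable_subset[OF si]) auto
    moreover have "(LBINT t=ereal 0..ereal (pi/2). q t) = integral {0..pi/2} q"
      using si by (intro interval_integral_eq_integral) auto
    then have "(LBINT t:{0<..<pi/2}. q t) = integral {0..pi/2} q"
      by (simp add: interval_lebesgue_integral_def)
    ultimately show ?thesis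
      by (simp add: has_bochner_integral_iff set_integrable_def set_lebesgue_integral_def)
  qed
  have cL: "continuous_on UNIV (\<lambda>t. Ln_sum z (2 * cos t))"
    unfolding kk[symmetric]
    by (intro continuous_intros continuous_on_compose2[OF cont[of UNIV]]) auto
  show "has_bochner_integral lborel (\<lambda>t. indicator {0<..<pi/2} t *\<^sub>R Ln_sum z (2 * cos t)) (pi * Ln U)"
    using conv[OF cL] integral_symmetric_circle[OF cont per] 1 by (simp add: kk)
  have "continuous_on UNIV (\<lambda>t. of_real ((2 * cos t)\<^sup>2) * Ln_sum z (2 * cos t))"
    by (intro continuous_intros cL)
  from conv[OF this]
  show "has_bochner_integral lborel (\<lambda>t. indicator {0<..<pi/2} t *\<^sub>R (of_real ((2 * cos t)\<^sup>2) * Ln_sum z (2 * cos t)))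
      (pi * (2 * Ln U - 1 / U\<^sup>2))"
    using integral_symmetric_circle[OF cw] per 2
    by (simp add: kk[symmetric] cos_diff distrib_left v_def power_divide)
qed

text \<open>A majorant uniform in \<open>d\<close>, for dominated convergence as \<open>d\<close>
  tends to 0. The logarithm is at most 8 and \<open>c\<^sup>2\<close> at most 4; from below,
  \<open>ln (c\<^sup>2) \<ge> - (1 / c\<^sup>2)\<close> keeps the product above -1.\<close>

lemma square_times_ln_bounds:
  fixes c d :: real
  assumes "0 < c" "c \<le> 2" "0 \<le> d" "d \<le> 4"
  shows "\<bar>c\<^sup>2 * ln (d + c\<^sup>2)\<bar> \<le> 32"
proof -
  have c2: "c\<^sup>2 \<le> 4" "c\<^sup>2 > 0" using assms power_mono[of c 2 2] by auto
  have "ln (d + c\<^sup>2) \<le> 8"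
    using ln_le_minus_one[of "d + c\<^sup>2"] c2 assms by linarith
  then have "c\<^sup>2 * ln (d + c\<^sup>2) \<le> c\<^sup>2 * 8" using c2 by (intro mult_left_mono) auto
  then have 1: "c\<^sup>2 * ln (d + c\<^sup>2) \<le> 32" using c2 by linarith
  have "ln (1 / c\<^sup>2) \<le> 1 / c\<^sup>2 - 1" using c2 by (intro ln_le_minus_one) auto
  then have "- ln (c\<^sup>2) \<le> 1 / c\<^sup>2" using c2 by (simp add: ln_div)
  moreover have "ln (c\<^sup>2) \<le> ln (d + c\<^sup>2)" using c2 assms by (subst ln_le_cancel_iff) linarith+
  ultimately have "- (1 / c\<^sup>2) \<le> ln (d + c\<^sup>2)" by linarith
  then have "c\<^sup>2 * (- (1 / c\<^sup>2)) \<le> c\<^sup>2 * ln (d + c\<^sup>2)" using c2 by (intro mult_left_mono) auto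
  then have "-1 \<le> c\<^sup>2 * ln (d + c\<^sup>2)" using c2 by simp
  with 1 show ?thesis by simp
qed

text \<open>
  The value is the limit of the real part of the weighted mean in \<open>Ln_sum_mean\<close> as \<open>z = U + 1 / U\<close> tends to \<open>0\<close>
  along the imaginary axis.
\<close>

lemma integral_cos_squared_ln:
  "has_bochner_integral lborel (\<lambda>t. indicator {0<..<pi/2} t *\<^sub>R ((2 * cos t)\<^sup>2 * ln ((2 * cos t)\<^sup>2))) pi"
proof -
  define U where "U = (\<lambda>n::nat. 1 + 1 / (real n + 1))"
  define d where "d = (\<lambda>n. (U n - 1 / U n)\<^sup>2)"
  define F where "F = (\<lambda>n t. indicator {0<..<pi/2} t *\<^sub>R ((2 * cos t)\<^sup>2 * ln (d n + (2 * cos t)\<^sup>2)))"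
  have U: "U n > 1" "U n \<le> 2" for n by (auto simp: U_def divide_simps)
  have d: "0 \<le> d n" "d n \<le> 4" for n
  proof -
    have "0 \<le> U n - 1 / U n" "U n - 1 / U n \<le> 2"
    proof -
      have "0 \<le> 1 / U n" "1 / U n \<le> 1" using U[of n] by (auto simp: divide_simps)
      then show "0 \<le> U n - 1 / U n" "U n - 1 / U n \<le> 2" using U[of n] by linarith+
    qed
    then have "(U n - 1 / U n)\<^sup>2 \<le> 2\<^sup>2" by (intro power_mono) auto
    then show "0 \<le> d n" "d n \<le> 4" by (auto simp: d_def)
  qed
  have LU: "U \<longlonglongrightarrow> 1" unfolding U_def by real_asymp
  have Ld: "d \<longlonglongrightarrow> (1 - 1 / 1)\<^sup>2" unfolding d_def by (intro tendsto_intros LU) auto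
  have F: "has_bochner_integral lborel (F n) (pi * (2 * ln (U n) + 1 / (U n)\<^sup>2))" for n
  proof -
    \<comment> \<open>With \<open>u\<close> on the imaginary axis also \<open>z\<close> is
      imaginary, so both \<open>z - 2 * cos t\<close> and \<open>z + 2 * cos t\<close> have squared
      modulus \<open>d n + (2 * cos t)\<^sup>2\<close>, and the real part of \<open>Ln_sum\<close>
      is the logarithm in \<open>F n\<close>.\<close>
    define u where "u = \<i> * of_real (U n)"
    define z where "z = u + 1 / u"
    have z: "z = \<i> * of_real (U n - 1 / U n)"
      using U[of n] by (simp add: z_def u_def field_simps)
    have "norm u > 1" using U[of n] by (simp add: u_def norm_mult)
    moreover have imz: "Im z > 0" using U[of n] by (simp add: z divide_simps less_1_mult)
    ultimately have "has_bochner_integral lborel (\<lambda>t. indicator {0<..<pi/2} t *\<^sub>R (of_real ((2 * cos t)\<^sup>2) * Ln_sum z (2 * cos t)))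
      (pi * (2 * Ln u - 1 / u\<^sup>2))"
      by (intro Ln_sum_mean) (auto simp: z_def)
    from has_bochner_integral_Re[OF this]
    have "has_bochner_integral lborel (\<lambda>t. Re (indicator {0<..<pi/2} t *\<^sub>R (of_real ((2 * cos t)\<^sup>2) * Ln_sum z (2 * cos t))))
       (Re (pi * (2 * Ln u - 1 / u\<^sup>2)))" .
    also have "(\<lambda>t. Re (indicator {0<..<pi/2} t *\<^sub>R (of_real ((2 * cos t)\<^sup>2) * Ln_sum z (2 * cos t)))) = F n"
    proof
      fix t
      have nz: "z - of_real (2 * cos t) \<noteq> 0" "z + of_real (2 * cos t) \<noteq> 0"
        using imz by (auto simp: complex_eq_iff)
      have "(norm (z - of_real (2 * cos t)))\<^sup>2 = d n + (2 * cos t)\<^sup>2" "(norm (z + of_real (2 * cos t)))\<^sup>2 = d n + (2 * cos t)\<^sup>2"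
        by (simp_all add: cmod_power2 z d_def)
      then have "2 * ln (norm (z - of_real (2 * cos t))) = ln (d n + (2 * cos t)\<^sup>2)"
         "2 * ln (norm (z + of_real (2 * cos t))) = ln (d n + (2 * cos t)\<^sup>2)"
        by (metis ln_realpow nz norm_eq_zero zero_less_norm_iff of_nat_numeral)+
      then have "Re (Ln_sum z (2 * cos t)) = ln (d n + (2 * cos t)\<^sup>2)"
        using nz unfolding Ln_sum_def by simp
      moreover have "Re (of_real x * w) = x * Re w" for x w by simp
      ultimately show "Re (indicator {0<..<pi/2} t *\<^sub>R (of_real ((2 * cos t)\<^sup>2) * Ln_sum z (2 * cos t))) = F n t"
        unfolding F_def by (simp del: of_real_power of_real_mult)
    qed
    also have "Re (pi * (2 * Ln u - 1 / u\<^sup>2)) = pi * (2 * ln (U n) + 1 / (U n)\<^sup>2)"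
      using U[of n] by (simp add: u_def norm_mult power_mult_distrib)
    finally show ?thesis .
  qed
  have dom: "(\<lambda>n. LINT t|lborel. F n t) \<longlonglongrightarrow> (LINT t|lborel. indicator {0<..<pi/2} t *\<^sub>R ((2 * cos t)\<^sup>2 * ln ((2 * cos t)\<^sup>2)))"
    and int: "integrable lborel (\<lambda>t. indicator {0<..<pi/2} t *\<^sub>R ((2 * cos t)\<^sup>2 * ln ((2 * cos t)\<^sup>2)))"
  proof -
    have m1: "(\<lambda>t. indicator {0<..<pi/2} t *\<^sub>R ((2 * cos t)\<^sup>2 * ln ((2 * cos t)\<^sup>2))) \<in> borel_measurable lborel"
      by simp
    have m2: "F n \<in> borel_measurable lborel" for n unfolding F_def by simp
    have w: "integrable lborel (\<lambda>t. indicator {0<..<pi/2} t *\<^sub>R (32::real))"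
      by (simp add: integrable_real_indicator)
    have lim: "AE t in lborel. (\<lambda>n. F n t) \<longlonglongrightarrow> indicator {0<..<pi/2} t *\<^sub>R ((2 * cos t)\<^sup>2 * ln ((2 * cos t)\<^sup>2))"
    proof (rule AE_I2)
      fix t :: real
      show "(\<lambda>n. F n t) \<longlonglongrightarrow> indicator {0<..<pi/2} t *\<^sub>R ((2 * cos t)\<^sup>2 * ln ((2 * cos t)\<^sup>2))"
      proof (cases "t \<in> {0<..<pi/2}")
        case True
        then have c: "cos t > 0" by (intro cos_gt_zero) auto
        have "(\<lambda>n. (2 * cos t)\<^sup>2 * ln (d n + (2 * cos t)\<^sup>2)) \<longlonglongrightarrow> (2 * cos t)\<^sup>2 * ln ((1 - 1 / 1)\<^sup>2 + (2 * cos t)\<^sup>2)"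
          using c by (intro tendsto_intros Ld) auto
        then show ?thesis using True by (simp add: F_def)
      qed (simp add: F_def)
    qed
    have bd: "AE t in lborel. norm (F n t) \<le> indicator {0<..<pi/2} t *\<^sub>R (32::real)" for n
    proof (rule AE_I2)
      fix t :: real
      show "norm (F n t) \<le> indicator {0<..<pi/2} t *\<^sub>R (32::real)"
      proof (cases "t \<in> {0<..<pi/2}")
        case True
        then have c: "cos t > 0" by (intro cos_gt_zero) auto
        then have "\<bar>(2 * cos t)\<^sup>2 * ln (d n + (2 * cos t)\<^sup>2)\<bar> \<le> 32"
          using d[of n] by (intro square_times_ln_bounds) auto
        then show ?thesis using True by (simp add: F_def)
      qed (simp add: F_def)
    qed
    show "(\<lambda>n. LINT t|lborel. F n t) \<longlonglongrightarrow> (LINT t|lborel. indicator {0<..<pi/2} t *\<^sub>R ((2 * cos t)\<^sup>2 * ln ((2 * cos t)\<^sup>2)))"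
      using integral_dominated_convergence[OF m1 m2 w lim bd] .
    show "integrable lborel (\<lambda>t. indicator {0<..<pi/2} t *\<^sub>R ((2 * cos t)\<^sup>2 * ln ((2 * cos t)\<^sup>2)))"
      using integrable_dominated_convergence[OF m1 m2 w lim bd] .
  qed
  have "(\<lambda>n. LINT t|lborel. F n t) = (\<lambda>n. pi * (2 * ln (U n) + 1 / (U n)\<^sup>2))"
    using F by (auto simp: has_bochner_integral_iff)
  also have "\<dots> \<longlonglongrightarrow> pi * (2 * ln 1 + 1 / 1\<^sup>2)"
    by (intro tendsto_intros LU) auto
  finally have "(LINT t|lborel. indicator {0<..<pi/2} t *\<^sub>R ((2 * cos t)\<^sup>2 * ln ((2 * cos t)\<^sup>2))) = pi * (2 * ln 1 + 1 / 1\<^sup>2)"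
    using dom LIMSEQ_unique by blast
  then show ?thesis using int by (simp add: has_bochner_integral_iff)
qed

text \<open>Averaging the tail formula over \<open>f\<close> involves four integrals: the plain and
  the weighted mean of \<open>Ln_sum\<close>, the mean of \<open>(cos t)\<^sup>2\<close>, which
  yields \<open>\<i> * pi\<close>, and the logarithmic moment
  \<open>integral_cos_squared_ln\<close>, which yields the constant 1.\<close>

lemma g_fun_closed_form:
  assumes "norm U > 1" "U + 1 / U = z" "Im z > 0"
  shows "g_fun z = Ln U - (2 * Ln U - 1 / U\<^sup>2 - \<i> * pi - 1) / z\<^sup>2"
proof -
  have z: "z \<noteq> 0" using assms(3) by auto
  note M = Ln_sum_mean[OF assms]
  have "has_bochner_integral lborel (\<lambda>t. indicator {0<..<pi/2} t *\<^sub>R (cos t)\<^sup>2) (pi / 4)"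
  proof -
    have "set_integrable lborel {0..pi/2} (\<lambda>t. (cos t)\<^sup>2)"
      by (intro borel_integrable_atLeastAtMost') (auto intro!: continuous_intros)
    then have "set_integrable lborel {0<..<pi/2} (\<lambda>t. (cos t)\<^sup>2)"
      by (rule set_integrable_subset) auto
    then show ?thesis
      using integral_cos_squared[of 0] by (simp add: has_bochner_integral_iff set_integrable_def)
  qed
  then have C: "has_bochner_integral lborel (\<lambda>t. complex_of_real (indicator {0<..<pi/2} t *\<^sub>R (cos t)\<^sup>2)) (of_real (pi / 4))"
    by (rule has_bochner_integral_of_real)
  have L: "has_bochner_integral lborel (\<lambda>t. complex_of_real (indicator {0<..<pi/2} t *\<^sub>R ((2 * cos t)\<^sup>2 * ln ((2 * cos t)\<^sup>2)))) (of_real pi)"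
    by (rule has_bochner_integral_of_real[OF integral_cos_squared_ln])
  let ?F = "\<lambda>t. (indicator {0<..<pi/2} t *\<^sub>R Ln_sum z (2 * cos t)) / pi
     - (1 / (pi * z\<^sup>2)) * ((indicator {0<..<pi/2} t *\<^sub>R (of_real ((2 * cos t)\<^sup>2) * Ln_sum z (2 * cos t)))
        - (4 * \<i> * pi) * of_real (indicator {0<..<pi/2} t *\<^sub>R (cos t)\<^sup>2)
        - of_real (indicator {0<..<pi/2} t *\<^sub>R ((2 * cos t)\<^sup>2 * ln ((2 * cos t)\<^sup>2))))"
  let ?I = "pi * Ln U / pi - (1 / (pi * z\<^sup>2)) * (pi * (2 * Ln U - 1 / U\<^sup>2) - (4 * \<i> * pi) * of_real (pi / 4) - of_real pi)"
  have "has_bochner_integral lborel ?F ?I"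
    by (intro has_bochner_integral_diff has_bochner_integral_mult_right has_bochner_integral_divide M C L)
  then have "(LINT t|lborel. ?F t) = ?I"
    by (simp only: has_bochner_integral_iff)
  also have "\<dots> = Ln U - (2 * Ln U - 1 / U\<^sup>2 - \<i> * pi - 1) / z\<^sup>2"
    using z by (simp add: field_simps)
  finally show ?thesis
    unfolding g_fun_eq_integral(2)[OF assms(3)]
  proof (rule trans[rotated], intro Bochner_Integration.integral_cong refl)
    fix t
    show "indicator {0<..<pi/2} t *\<^sub>R ((Ln_sum z (2 * cos t)
      - of_real ((2 * cos t)\<^sup>2) / z\<^sup>2 * (Ln_sum z (2 * cos t) - \<i> * pi - 2 * of_real (ln (2 * cos t)))) / pi) = ?F t"
    proof (cases "t \<in> {0<..<pi/2}")
      case True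
      then have c: "cos t > 0" by (intro cos_gt_zero) auto
      have "(L - x / z\<^sup>2 * (L - \<i> * pi - 2 * l)) / pi = L / pi - (1 / (pi * z\<^sup>2)) * (x * L - (4 * \<i> * pi) * y - x * (2 * l))"
        if "x = 4 * y" for L x l y :: complex
        using z unfolding that by (simp add: field_simps)
      from this[of "of_real ((2 * cos t)\<^sup>2)" "of_real ((cos t)\<^sup>2)" "Ln_sum z (2 * cos t)" "of_real (ln (2 * cos t))"]
      moreover have "ln ((2 * cos t)\<^sup>2) = 2 * ln (2 * cos t)" unfolding power2_eq_square using c by (subst ln_mult_pos) auto
      ultimately show ?thesis using True by simp
    qed simp
  qed
qed

section \<open>The phase function\<close>

text \<open>Principal roots of points in the upper half plane lie in the open first quadrant, so
  their product has positive imaginary part, and so has \<open>U\<close>. The modulus then follows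
  from \<open>Im z = Im U * (1 - 1 / (norm U)\<^sup>2)\<close>.\<close>

lemma varphi_half:
  fixes z :: complex
  assumes "Im z > 0"
  shows "varphi (z / 2) + 1 / varphi (z / 2) = z" "norm (varphi (z / 2)) > 1" "Im (varphi (z / 2)) > 0"
    "varphi (z / 2) \<noteq> 0"
proof -
  define a where "a = csqrt (z / 2 - 1)"
  define b where "b = csqrt (z / 2 + 1)"
  define U where "U = varphi (z / 2)"
  have quad: "Re (csqrt w) > 0 \<and> Im (csqrt w) > 0" if "Im w > 0" for w
  proof -
    have "Im w = 2 * Re (csqrt w) * Im (csqrt w)"
      using arg_cong[OF power2_csqrt[of w], of Im] unfolding Im_power2 by (rule sym)
    moreover have "Re (csqrt w) \<ge> 0" by (rule Re_csqrt)
    moreover have "x > 0 \<and> y > 0" if "2 * x * y > 0" "x \<ge> 0" for x y :: real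
      using that by (auto simp: zero_less_mult_iff)
    ultimately show ?thesis using that by metis
  qed
  have ab: "Re a > 0" "Im a > 0" "Re b > 0" "Im b > 0"
    using assms quad[of "z / 2 - 1"] quad[of "z / 2 + 1"] unfolding a_def b_def
    by (auto simp del: csqrt.simps)
  have U: "U = z / 2 + a * b" by (simp add: U_def varphi_def a_def b_def)
  have "U * (z / 2 - a * b) = (z / 2)\<^sup>2 - a\<^sup>2 * b\<^sup>2"
    unfolding U by (simp add: algebra_simps power2_eq_square)
  also have "\<dots> = 1"
    unfolding a_def b_def power2_csqrt by (simp add: algebra_simps power2_eq_square)
  finally have 1: "U * (z / 2 - a * b) = 1" .
  then have U0: "U \<noteq> 0" by auto
  then have "1 / U = z / 2 - a * b" using 1 by (simp add: field_simps)
  then have sum: "U + 1 / U = z" unfolding U by simp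
  have imU: "Im U > 0"
    using ab assms unfolding U by (auto intro!: add_pos_pos mult_pos_pos)
  have "Im (1 / U) = - Im U / (norm U)\<^sup>2" by (simp add: Im_divide cmod_power2)
  then have "Im z = Im U * (1 - 1 / (norm U)\<^sup>2)"
    unfolding sum[symmetric] by (simp add: algebra_simps)
  then have "1 / (norm U)\<^sup>2 < 1" using imU assms by (simp add: zero_less_mult_iff)
  then have "(norm U)\<^sup>2 > 1\<^sup>2" using U0 by (simp add: divide_less_eq)
  then have "norm U > 1" by (rule power_less_imp_less_base) simp
  then show "varphi (z / 2) + 1 / varphi (z / 2) = z" "norm (varphi (z / 2)) > 1" "Im (varphi (z / 2)) > 0"
    "varphi (z / 2) \<noteq> 0"
    using sum imU U0 by (simp_all add: U_def)
qed

text \<open>The mixture has a nonnegative integrand. The sign is what monotone convergence needs in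
  the computation of \<open>l_const\<close>.\<close>

lemma psi_nonneg: "psi s \<ge> 0"
proof -
  have pos: "psi s \<ge> 0" if "s > 0" for s
    unfolding psi_eq_integral[OF that] using that by (intro Bochner_Integration.integral_nonneg) auto
  have "psi s = psi \<bar>s\<bar>" by (simp add: psi_def)
  moreover have "psi 0 = 0" by (simp add: psi_def)
  ultimately show ?thesis using pos[of "\<bar>s\<bar>"] by (cases "s = 0") auto
qed

lemma psi_measurable [measurable]: "psi \<in> borel_measurable borel"
  unfolding psi_def by measurable

text \<open>
  \<open>l_const / 2\<close> is the limit of \<open>Re (g_fun z)\<close> for \<open>z = 2 + \<i> * d\<close>, \<open>d \<down> 0\<close>, where the closed form is continuous; monotone
  convergence takes care of the singularity of \<open>ln \<bar>2 - s\<bar>\<close>.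
\<close>

lemma l_const_eq: "l_const = 1"
proof -
  define d where "d = (\<lambda>n::nat. 1 / (real n + 1))"
  define z where "z = (\<lambda>n. Complex 2 (d n))"
  define U where "U = (\<lambda>n. varphi (z n / 2))"
  have d: "d n > 0" for n by (simp add: d_def)
  have imz: "Im (z n) > 0" for n using d by (simp add: z_def)
  have Ld: "d \<longlonglongrightarrow> 0" unfolding d_def by real_asymp
  have zn: "z n = 2 + \<i> * of_real (d n)" for n by (simp add: z_def complex_eq_iff)
  have Lz: "z \<longlonglongrightarrow> 2"
  proof -
    have "(\<lambda>n. 2 + \<i> * of_real (d n)) \<longlonglongrightarrow> 2 + \<i> * of_real 0" by (intro tendsto_intros Ld)
    moreover have "z = (\<lambda>n. 2 + \<i> * of_real (d n))" using zn by (simp add: fun_eq_iff)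
    ultimately show ?thesis by simp
  qed
  have "U \<longlonglongrightarrow> 1"
  proof -
    have "(\<lambda>n. csqrt (z n / 2 - 1)) \<longlonglongrightarrow> 0"
    proof (rule tendsto_norm_zero_cancel)
      have "(\<lambda>n. sqrt (norm (z n / 2 - 1))) \<longlonglongrightarrow> sqrt (norm (2 / 2 - 1 :: complex))"
        by (intro tendsto_intros Lz) auto
      then show "(\<lambda>n. norm (csqrt (z n / 2 - 1))) \<longlonglongrightarrow> 0" by simp
    qed
    moreover have "(\<lambda>n. csqrt (z n / 2 + 1)) \<longlonglongrightarrow> csqrt (2 / 2 + 1)"
      by (intro isCont_tendsto_compose[where g = csqrt] tendsto_intros Lz continuous_at_csqrt)
         (auto simp: complex_nonpos_Reals_iff)
    ultimately have "(\<lambda>n. z n / 2 + csqrt (z n / 2 - 1) * csqrt (z n / 2 + 1)) \<longlonglongrightarrow> 2 / 2 + 0 * csqrt (2 / 2 + 1)"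
      by (intro tendsto_intros Lz) auto
    then show ?thesis by (simp add: U_def varphi_def)
  qed
  \<comment> \<open>At \<open>U = 1\<close>, \<open>z = 2\<close> the closed form takes the value
    \<open>1 / 2 + \<i> * pi / 4\<close>.\<close>
  then have "(\<lambda>n. Ln (U n) - (2 * Ln (U n) - 1 / (U n)\<^sup>2 - \<i> * pi - 1) / (z n)\<^sup>2) \<longlonglongrightarrow>
      Ln 1 - (2 * Ln 1 - 1 / 1\<^sup>2 - \<i> * pi - 1) / 2\<^sup>2"
    by (intro tendsto_intros Lz) auto
  moreover have "g_fun (z n) = Ln (U n) - (2 * Ln (U n) - 1 / (U n)\<^sup>2 - \<i> * pi - 1) / (z n)\<^sup>2" for n
    unfolding U_def using varphi_half[OF imz] imz by (intro g_fun_closed_form) auto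
  ultimately have "(\<lambda>n. g_fun (z n)) \<longlonglongrightarrow> Ln 1 - (2 * Ln 1 - 1 / 1\<^sup>2 - \<i> * pi - 1) / 2\<^sup>2"
    by simp
  from tendsto_Re[OF this] have Lg: "(\<lambda>n. Re (g_fun (z n))) \<longlonglongrightarrow> 1 / 2"
    by (simp add: Re_divide_numeral)
  \<comment> \<open>The sign makes the sequence increase: the modulus of \<open>z n - s\<close>
    decreases with \<open>d n\<close>.\<close>
  define X where "X = (\<lambda>n s. - (ln (norm (z n - of_real s)) * psi s))"
  have X: "has_bochner_integral lborel (X n) (- Re (g_fun (z n)))" for n
  proof -
    have "has_bochner_integral lborel (\<lambda>s. Ln (z n - of_real s) * of_real (psi s)) (g_fun (z n))"
      using g_fun_eq_integral(1)[OF imz] by (simp add: has_bochner_integral_iff g_fun_def)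
    then have "has_bochner_integral lborel (\<lambda>s. Re (Ln (z n - of_real s) * of_real (psi s))) (Re (g_fun (z n)))"
      by (rule has_bochner_integral_Re)
    then have "has_bochner_integral lborel (\<lambda>s. - Re (Ln (z n - of_real s) * of_real (psi s))) (- Re (g_fun (z n)))"
      by (rule has_bochner_integral_minus)
    moreover have "z n - of_real s \<noteq> 0" for s using imz[of n] by (auto simp: complex_eq_iff)
    ultimately show ?thesis by (simp add: X_def)
  qed
  have nz: "norm (z n - of_real s) = sqrt ((2 - s)\<^sup>2 + (d n)\<^sup>2)" for n s
    by (simp add: z_def cmod_def)
  have ae: "AE s in lborel. s \<noteq> (2::real)"
    by (rule AE_lborel_singleton)
  have mono: "AE s in lborel. mono (\<lambda>n. X n s)"
  proof (rule AE_I2)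
    fix s :: real
    show "mono (\<lambda>n. X n s)"
    proof (rule monoI)
      fix m n :: nat assume "m \<le> n"
      then have "d n \<le> d m" by (simp add: d_def frac_le)
      then have "(d n)\<^sup>2 \<le> (d m)\<^sup>2" using d[of n] by (intro power_mono) auto
      moreover have "0 < (2 - s)\<^sup>2 + (d n)\<^sup>2" using d[of n] by (intro add_nonneg_pos) auto
      ultimately have "ln (norm (z n - of_real s)) \<le> ln (norm (z m - of_real s))"
        unfolding nz by (subst ln_le_cancel_iff) auto
      then show "X m s \<le> X n s" unfolding X_def using psi_nonneg[of s] by (simp add: mult_right_mono)
    qed
  qed
  have lim: "AE s in lborel. (\<lambda>n. X n s) \<longlonglongrightarrow> - (ln \<bar>2 - s\<bar> * psi s)"
    using ae
  proof eventually_elim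
    case (elim s)
    have "(\<lambda>n. - (ln (norm (z n - of_real s)) * psi s)) \<longlonglongrightarrow> - (ln (norm (2 - of_real s :: complex)) * psi s)"
      using elim by (intro tendsto_intros Lz) (auto simp: complex_eq_iff)
    moreover have "norm (2 - of_real s :: complex) = \<bar>2 - s\<bar>"
      by (metis norm_of_real of_real_diff of_real_numeral)
    ultimately show ?case by (simp add: X_def)
  qed
  have "integral\<^sup>L lborel (\<lambda>s. - (ln \<bar>2 - s\<bar> * psi s)) = - (1 / 2)"
  proof (rule integral_monotone_convergence[OF _ mono lim])
    show "integrable lborel (X n)" for n using X by (auto simp: has_bochner_integral_iff)
    have "(\<lambda>n. integral\<^sup>L lborel (X n)) = (\<lambda>n. - Re (g_fun (z n)))" using X by (auto simp: has_bochner_integral_iff)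
    then show "(\<lambda>n. integral\<^sup>L lborel (X n)) \<longlonglongrightarrow> - (1 / 2)" using tendsto_minus[OF Lg] by simp
  qed simp
  then show ?thesis by (simp add: l_const_def)
qed

text \<open>Doubling an argument in \<open>(0, pi)\<close> and subtracting \<open>pi\<close> gives
  an argument in \<open>(- pi, pi)\<close>, so no correction of the branch occurs.\<close>

lemma Ln_minus_square:
  fixes U :: complex
  assumes "Im U > 0"
  shows "Ln (- U\<^sup>2) = 2 * Ln U - \<i> * pi"
proof (rule Ln_unique)
  have U: "U \<noteq> 0" using assms by auto
  have "exp (2 * Ln U - \<i> * pi) = (exp (Ln U))\<^sup>2 / exp (\<i> * pi)"
    by (simp add: exp_diff exp_double)
  then show "exp (2 * Ln U - \<i> * pi) = - U\<^sup>2" using U by simp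
  have "0 < Im (Ln U)" "Im (Ln U) < pi" using assms U Im_Ln_pos_lt[of U] by auto
  then show "- pi < Im (2 * Ln U - \<i> * pi)" "Im (2 * Ln U - \<i> * pi) \<le> pi" by auto
qed

text \<open>By \<open>1 - z * U = - U\<^sup>2\<close> the logarithm in the exponent becomes
  \<open>2 * Ln U - \<i> * pi\<close>, the combination found in \<open>g_fun_closed_form\<close>.
  Thus \<open>phi_fun z\<close> is the critical value at the saddle \<open>U\<close> lowered by
  1/2.\<close>

lemma phi_fun_eq:
  assumes "Im z > 0" "U = varphi (z / 2)"
  shows "phi_fun z = U / z + Ln (1 - z * U) / z\<^sup>2 - Ln U - 1 / 2"
proof -
  note V = varphi_half[OF assms(1), folded assms(2)]
  have z: "z \<noteq> 0" using assms(1) by auto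
  have U2: "1 - z * U = - U\<^sup>2" using V(1,4) by (subst V(1)[symmetric]) (simp add: field_simps power2_eq_square)
  have "phi_fun z = 1 / 2 - (Ln U - (2 * Ln U - 1 / U\<^sup>2 - \<i> * pi - 1) / z\<^sup>2)"
    using g_fun_closed_form[OF V(2) V(1) assms(1)] by (simp add: phi_fun_def l_const_eq)
  also have "\<dots> = 1 / 2 - Ln U + (2 * Ln U - \<i> * pi) / z\<^sup>2 - (1 / U\<^sup>2 + 1) / z\<^sup>2"
    by (simp add: diff_divide_distrib add_divide_distrib)
  also have "1 / U\<^sup>2 + 1 = z / U"
    using V(1,4) by (subst V(1)[symmetric]) (simp add: field_simps power2_eq_square)
  also have "z / U / z\<^sup>2 = 1 - U / z"
  proof -
    have "1 / U = z - U" using V(1) by (simp add: algebra_simps)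
    then have "z / U / z\<^sup>2 = (z - U) / z" using z by (simp add: power2_eq_square divide_simps)
    then show ?thesis using z by (simp add: diff_divide_distrib)
  qed
  finally show ?thesis
    by (simp add: U2 Ln_minus_square[OF V(3)])
qed

section \<open>Local analysis at a saddle point\<close>

text \<open>
  Around a saddle \<open>V\<close>, that is \<open>V\<^sup>2 - z * V + 1 = 0\<close>, put \<open>u = V * exp (\<i> * s)\<close> and \<open>X = z * V\<close>. Then \<open>V / z = (X - 1) / X\<close> and
  \<open>1 / z\<^sup>2 = (X - 1) / X\<^sup>2\<close>, so that the exponent depends on \<open>X\<close> and \<open>s\<close> only and stays regular as \<open>X \<rightarrow> 0\<close>.
\<close>

definition saddle_phase :: "complex \<Rightarrow> complex \<Rightarrow> complex" where
  "saddle_phase X s = (X - 1) * ((exp (\<i> * s) - 1) / X + (Ln (1 - X * exp (\<i> * s)) - Ln (1 - X)) / X\<^sup>2) - \<i> * s"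

definition saddle_amp :: "real \<Rightarrow> complex \<Rightarrow> complex \<Rightarrow> complex" where
  "saddle_amp a X s = exp (- of_real a * (Ln (1 - X * exp (\<i> * s)) - Ln (1 - X)))"

definition geom :: "complex \<Rightarrow> complex \<Rightarrow> complex" where
  "geom X s = 1 / (1 - X * exp (\<i> * s))"

text \<open>Derivatives in \<open>s\<close> of orders 0 to 4, indexed by \<open>k\<close> in the
  form required by \<open>complex_Taylor\<close>; the last branch is the fourth. From the first
  derivative on there is no division by \<open>X\<close>, so the bounds are uniform as
  \<open>X\<close> tends to 0.\<close>

definition saddle_phase_deriv :: "complex \<Rightarrow> nat \<Rightarrow> complex \<Rightarrow> complex" where
  "saddle_phase_deriv X k s = (let y = geom X s; e = exp (2 * \<i> * s) in
     if k = 0 then saddle_phase X s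
     else if k = 1 then - \<i> - \<i> * (X - 1) * e * y
     else if k = 2 then (X - 1) * e * (y + y\<^sup>2)
     else if k = 3 then \<i> * (X - 1) * e * (y + y\<^sup>2 + 2 * y ^ 3)
     else - (X - 1) * e * (y + y\<^sup>2 + 6 * y ^ 4))"

definition saddle_amp_deriv :: "real \<Rightarrow> complex \<Rightarrow> nat \<Rightarrow> complex \<Rightarrow> complex" where
  "saddle_amp_deriv a X k s = (let y = geom X s; r = saddle_amp a X s in
     if k = 0 then r
     else if k = 1 then \<i> * a * (y - 1) * r
     else - (a * (y - 1) * (y + a * (y - 1)) * r))"

text \<open>For \<open>norm s \<le> 2\<close> the exponential is at most \<open>exp 2 < 8\<close>.
  The radius 1/16 for \<open>X\<close> therefore keeps \<open>X * exp (\<i> * s)\<close> below 1/2,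
  away from the singularity of the logarithm.\<close>

lemma geom_domain:
  assumes "norm X \<le> 1 / 16" "norm s \<le> 2"
  shows "norm (X * exp (\<i> * s)) < 1 / 2" "norm (exp (\<i> * s)) \<le> 8" "1 - X * exp (\<i> * s) \<notin> \<real>\<^sub>\<le>\<^sub>0"
    "1 - X * exp (\<i> * s) \<noteq> 0" "norm (geom X s) \<le> 2"
proof -
  have "exp 1 \<le> (2.8 :: real)"
    using e_less_272 by simp
  then have "(exp 1) ^ 2 \<le> (2.8 :: real) ^ 2" by (intro power_mono) auto
  then have e2: "exp 2 < (8 :: real)" by (simp add: exp_of_nat_mult[symmetric] power2_eq_square exp_add[symmetric])
  have "\<bar>Im s\<bar> \<le> 2" using assms(2) abs_Im_le_cmod[of s] by linarith
  then have "exp (- Im s) \<le> exp 2" by simp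
  moreover have "norm (exp (\<i> * s)) = exp (- Im s)" by simp
  ultimately have 1: "norm (exp (\<i> * s)) < 8" using e2 by linarith
  then show "norm (exp (\<i> * s)) \<le> 8" by simp
  have "norm X * norm (exp (\<i> * s)) \<le> 1 / 16 * norm (exp (\<i> * s))"
    using assms by (intro mult_right_mono) auto
  also have "\<dots> < 1 / 16 * 8" using 1 by simp
  finally show 2: "norm (X * exp (\<i> * s)) < 1 / 2" by (simp add: norm_mult)
  then show "1 - X * exp (\<i> * s) \<notin> \<real>\<^sub>\<le>\<^sub>0" by (intro one_minus_notin_nonpos_Reals) linarith
  then show "1 - X * exp (\<i> * s) \<noteq> 0" by auto
  have "1 / 2 \<le> norm (1 - X * exp (\<i> * s))"
    using norm_triangle_ineq2[of 1 "X * exp (\<i> * s)"] 2 by simp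
  then show "norm (geom X s) \<le> 2" by (simp add: geom_def norm_divide divide_simps)
qed

lemma geom_has_derivative:
  assumes "norm X \<le> 1 / 16" "norm s \<le> 2"
  shows "(geom X has_field_derivative \<i> * ((geom X s)\<^sup>2 - geom X s)) (at s)"
proof -
  note d = geom_domain[OF assms]
  have "(geom X has_field_derivative (X * (\<i> * exp (\<i> * s))) / (1 - X * exp (\<i> * s))\<^sup>2) (at s)"
    unfolding geom_def using d(4)
    by (auto intro!: derivative_eq_intros simp: power2_eq_square)
  also have "(X * (\<i> * exp (\<i> * s))) / (1 - X * exp (\<i> * s))\<^sup>2 = \<i> * ((geom X s)\<^sup>2 - geom X s)"
  proof -
    have "v = 1 - w \<Longrightarrow> w \<noteq> 0 \<Longrightarrow> (\<i> * v) / w\<^sup>2 = \<i> * ((1 / w)\<^sup>2 - 1 / w)" for v w :: complex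
      by (erule ssubst) (simp add: field_simps power2_eq_square)
    from this[OF _ d(4), of "X * exp (\<i> * s)"] show ?thesis by (simp add: geom_def mult_ac)
  qed
  finally show ?thesis .
qed

lemma Ln_geom_has_derivative:
  assumes "norm X \<le> 1 / 16" "norm s \<le> 2"
  shows "((\<lambda>s. Ln (1 - X * exp (\<i> * s))) has_field_derivative - \<i> * (geom X s - 1)) (at s)"
proof -
  note d = geom_domain[OF assms]
  have "((\<lambda>s. Ln (1 - X * exp (\<i> * s))) has_field_derivative - (X * (\<i> * exp (\<i> * s))) / (1 - X * exp (\<i> * s))) (at s)"
    using d(3,4) by (auto intro!: derivative_eq_intros simp: field_simps)
  also have "- (X * (\<i> * exp (\<i> * s))) / (1 - X * exp (\<i> * s)) = - \<i> * (geom X s - 1)"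
  proof -
    have "v = 1 - w \<Longrightarrow> w \<noteq> 0 \<Longrightarrow> - (\<i> * v) / w = - \<i> * (1 / w - 1)" for v w :: complex
      by (erule ssubst) (simp add: field_simps)
    from this[OF _ d(4), of "X * exp (\<i> * s)"] show ?thesis by (simp add: geom_def mult_ac)
  qed
  finally show ?thesis .
qed

lemma saddle_phase_deriv_has_derivative:
  assumes "norm X \<le> 1 / 16" "norm s \<le> 2" "X \<noteq> 0" "k \<le> 3"
  shows "(saddle_phase_deriv X k has_field_derivative saddle_phase_deriv X (Suc k) s) (at s)"
proof -
  note g = geom_has_derivative[OF assms(1,2)]
  note L = Ln_geom_has_derivative[OF assms(1,2)]
  define y where "y = geom X s"
  have y: "y * (1 - X * exp (\<i> * s)) = 1"
    using geom_domain(4)[OF assms(1,2)] by (simp add: y_def geom_def)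
  have e2: "exp (2 * \<i> * s) = exp (\<i> * s) * exp (\<i> * s)" by (simp add: exp_add[symmetric] algebra_simps)
  consider "k = 0" | "k = 1" | "k = 2" | "k = 3" using assms(4) by linarith
  then show ?thesis
  proof cases
    case 1
    have f: "saddle_phase_deriv X 0 = saddle_phase X" by (simp add: saddle_phase_deriv_def Let_def fun_eq_iff)
    define l where "l = (\<lambda>s. Ln (1 - X * exp (\<i> * s)))"
    have l: "(l has_field_derivative - \<i> * (y - 1)) (at s)" using L by (simp add: l_def y_def)
    have "((\<lambda>s. (X - 1) * ((exp (\<i> * s) - 1) / X + (l s - Ln (1 - X)) / X\<^sup>2) - \<i> * s) has_field_derivative
        (X - 1) * (\<i> * exp (\<i> * s) / X + (- \<i> * (y - 1)) / X\<^sup>2) - \<i>) (at s)"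
      using assms(3) by (auto intro!: derivative_eq_intros l simp: field_simps)
    then have "(saddle_phase X has_field_derivative (X - 1) * (\<i> * exp (\<i> * s) / X + (- \<i> * (y - 1)) / X\<^sup>2) - \<i>) (at s)"
      unfolding saddle_phase_def l_def .
    also have "(X - 1) * (\<i> * exp (\<i> * s) / X + (- \<i> * (y - 1)) / X\<^sup>2) - \<i> = - \<i> - \<i> * (X - 1) * exp (2 * \<i> * s) * y"
    proof -
      \<comment> \<open>This identity for the geometric factor supplies the power of
        \<open>X\<close> that cancels the denominators.\<close>
      have y1: "y - 1 = X * E * y" if "y * (1 - X * E) = 1" for E using that by (simp add: algebra_simps)
      have "\<i> * E / X + (- \<i> * (y - 1)) / X\<^sup>2 = - \<i> * (E * E) * y" if "y * (1 - X * E) = 1" for E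
      proof -
        have "\<i> * E / X + (- \<i> * (y - 1)) / X\<^sup>2 = \<i> * E / X * (y * (1 - X * E)) - \<i> * E * y / X"
          unfolding y1[OF that] unfolding that using assms(3) by (simp add: power2_eq_square)
        also have "\<dots> = - \<i> * (E * E) * y" using assms(3) by (simp add: field_simps)
        finally show ?thesis .
      qed
      from this[OF y] show ?thesis unfolding e2 by simp
    qed
    finally show ?thesis using 1 f by (simp add: saddle_phase_deriv_def Let_def y_def)
  next
    case 2
    have "saddle_phase_deriv X 1 = (\<lambda>s. - \<i> - \<i> * (X - 1) * exp (2 * \<i> * s) * geom X s)"
      by (simp add: saddle_phase_deriv_def Let_def fun_eq_iff)
    moreover have "((\<lambda>s. - \<i> - \<i> * (X - 1) * exp (2 * \<i> * s) * geom X s) has_field_derivative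
        (X - 1) * exp (2 * \<i> * s) * (y + y\<^sup>2)) (at s)"
      unfolding y_def by (rule derivative_eq_intros g refl | simp add: algebra_simps power2_eq_square)+
    ultimately show ?thesis using 2 by (simp add: saddle_phase_deriv_def Let_def y_def eval_nat_numeral)
  next
    case 3
    have "saddle_phase_deriv X 2 = (\<lambda>s. (X - 1) * exp (2 * \<i> * s) * (geom X s + (geom X s)\<^sup>2))"
      by (simp add: saddle_phase_deriv_def Let_def fun_eq_iff)
    moreover have "((\<lambda>s. (X - 1) * exp (2 * \<i> * s) * (geom X s + (geom X s)\<^sup>2)) has_field_derivative
        \<i> * (X - 1) * exp (2 * \<i> * s) * (y + y\<^sup>2 + 2 * y ^ 3)) (at s)"
      unfolding y_def by (rule derivative_eq_intros g refl | simp add: algebra_simps power2_eq_square power3_eq_cube)+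
    ultimately show ?thesis using 3 by (simp add: saddle_phase_deriv_def Let_def y_def)
  next
    case 4
    have "saddle_phase_deriv X 3 = (\<lambda>s. \<i> * (X - 1) * exp (2 * \<i> * s) * (geom X s + (geom X s)\<^sup>2 + 2 * geom X s ^ 3))"
      by (simp add: saddle_phase_deriv_def Let_def fun_eq_iff)
    moreover have "((\<lambda>s. \<i> * (X - 1) * exp (2 * \<i> * s) * (geom X s + (geom X s)\<^sup>2 + 2 * geom X s ^ 3)) has_field_derivative
        - (X - 1) * exp (2 * \<i> * s) * (y + y\<^sup>2 + 6 * y ^ 4)) (at s)"
      unfolding y_def by (rule derivative_eq_intros g refl | simp add: algebra_simps eval_nat_numeral)+
    ultimately show ?thesis using 4 by (simp add: saddle_phase_deriv_def Let_def y_def)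
  qed
qed

lemma saddle_amp_deriv_has_derivative:
  assumes "norm X \<le> 1 / 16" "norm s \<le> 2" "k \<le> 1"
  shows "(saddle_amp_deriv a X k has_field_derivative saddle_amp_deriv a X (Suc k) s) (at s)"
proof -
  note g = geom_has_derivative[OF assms(1,2)]
  note L = Ln_geom_has_derivative[OF assms(1,2)]
  have r: "(saddle_amp a X has_field_derivative \<i> * a * (geom X s - 1) * saddle_amp a X s) (at s)"
  proof -
    define l where "l = (\<lambda>s. Ln (1 - X * exp (\<i> * s)))"
    have l: "(l has_field_derivative - \<i> * (geom X s - 1)) (at s)" using L by (simp add: l_def)
    have "((\<lambda>s. exp (- of_real a * (l s - Ln (1 - X)))) has_field_derivative
        \<i> * a * (geom X s - 1) * exp (- of_real a * (l s - Ln (1 - X)))) (at s)"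
      by (auto intro!: derivative_eq_intros l simp: algebra_simps)
    then show ?thesis unfolding saddle_amp_def l_def .
  qed
  consider "k = 0" | "k = 1" using assms(3) by linarith
  then show ?thesis
  proof cases
    case 1
    have "saddle_amp_deriv a X 0 = saddle_amp a X" by (simp add: saddle_amp_deriv_def Let_def fun_eq_iff)
    then show ?thesis using r 1 by (simp add: saddle_amp_deriv_def Let_def)
  next
    case 2
    have "saddle_amp_deriv a X 1 = (\<lambda>s. \<i> * a * (geom X s - 1) * saddle_amp a X s)"
      by (simp add: saddle_amp_deriv_def Let_def fun_eq_iff)
    moreover have "((\<lambda>s. \<i> * a * (geom X s - 1) * saddle_amp a X s) has_field_derivative
        - (a * (geom X s - 1) * (geom X s + a * (geom X s - 1)) * saddle_amp a X s)) (at s)"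
      by (rule derivative_eq_intros g r refl | simp add: algebra_simps power2_eq_square)+
    ultimately show ?thesis using 2 by (simp add: saddle_amp_deriv_def Let_def)
  qed
qed

text \<open>The orders 0 and 1 vanish because the phase is normalised to 0 at a critical point; the
  second derivative there is \<open>- (2 - X) / (1 - X)\<close>.\<close>

lemma saddle_phase_Taylor:
  assumes "norm X \<le> 1 / 16" "norm s \<le> 2" "X \<noteq> 0"
  shows "norm (saddle_phase X s + (2 - X) / (1 - X) * s\<^sup>2 / 2 - saddle_phase_deriv X 3 0 * s ^ 3 / 6) \<le> 16384 * norm s ^ 4"
    and "norm (saddle_phase_deriv X 3 0) \<le> 64 * 2 * 22"
proof -
  have X1: "norm (X - 1) \<le> 2" "1 - X \<noteq> 0"
    using assms(1) norm_triangle_ineq4[of X 1] by auto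
  have y0: "geom X 0 = 1 / (1 - X)" by (simp add: geom_def)
  have "cmod (saddle_phase_deriv X 0 s - (\<Sum>i\<le>3. saddle_phase_deriv X i 0 * (s - 0) ^ i / fact i))
      \<le> 98304 * cmod (s - 0) ^ Suc 3 / fact 3"
  proof (rule complex_Taylor[where S = "cball 0 2"])
    show "(saddle_phase_deriv X i has_field_derivative saddle_phase_deriv X (Suc i) x) (at x within cball 0 2)"
      if "x \<in> cball 0 2" "i \<le> 3" for x i
      using saddle_phase_deriv_has_derivative[OF assms(1) _ assms(3)] that
      by (auto intro: has_field_derivative_at_within)
    \<comment> \<open>The value 98304 is \<open>6 * 16384\<close>, so that division by
      \<open>fact 3\<close> gives the stated constant. The product of the bounds for the three
      factors, \<open>2 * 8 ^ 2 * 102\<close>, is well below it.\<close>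
    show "norm (saddle_phase_deriv X (Suc 3) x) \<le> 98304" if "x \<in> cball 0 2" for x
    proof -
      have x: "norm x \<le> 2" using that by simp
      note d = geom_domain[OF assms(1) x]
      define y where "y = geom X x"
      have y: "norm y ^ k \<le> 2 ^ k" for k using d(5) by (intro power_mono) (auto simp: y_def)
      have "norm (y + y\<^sup>2 + 6 * y ^ 4) \<le> norm y + norm y ^ 2 + 6 * norm y ^ 4"
        by (intro norm_triangle_le add_mono) (auto simp: norm_mult norm_power)
      also have "\<dots> \<le> 2 + 4 + 6 * 16"
        using y[of 1] y[of 2] y[of 4] by (intro add_mono mult_left_mono) auto
      finally have 1: "norm (y + y\<^sup>2 + 6 * y ^ 4) \<le> 102" by simp
      have e: "exp (2 * \<i> * x) = (exp (\<i> * x))\<^sup>2" by (simp add: power2_eq_square exp_add[symmetric] algebra_simps)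
      have 2: "norm (exp (2 * \<i> * x)) \<le> 8 ^ 2" unfolding e norm_power using d(2) by (intro power_mono) auto
      have "norm (saddle_phase_deriv X (Suc 3) x) = norm (X - 1) * norm (exp (2 * \<i> * x)) * norm (y + y\<^sup>2 + 6 * y ^ 4)"
        by (simp add: saddle_phase_deriv_def Let_def y_def norm_mult norm_minus_commute)
      also have "\<dots> \<le> 2 * 8 ^ 2 * 102"
        using X1 1 2 by (intro mult_mono) auto
      finally show ?thesis by simp
    qed
  qed (use assms in auto)
  also have "(\<Sum>i\<le>3. saddle_phase_deriv X i 0 * (s - 0) ^ i / fact i) =
      - ((2 - X) / (1 - X) * s\<^sup>2 / 2) + saddle_phase_deriv X 3 0 * s ^ 3 / 6"
  proof -
    have "saddle_phase_deriv X 0 0 = 0" by (simp add: saddle_phase_deriv_def Let_def saddle_phase_def)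
    moreover have "saddle_phase_deriv X 1 0 = 0"
      using X1 by (simp add: saddle_phase_deriv_def Let_def y0 field_simps)
    moreover have "saddle_phase_deriv X 2 0 = - ((2 - X) / (1 - X))"
    proof -
      have "(X - 1) * (1 / (1 - X) + (1 / (1 - X))\<^sup>2) = - ((2 - X) / (1 - X))"
        using X1 by (simp add: power2_eq_square divide_simps) (simp add: algebra_simps)
      then show ?thesis by (simp add: saddle_phase_deriv_def Let_def y0)
    qed
    ultimately show ?thesis by (simp add: eval_nat_numeral)
  qed
  finally show "norm (saddle_phase X s + (2 - X) / (1 - X) * s\<^sup>2 / 2 - saddle_phase_deriv X 3 0 * s ^ 3 / 6) \<le> 16384 * norm s ^ 4"
    by (simp add: saddle_phase_deriv_def Let_def algebra_simps eval_nat_numeral)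
  have "norm (geom X 0) \<le> 2" using geom_domain(5)[OF assms(1), of 0] by simp
  then have y: "norm (geom X 0) ^ k \<le> 2 ^ k" for k by (intro power_mono) auto
  have "norm (geom X 0 + (geom X 0)\<^sup>2 + 2 * geom X 0 ^ 3) \<le> norm (geom X 0) + norm (geom X 0) ^ 2 + 2 * norm (geom X 0) ^ 3"
    by (intro norm_triangle_le add_mono) (auto simp: norm_mult norm_power)
  also have "\<dots> \<le> 2 + 4 + 2 * 8"
    using y[of 1] y[of 2] y[of 3] by (intro add_mono mult_left_mono) auto
  finally have 1: "norm (geom X 0 + (geom X 0)\<^sup>2 + 2 * geom X 0 ^ 3) \<le> 22" by simp
  have "norm (saddle_phase_deriv X 3 0) = norm (X - 1) * norm (geom X 0 + (geom X 0)\<^sup>2 + 2 * geom X 0 ^ 3)"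
    by (simp add: saddle_phase_deriv_def Let_def norm_mult)
  also have "\<dots> \<le> 2 * 22" using X1 1 by (intro mult_mono) auto
  finally show "norm (saddle_phase_deriv X 3 0) \<le> 64 * 2 * 22" by simp
qed

lemma saddle_amp_Taylor:
  fixes a :: real
  assumes "norm X \<le> 1 / 16" "norm s \<le> 2"
  shows "norm (saddle_amp a X s - 1 - saddle_amp_deriv a X 1 0 * s) \<le> \<bar>a\<bar> * 3 * (2 + \<bar>a\<bar> * 3) * exp (\<bar>a\<bar> * 2) * norm s ^ 2"
    and "norm (saddle_amp_deriv a X 1 0) \<le> \<bar>a\<bar> * 3"
proof -
  \<comment> \<open>A bound for the second derivative: 3 for \<open>geom - 1\<close>, then the
    bracket, then the amplitude, whose exponent is at most \<open>2 * \<bar>a\<bar>\<close> since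
    each logarithm is at most 1.\<close>
  define B where "B = \<bar>a\<bar> * 3 * (2 + \<bar>a\<bar> * 3) * exp (\<bar>a\<bar> * 2)"
  have y1: "norm (geom X x - 1) \<le> 3" if "norm x \<le> 2" for x
    using geom_domain(5)[OF assms(1) that] norm_triangle_ineq4[of "geom X x" 1] by simp
  have "cmod (saddle_amp_deriv a X 0 s - (\<Sum>i\<le>1. saddle_amp_deriv a X i 0 * (s - 0) ^ i / fact i))
      \<le> B * cmod (s - 0) ^ Suc 1 / fact 1"
  proof (rule complex_Taylor[where S = "cball 0 2"])
    show "(saddle_amp_deriv a X i has_field_derivative saddle_amp_deriv a X (Suc i) x) (at x within cball 0 2)"
      if "x \<in> cball 0 2" "i \<le> 1" for x i
      using saddle_amp_deriv_has_derivative[OF assms(1)] that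
      by (auto intro: has_field_derivative_at_within)
    show "norm (saddle_amp_deriv a X (Suc 1) x) \<le> B" if "x \<in> cball 0 2" for x
    proof -
      have x: "norm x \<le> 2" using that by simp
      note d = geom_domain[OF assms(1) x]
      have Ln: "norm (Ln (1 - w)) \<le> 1" if "norm w < 1 / 2" for w :: complex
        using norm_Ln_le[of "- w"] that by simp
      have "norm (Ln (1 - X * exp (\<i> * x)) - Ln (1 - X)) \<le> norm (Ln (1 - X * exp (\<i> * x))) + norm (Ln (1 - X))"
        by (rule norm_triangle_ineq4)
      also have "\<dots> \<le> 1 + 1" using d(1) assms(1) by (intro add_mono Ln) auto
      finally have "norm (Ln (1 - X * exp (\<i> * x)) - Ln (1 - X)) \<le> 2" by simp
      then have "norm (- of_real a * (Ln (1 - X * exp (\<i> * x)) - Ln (1 - X))) \<le> \<bar>a\<bar> * 2"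
        unfolding norm_mult by (intro mult_mono) auto
      then have r: "norm (saddle_amp a X x) \<le> exp (\<bar>a\<bar> * 2)"
        unfolding saddle_amp_def norm_exp_eq_Re
        by (simp only: exp_le_cancel_iff) (rule order.trans[OF complex_Re_le_cmod])
      have "norm (geom X x + a * (geom X x - 1)) \<le> 2 + \<bar>a\<bar> * 3"
        using d(5) y1[OF x] by (intro norm_triangle_le add_mono) (auto simp: norm_mult intro: mult_left_mono)
      then have "\<bar>a\<bar> * norm (geom X x - 1) * norm (geom X x + a * (geom X x - 1)) * norm (saddle_amp a X x) \<le> B"
        unfolding B_def using y1[OF x] r by (intro mult_mono mult_nonneg_nonneg) auto
      then show ?thesis by (simp add: saddle_amp_deriv_def Let_def norm_mult)
    qed
  qed (use assms in auto)
  moreover have "saddle_amp_deriv a X 0 0 = 1"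
    by (simp add: saddle_amp_deriv_def saddle_amp_def)
  ultimately show "norm (saddle_amp a X s - 1 - saddle_amp_deriv a X 1 0 * s) \<le> B * norm s ^ 2"
    by (simp add: saddle_amp_deriv_def[of a X 0 s] eval_nat_numeral algebra_simps)
  show "norm (saddle_amp_deriv a X 1 0) \<le> \<bar>a\<bar> * 3"
    using y1[of 0] by (auto simp: saddle_amp_deriv_def saddle_amp_def norm_mult intro: mult_left_mono)
qed

text \<open>The range 8/5 slightly exceeds \<open>pi / 2\<close>, the half length of the segments.
  There the cubic remainder is at most \<open>\<bar>t\<bar> / 2\<close>, because a sixth of
  \<open>(8 / 5)\<^sup>2\<close> is below 1/2.\<close>

lemma sin_squared_ge:
  fixes t :: real
  assumes "\<bar>t\<bar> \<le> 8 / 5"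
  shows "t\<^sup>2 / 4 \<le> (sin t)\<^sup>2"
proof -
  have "\<bar>sin t - (\<Sum>m<3. sin_coeff m * t ^ m)\<bar> \<le> inverse (fact 3) * \<bar>t\<bar> ^ 3"
    by (rule Maclaurin_sin_bound)
  then have "\<bar>sin t - t\<bar> \<le> \<bar>t\<bar> ^ 3 / 6"
    by (simp add: eval_nat_numeral sin_coeff_def)
  also have "\<bar>t\<bar> ^ 3 / 6 = \<bar>t\<bar> * (\<bar>t\<bar> * \<bar>t\<bar> / 6)" by (simp add: power3_eq_cube)
  also have "\<dots> \<le> \<bar>t\<bar> * (1 / 2)"
  proof (rule mult_left_mono)
    have "\<bar>t\<bar> * \<bar>t\<bar> \<le> 8 / 5 * (8 / 5)" using assms by (intro mult_mono) auto
    then show "\<bar>t\<bar> * \<bar>t\<bar> / 6 \<le> 1 / 2" by simp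
  qed simp
  finally have "\<bar>t / 2\<bar> \<le> \<bar>sin t\<bar>" by linarith
  then have "(t / 2)\<^sup>2 \<le> (sin t)\<^sup>2" by (simp only: abs_le_square_iff)
  then show ?thesis by (simp add: power_divide)
qed

text \<open>
  The second derivative in \<open>t\<close> is uniformly close to its value \<open>- 2 * exp (2 * \<i> * t)\<close> at \<open>X = 0\<close>, \<open>l = 1\<close>, where the phase is
  \<open>(exp (2 * \<i> * t) - 1) / 2 - \<i> * t\<close> with real part \<open>- (sin t)\<^sup>2\<close>.
\<close>

lemma saddle_phase_Re:
  "\<exists>\<eta>>0. \<forall>X l t. X \<noteq> 0 \<and> norm X < \<eta> \<and> norm (l - 1) < \<eta> \<and> \<bar>t\<bar> \<le> 8 / 5 \<longrightarrow>
     Re (saddle_phase X (l * of_real t)) \<le> - (1 / 8) * t\<^sup>2"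
proof -
  \<comment> \<open>The value \<open>X = 0\<close> is included, since \<open>\<Phi>\<close> is free
    of division by \<open>X\<close>. Compactness then gives closeness to the case
    \<open>X = 0\<close>, \<open>l = 1\<close> uniformly in \<open>t\<close>.\<close>
  define K where "K = cball (0::complex) (1/16) \<times> cball (1::complex) (1/4) \<times> cball (0::complex) (8/5)"
  define \<Phi> where "\<Phi> = (\<lambda>(X::complex, l::complex, t::complex). l\<^sup>2 * ((X - 1) * exp (2 * \<i> * (l * t)) * (geom X (l * t) + (geom X (l * t))\<^sup>2)))"
  have lt: "norm (l * t) \<le> 2" if "norm (l - 1) \<le> 1 / 4" "norm t \<le> 8 / 5" for l t :: complex
  proof -
    have "norm l \<le> 5 / 4" using norm_triangle_ineq[of "l - 1" 1] that by simp
    then have "norm l * norm t \<le> 5 / 4 * (8 / 5)" using that by (intro mult_mono) auto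
    then show ?thesis by (simp add: norm_mult)
  qed
  have "compact K" unfolding K_def by (intro compact_Times compact_cball)
  moreover have "continuous_on K \<Phi>"
    unfolding \<Phi>_def geom_def case_prod_beta
    by (intro continuous_intros) (use geom_domain(4) lt in \<open>auto simp: K_def dist_norm norm_minus_commute\<close>)
  ultimately have "uniformly_continuous_on K \<Phi>" by (rule compact_uniformly_continuous[rotated])
  then obtain d where d: "d > 0" "\<And>x y. x \<in> K \<Longrightarrow> y \<in> K \<Longrightarrow> dist y x < d \<Longrightarrow> dist (\<Phi> y) (\<Phi> x) < 1 / 8"
    unfolding uniformly_continuous_on_def by (metis zero_less_divide_1_iff zero_less_numeral)
  define \<eta> where "\<eta> = min (1 / 16) (d / 2)"
  show ?thesis
  proof (intro exI[of _ \<eta>] conjI allI impI)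
    show "\<eta> > 0" using d(1) by (simp add: \<eta>_def)
    fix X l :: complex and t :: real
    assume A: "X \<noteq> 0 \<and> norm X < \<eta> \<and> norm (l - 1) < \<eta> \<and> \<bar>t\<bar> \<le> 8 / 5"
    then have X: "X \<noteq> 0" "norm X \<le> 1 / 16" "norm (l - 1) \<le> 1 / 4" "norm X < d / 2" "norm (l - 1) < d / 2"
      by (auto simp: \<eta>_def)
    \<comment> \<open>The difference from the limiting phase together with its first two
      derivatives. It vanishes to second order at 0, so the bound 1/8 on the second derivative costs
      only half of the \<open>t\<^sup>2 / 4\<close> gained from the sine.\<close>
    define D where "D = (\<lambda>(k::nat) s. if k = 0 then saddle_phase X (l * s) - ((exp (2 * \<i> * s) - 1) / 2 - \<i> * s)
       else if k = 1 then l * saddle_phase_deriv X 1 (l * s) - (\<i> * exp (2 * \<i> * s) - \<i>)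
       else l\<^sup>2 * saddle_phase_deriv X 2 (l * s) + 2 * exp (2 * \<i> * s))"
    have "cmod (D 0 (of_real t) - (\<Sum>i\<le>1. D i 0 * (of_real t - 0) ^ i / fact i)) \<le> 1 / 8 * cmod (of_real t - 0) ^ Suc 1 / fact 1"
    proof (rule complex_Taylor[where S = "cball 0 (8/5)"])
      show "(D i has_field_derivative D (Suc i) x) (at x within cball 0 (8/5))" if "x \<in> cball 0 (8/5)" "i \<le> 1" for i x
      proof (rule has_field_derivative_at_within)
        have "norm (l * x) \<le> 2" using that X by (intro lt) auto
        note sd = saddle_phase_deriv_has_derivative[OF X(2) this X(1)]
        have ch: "((\<lambda>s. saddle_phase_deriv X k (l * s)) has_field_derivative saddle_phase_deriv X (Suc k) (l * x) * l) (at x)" if "k \<le> 3" for k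
          by (rule DERIV_chain2[where g = "(*) l", OF sd[OF that]]) (auto intro!: derivative_eq_intros)
        have 0: "saddle_phase_deriv X 0 = saddle_phase X" by (simp add: saddle_phase_deriv_def fun_eq_iff)
        show "(D i has_field_derivative D (Suc i) x) (at x)"
        proof (cases "i = 0")
          case True
          have "D 0 = (\<lambda>s. saddle_phase_deriv X 0 (l * s) - ((exp (2 * \<i> * s) - 1) / 2 - \<i> * s))"
            by (simp add: D_def 0 fun_eq_iff)
          moreover have "((\<lambda>s. saddle_phase_deriv X 0 (l * s) - ((exp (2 * \<i> * s) - 1) / 2 - \<i> * s)) has_field_derivative
             saddle_phase_deriv X (Suc 0) (l * x) * l - ((\<i> * 2 * exp (2 * \<i> * x)) / 2 - \<i>)) (at x)"
            by (intro DERIV_diff ch) (auto intro!: derivative_eq_intros)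
          ultimately show ?thesis using True by (simp add: D_def mult_ac)
        next
          case False
          then have i: "i = 1" using that by simp
          have "D 1 = (\<lambda>s. l * saddle_phase_deriv X 1 (l * s) - (\<i> * exp (2 * \<i> * s) - \<i>))"
            by (simp add: D_def fun_eq_iff)
          moreover have "((\<lambda>s. l * saddle_phase_deriv X 1 (l * s) - (\<i> * exp (2 * \<i> * s) - \<i>)) has_field_derivative
             l * (saddle_phase_deriv X (Suc 1) (l * x) * l) - (\<i> * (2 * \<i> * exp (2 * \<i> * x)))) (at x)"
            by (intro DERIV_diff DERIV_cmult ch) (auto intro!: derivative_eq_intros)
          ultimately show ?thesis using i by (simp add: D_def mult_ac power2_eq_square numeral_2_eq_2)
        qed
      qed
      show "norm (D (Suc 1) x) \<le> 1 / 8" if "x \<in> cball 0 (8/5)" for x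
      proof -
        have "(X, l, x) \<in> K" "(0, 1, x) \<in> K" using that X by (auto simp: K_def dist_norm norm_minus_commute)
        moreover have "dist (X, l, x) (0, 1, x) < d"
        proof -
          have "dist (X, l, x) (0, 1, x) \<le> dist X 0 + dist (l, x) (1, x)"
            unfolding dist_Pair_Pair by (intro sqrt_sum_squares_le_sum) auto
          also have "\<dots> = norm X + norm (l - 1)" by (simp add: dist_Pair_Pair dist_norm)
          also have "\<dots> < d" using X by simp
          finally show ?thesis .
        qed
        ultimately have "dist (\<Phi> (X, l, x)) (\<Phi> (0, 1, x)) < 1 / 8" using d(2) by blast
        moreover have "\<Phi> (0, 1, x) = - 2 * exp (2 * \<i> * x)" by (simp add: \<Phi>_def geom_def)
        moreover have "\<Phi> (X, l, x) = l\<^sup>2 * saddle_phase_deriv X 2 (l * x)"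
          by (simp add: \<Phi>_def saddle_phase_deriv_def Let_def)
        ultimately show ?thesis by (simp add: D_def dist_norm)
      qed
    qed (use A in auto)
    moreover have "D 0 0 = 0" by (simp add: D_def saddle_phase_def)
    moreover have "D 1 0 = 0"
    proof -
      have "1 - X \<noteq> 0" using X(2) by auto
      then show ?thesis by (simp add: D_def saddle_phase_deriv_def Let_def geom_def field_simps)
    qed
    ultimately have "norm (D 0 (of_real t)) \<le> 1 / 8 * t\<^sup>2" by (simp add: power2_eq_square)
    then have "Re (D 0 (of_real t)) \<le> 1 / 8 * t\<^sup>2" using complex_Re_le_cmod order.trans by blast
    moreover have "Re ((exp (2 * \<i> * of_real t) - 1) / 2 - \<i> * of_real t) = - (sin t)\<^sup>2"
    proof -
      have "exp (2 * \<i> * of_real t) = cis (2 * t)" by (simp add: cis_conv_exp mult_ac)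
      then have "Re ((exp (2 * \<i> * of_real t) - 1) / 2 - \<i> * of_real t) = (cos (2 * t) - 1) / 2" by simp
      then show ?thesis by (simp add: cos_double_sin)
    qed
    moreover have "t\<^sup>2 / 4 \<le> (sin t)\<^sup>2" using A by (intro sin_squared_ge) auto
    moreover have "Re (D 0 (of_real t)) = Re (saddle_phase X (l * of_real t)) - Re ((exp (2 * \<i> * of_real t) - 1) / 2 - \<i> * of_real t)"
      unfolding D_def by (simp only: refl if_True minus_complex.sel)
    ultimately show "Re (saddle_phase X (l * of_real t)) \<le> - (1 / 8) * t\<^sup>2"
      by linarith
  qed
qed

text \<open>
  The condition \<open>l\<^sup>2 * ((2 - X) / (1 - X)) = 2\<close> below selects the direction of steepest descent: it makes the quadratic term
  of the phase exactly \<open>- t\<^sup>2\<close>.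
\<close>

definition saddle_int :: "real \<Rightarrow> nat \<Rightarrow> complex \<Rightarrow> complex \<Rightarrow> complex" where
  "saddle_int a n X l = integral {-(pi/2)..pi/2}
     (\<lambda>t. exp (of_nat n * saddle_phase X (l * of_real t)) * saddle_amp a X (l * of_real t))"

lemma saddle_integral:
  fixes a :: real
  shows "\<exists>\<eta>>0. \<exists>C\<ge>0. \<forall>(n::nat)>0. \<forall>X l. X \<noteq> 0 \<and> norm X < \<eta> \<and> norm (l - 1) < \<eta> \<and> l\<^sup>2 * ((2 - X) / (1 - X)) = 2 \<longrightarrow>
    norm (saddle_int a n X l - sqrt (pi / n))
      \<le> C * sqrt (pi / n) / n"
proof -
  obtain \<eta> where \<eta>: "\<eta> > 0" "\<And>X l t. X \<noteq> 0 \<Longrightarrow> norm X < \<eta> \<Longrightarrow> norm (l - 1) < \<eta> \<Longrightarrow> \<bar>t\<bar> \<le> 8 / 5 \<Longrightarrow>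
     Re (saddle_phase X (l * of_real t)) \<le> - (1 / 8) * t\<^sup>2"
    using saddle_phase_Re by blast
  define B where "B = \<bar>a\<bar> * 3 * (2 + \<bar>a\<bar> * 3) * exp (\<bar>a\<bar> * 2)"
  \<comment> \<open>One constant for all hypotheses of \<open>laplace_integral\<close>, generously
    rounded with \<open>norm l \<le> 17 / 16\<close>: the first summand covers the quartic remainder
    and \<open>c3\<close>, the second \<open>c1\<close>, the third the amplitude remainder.\<close>
  define M where "M = 16384 * 16 + \<bar>a\<bar> * 12 + B * 4"
  have B0: "B \<ge> 0" by (simp add: B_def)
  have M0: "M \<ge> 0" using B0 by (simp add: M_def)
  define C where "C = laplace_const (1 / 8) (pi / 2) M"
  have C: "C \<ge> 0" unfolding C_def using M0 by (intro laplace_const_nonneg) auto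
  show ?thesis
  proof (rule exI[of _ "min \<eta> (1 / 16)"], rule conjI[OF _ exI[of _ C]], goal_cases)
    case 1
    show ?case using \<eta>(1) by simp
  next
    case 2
    show ?case
    proof (intro conjI allI impI C)
    fix n :: nat and X l :: complex
    assume n: "n > 0" and A: "X \<noteq> 0 \<and> norm X < min \<eta> (1 / 16) \<and> norm (l - 1) < min \<eta> (1 / 16) \<and> l\<^sup>2 * ((2 - X) / (1 - X)) = 2"
    then have X: "X \<noteq> 0" "norm X < \<eta>" "norm (l - 1) < \<eta>" "norm X \<le> 1 / 16" "norm (l - 1) \<le> 1 / 16"
      and l2: "(2 - X) / (1 - X) * l\<^sup>2 = 2" by (auto simp: mult_ac)
    have pi: "pi / 2 \<le> 8 / 5" using pi_less_4 pi_approx by simp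
    have l: "norm l \<le> 17 / 16" using norm_triangle_ineq[of "l - 1" 1] X by simp
    have lt: "norm (l * of_real t) \<le> 2" if "\<bar>t\<bar> \<le> pi / 2" for t
    proof -
      have "norm l * \<bar>t\<bar> \<le> 17 / 16 * (8 / 5)" using that pi l by (intro mult_mono) auto
      then show ?thesis by (simp add: norm_mult)
    qed
    have lk: "norm l ^ k \<le> (17 / 16) ^ k" for k using l by (intro power_mono) auto
    define c3 where "c3 = saddle_phase_deriv X 3 0 * l ^ 3 / 6"
    define c1 where "c1 = saddle_amp_deriv a X 1 0 * l"
    have phase: "norm (saddle_phase X (l * of_real t) + of_real (t\<^sup>2) - c3 * of_real (t ^ 3)) \<le> M * t ^ 4" if "\<bar>t\<bar> \<le> pi / 2" for t
    proof -
      have "(2 - X) / (1 - X) * (l * of_real t)\<^sup>2 / 2 = ((2 - X) / (1 - X) * l\<^sup>2) * of_real (t\<^sup>2) / 2"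
        by (simp add: power_mult_distrib)
      also have "\<dots> = of_real (t\<^sup>2)" unfolding l2 by simp
      finally have e: "(2 - X) / (1 - X) * (l * of_real t)\<^sup>2 / 2 = of_real (t\<^sup>2)" .
      have "norm (saddle_phase X (l * of_real t) + of_real (t\<^sup>2) - c3 * of_real (t ^ 3)) \<le> 16384 * norm (l * of_real t) ^ 4"
        using saddle_phase_Taylor(1)[OF X(4) lt[OF that] X(1)] unfolding e by (simp add: c3_def power_mult_distrib mult_ac)
      also have "\<dots> = 16384 * norm l ^ 4 * t ^ 4" by (simp add: norm_mult power_mult_distrib)
      also have "\<dots> \<le> M * t ^ 4"
        using lk[of 4] B0 by (intro mult_right_mono) (auto simp: M_def power_divide)
      finally show ?thesis .
    qed
    have amp: "norm (saddle_amp a X (l * of_real t) - 1 - c1 * of_real t) \<le> M * t\<^sup>2" if "\<bar>t\<bar> \<le> pi / 2" for t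
    proof -
      have "norm (saddle_amp a X (l * of_real t) - 1 - c1 * of_real t) \<le> B * norm (l * of_real t) ^ 2"
        using saddle_amp_Taylor(1)[OF X(4) lt[OF that], of a] by (simp add: c1_def B_def mult_ac)
      also have "\<dots> = B * norm l ^ 2 * t\<^sup>2" by (simp add: norm_mult power_mult_distrib)
      also have "\<dots> \<le> B * (17 / 16) ^ 2 * t\<^sup>2"
        using B0 lk[of 2] by (intro mult_right_mono mult_left_mono) auto
      also have "\<dots> \<le> M * t\<^sup>2"
        using B0 by (intro mult_right_mono) (auto simp: M_def power_divide)
      finally show ?thesis .
    qed
    have c: "norm c1 \<le> M" "norm c3 \<le> M"
    proof -
      have "norm c1 \<le> \<bar>a\<bar> * 3 * (17 / 16)"
        unfolding c1_def norm_mult using saddle_amp_Taylor(2)[OF X(4), of 0 a] l by (intro mult_mono) auto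
      also have "\<dots> \<le> M" using B0 by (simp add: M_def)
      finally show "norm c1 \<le> M" .
      have "norm c3 = norm (saddle_phase_deriv X 3 0) * norm l ^ 3 / 6"
        by (simp add: c3_def norm_mult norm_divide norm_power)
      also have "\<dots> \<le> (64 * 2 * 22) * (17 / 16) ^ 3 / 6"
        using saddle_phase_Taylor(2)[OF X(4) _ X(1), of 0] lk[of 3]
        by (intro divide_right_mono mult_mono) auto
      also have "\<dots> \<le> M" using B0 by (simp add: M_def power_divide)
      finally show "norm c3 \<le> M" .
    qed
    have ball: "continuous_on (cball 0 2) (saddle_phase X)" "continuous_on (cball 0 2) (saddle_amp a X)"
    proof -
      have 0: "saddle_phase_deriv X 0 = saddle_phase X" "saddle_amp_deriv a X 0 = saddle_amp a X"
        by (simp_all add: saddle_phase_deriv_def saddle_amp_deriv_def fun_eq_iff)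
      have "isCont (saddle_phase X) s" if "s \<in> cball 0 2" for s
        using saddle_phase_deriv_has_derivative[OF X(4) _ X(1), of s 0] that unfolding 0
        by (intro DERIV_isCont) simp
      then show "continuous_on (cball 0 2) (saddle_phase X)"
        by (intro continuous_at_imp_continuous_on) blast
      have "isCont (saddle_amp a X) s" if "s \<in> cball 0 2" for s
        using saddle_amp_deriv_has_derivative[OF X(4), of s 0 a] that unfolding 0
        by (intro DERIV_isCont) simp
      then show "continuous_on (cball 0 2) (saddle_amp a X)"
        by (intro continuous_at_imp_continuous_on) blast
    qed
    have sub: "(\<lambda>t. l * of_real t) ` {-(pi/2)..pi/2} \<subseteq> cball 0 2" using lt by (auto simp: abs_le_iff)
    have "continuous_on {-(pi/2)..pi/2} (\<lambda>t. saddle_phase X (l * of_real t))"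
      by (rule continuous_on_compose2[OF ball(1) _ sub]) (intro continuous_intros)
    moreover have "continuous_on {-(pi/2)..pi/2} (\<lambda>t. saddle_amp a X (l * of_real t))"
      by (rule continuous_on_compose2[OF ball(2) _ sub]) (intro continuous_intros)
    ultimately show "norm (saddle_int a n X l - sqrt (pi / n))
      \<le> C * sqrt (pi / n) / n"
      unfolding C_def saddle_int_def using phase amp c \<eta>(2)[OF X(1,2,3)] pi n by (intro laplace_integral[where ?c1.0 = c1 and ?c3.0 = c3]) auto
    qed
  qed
qed

section \<open>Contour deformation\<close>

text \<open>Cauchy's integrand in the angle variable. The angle is complex so that the path can
  leave the real axis and pass through the saddles.\<close>

definition coeff_integrand :: "real \<Rightarrow> nat \<Rightarrow> complex \<Rightarrow> complex \<Rightarrow> complex" where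
  "coeff_integrand a n z \<theta> = gen_fun a n z (exp (\<i> * \<theta>)) * exp (- \<i> * of_nat n * \<theta>)"

lemma norm_exp_strip:
  fixes \<theta> :: complex
  assumes "\<bar>Im \<theta>\<bar> < 1 / 2"
  shows "norm (exp (\<i> * \<theta>)) < 2"
proof -
  have "exp (- Im \<theta>) < exp (1 / 2)" using assms by simp
  also have "exp (1 / 2) < (2::real)"
  proof (rule power_less_imp_less_base)
    have "(exp (1 / 2 :: real)) ^ 2 = exp 1" by (simp add: power2_eq_square exp_add[symmetric])
    then show "(exp (1 / 2 :: real)) ^ 2 < 2 ^ 2" using e_less_272 by simp
  qed simp
  finally show ?thesis by simp
qed

text \<open>The strip is convex, hence the integrand has a primitive there, and path integrals
  become differences of \<open>\<Phi>\<close>. Periodicity of the integrand makes the increment over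
  \<open>2 * pi\<close> constant; on the real axis it is Cauchy's integral. In the strip
  \<open>exp (\<i> * \<theta>)\<close> stays below 2, inside the disk of radius
  \<open>1 / norm z\<close>.\<close>

lemma coeff_integrand_primitive:
  assumes z: "z \<noteq> 0" "norm z < 1 / 2"
  obtains \<Phi> where
    "\<And>\<theta>. \<bar>Im \<theta>\<bar> < 1 / 2 \<Longrightarrow> (\<Phi> has_field_derivative coeff_integrand a n z \<theta>) (at \<theta>)"
    "\<And>\<theta> :: complex. \<bar>Im \<theta>\<bar> < 1 / 2 \<Longrightarrow> \<Phi> (\<theta> + 2 * pi) - \<Phi> \<theta> = 2 * pi * ((deriv ^^ n) (gen_fun a n z) 0 / fact n)"
proof -
  define S where "S = {\<theta>::complex. \<bar>Im \<theta>\<bar> < 1 / 2}"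
  have S: "S = {\<theta>. Im \<theta> > - 1 / 2} \<inter> {\<theta>. Im \<theta> < 1 / 2}" by (auto simp: S_def)
  have conv: "convex S" "open S"
    unfolding S by (intro convex_Int convex_halfspace_Im_gt convex_halfspace_Im_lt)
      (intro open_Int open_halfspace_Im_gt open_halfspace_Im_lt)
  have R: "1 / norm z > 1" "1 / norm z > 2" using z by (auto simp: field_simps)
  have "coeff_integrand a n z holomorphic_on S"
    unfolding coeff_integrand_def
  proof (intro holomorphic_intros)
    have "(gen_fun a n z \<circ> (\<lambda>\<theta>. exp (\<i> * \<theta>))) holomorphic_on S"
    proof (rule holomorphic_on_compose_gen[OF _ gen_fun_holomorphic[OF z(1)]])
      show "(\<lambda>\<theta>. exp (\<i> * \<theta>)) ` S \<subseteq> ball 0 (1 / norm z)"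
        using norm_exp_strip R(2) by (fastforce simp: S_def simp del: norm_exp_eq_Re)
    qed (intro holomorphic_intros)
    then show "(\<lambda>\<theta>. gen_fun a n z (exp (\<i> * \<theta>))) holomorphic_on S" by (simp add: o_def)
  qed
  then obtain \<Phi> where "\<And>\<theta>. \<theta> \<in> S \<Longrightarrow> (\<Phi> has_field_derivative coeff_integrand a n z \<theta>) (at \<theta> within S)"
    using holomorphic_convex_primitive'[OF conv] by blast
  then have \<Phi>: "(\<Phi> has_field_derivative coeff_integrand a n z \<theta>) (at \<theta>)" if "\<theta> \<in> S" for \<theta>
    using that conv(2) at_within_open by metis
  have per: "coeff_integrand a n z (\<theta> + 2 * pi) = coeff_integrand a n z \<theta>" for \<theta> :: complex
  proof -
    have e: "exp (\<i> * (2 * of_real pi)) = 1" by (simp add: exp_eq_1)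
    have "\<i> * (\<theta> + 2 * pi) = \<i> * \<theta> + \<i> * (2 * of_real pi)" by (simp add: algebra_simps)
    then have 1: "exp (\<i> * (\<theta> + 2 * pi)) = exp (\<i> * \<theta>)" by (simp only: exp_add e mult_1_right)
    have neg: "exp (- \<i> * of_nat n * w) = inverse (exp (\<i> * w) ^ n)" for w
      by (simp add: exp_minus exp_of_nat_mult[symmetric] mult_ac)
    show ?thesis unfolding coeff_integrand_def neg 1 ..
  qed
  have const: "\<Phi> (\<theta> + 2 * pi) - \<Phi> \<theta> = \<Phi> (of_real (2 * pi)) - \<Phi> 0" if "\<theta> \<in> S" for \<theta> :: complex
  proof -
    have "((\<lambda>w. \<Phi> (w + 2 * pi) - \<Phi> w) has_field_derivative 0) (at w within S)" if w: "w \<in> S" for w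
    proof -
      have "w + 2 * pi \<in> S" using w by (simp add: S_def)
      then have "((\<lambda>w. \<Phi> (w + 2 * pi)) has_field_derivative coeff_integrand a n z (w + 2 * pi)) (at w)"
        using \<Phi> DERIV_shift by blast
      then have "((\<lambda>w. \<Phi> (w + 2 * pi) - \<Phi> w) has_field_derivative coeff_integrand a n z (w + 2 * pi) - coeff_integrand a n z w) (at w)"
        by (intro DERIV_diff \<Phi> w)
      then show ?thesis
        using per[of w] by (simp add: has_field_derivative_at_within)
    qed
    from has_field_derivative_zero_constant[OF conv(1) this]
    obtain c where c: "\<And>w. w \<in> S \<Longrightarrow> \<Phi> (w + 2 * pi) - \<Phi> w = c" by blast
    have "0 \<in> S" by (simp add: S_def)
    from c[OF this] c[OF that] show ?thesis by simp
  qed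
  have i1: "((\<lambda>t. coeff_integrand a n z (of_real t)) has_integral \<Phi> (of_real (2 * pi)) - \<Phi> (of_real 0)) {0..2 * pi}"
  proof (rule fundamental_theorem_of_calculus)
    fix t :: real
    have "of_real t \<in> S" by (simp add: S_def)
    from has_vector_derivative_real_field[OF \<Phi>[OF this]]
    show "((\<lambda>t. \<Phi> (of_real t)) has_vector_derivative coeff_integrand a n z (of_real t)) (at t within {0..2 * pi})"
      by (rule has_vector_derivative_at_within)
  qed simp
  have eq: "coeff_integrand a n z (of_real t) = gen_fun a n z (cis t) * cis (- (real n * t))" for t
    by (simp add: coeff_integrand_def cis_conv_exp mult_ac)
  have i2: "((\<lambda>t. gen_fun a n z (cis t) * cis (- (real n * t))) has_integral 2 * pi * ((deriv ^^ n) (gen_fun a n z) 0 / fact n)) {0..2 * pi}"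
    by (rule has_integral_circle_coeff[OF gen_fun_holomorphic[OF z(1)] R(1)])
  have "\<Phi> (of_real (2 * pi)) - \<Phi> 0 = 2 * pi * ((deriv ^^ n) (gen_fun a n z) 0 / fact n)"
    using has_integral_unique[OF i1[unfolded eq] i2] by simp
  with const \<Phi> show ?thesis
    by (intro that[of \<Phi>]) (auto simp: S_def)
qed

lemma primitive_segment_integral:
  fixes c l :: complex and h :: real
  assumes "\<And>t. \<bar>t\<bar> \<le> h \<Longrightarrow> (\<Phi> has_field_derivative G (c + l * of_real t)) (at (c + l * of_real t))" "h \<ge> 0"
  shows "\<Phi> (c + l * of_real h) - \<Phi> (c - l * of_real h) = l * integral {-h..h} (\<lambda>t. G (c + l * of_real t))"
proof -
  have "((\<lambda>t. G (c + l * of_real t) * l) has_integral \<Phi> (c + l * of_real h) - \<Phi> (c + l * of_real (- h))) {-h..h}"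
  proof (rule fundamental_theorem_of_calculus)
    fix t assume "t \<in> {-h..h}"
    then have "(\<Phi> has_field_derivative G (c + l * of_real t)) (at (c + l * of_real t))" by (intro assms) auto
    then have "((\<lambda>w. \<Phi> (c + l * w)) has_field_derivative G (c + l * of_real t) * l) (at (of_real t))"
      by (rule DERIV_chain2) (auto intro!: derivative_eq_intros)
    from has_vector_derivative_real_field[OF this]
    show "((\<lambda>t. \<Phi> (c + l * of_real t)) has_vector_derivative G (c + l * of_real t) * l) (at t within {-h..h})"
      by (rule has_vector_derivative_at_within)
  qed (use assms(2) in simp)
  then show ?thesis by (simp add: integral_unique mult.commute[of l] flip: integral_mult_left)
qed

text \<open>The integrand at a saddle. \<open>L\<close> is a logarithm of \<open>V\<close>, and
  \<open>- \<i> * L\<close> is the saddle in the angle plane; it is an argument of its own because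
  both \<open>Ln U\<close> and \<open>- Ln U\<close> are needed.\<close>

definition saddle_value :: "real \<Rightarrow> nat \<Rightarrow> complex \<Rightarrow> complex \<Rightarrow> complex \<Rightarrow> complex" where
  "saddle_value a n z V L =
     exp (of_nat n * (V / z + Ln (1 - z * V) / z\<^sup>2 - L)) * exp (- of_real a * Ln (1 - z * V))"

lemma coeff_integrand_saddle:
  assumes "V + 1 / V = z" "V \<noteq> 0" "z \<noteq> 0" "exp L = V"
  shows "coeff_integrand a n z (- \<i> * L + s) =
    saddle_value a n z V L * (exp (n * saddle_phase (z * V) s) * saddle_amp a (z * V) s)"
proof -
  define E where "E = exp (\<i> * s)"
  define A where "A = Ln (1 - z * V * E)"
  define B where "B = Ln (1 - z * V)"
  \<comment> \<open>The saddle equation replaces \<open>X - 1\<close> by \<open>V\<^sup>2\<close>,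
    which converts the denominators \<open>X\<close> and \<open>X\<^sup>2\<close> of
    \<open>saddle_phase\<close> into \<open>z\<close> and \<open>z\<^sup>2\<close>.\<close>
  have zV: "z * V - 1 = V\<^sup>2" using assms(1,2) by (subst assms(1)[symmetric]) (simp add: field_simps power2_eq_square)
  have u: "exp (\<i> * (- \<i> * L + s)) = V * E" by (simp add: algebra_simps exp_add assms(4) E_def)
  have p: "saddle_phase (z * V) s = V * (E - 1) / z + (A - B) / z\<^sup>2 - \<i> * s"
  proof -
    have "saddle_phase (z * V) s = V\<^sup>2 * ((E - 1) / (z * V) + (A - B) / (z * V)\<^sup>2) - \<i> * s"
      unfolding saddle_phase_def zV by (simp add: E_def A_def B_def)
    also have "V\<^sup>2 * ((E - 1) / (z * V) + (A - B) / (z * V)\<^sup>2) = V * (E - 1) / z + (A - B) / z\<^sup>2"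
      using assms(2,3) by (simp add: field_simps power2_eq_square)
    finally show ?thesis .
  qed
  have "coeff_integrand a n z (- \<i> * L + s) = exp (n * (V * E / z) + (n / z\<^sup>2 - a) * A - \<i> * n * (- \<i> * L + s))"
    unfolding coeff_integrand_def u gen_fun_def exp_add[symmetric] by (simp add: A_def mult_ac)
  also have "n * (V * E / z) + (n / z\<^sup>2 - a) * A - \<i> * n * (- \<i> * L + s) =
     n * (V / z + B / z\<^sup>2 - L) + (- of_real a * B) + (n * (V * (E - 1) / z + (A - B) / z\<^sup>2 - \<i> * s) + (- of_real a * (A - B)))"
    using assms(3) by (simp add: field_simps)
  also have "exp \<dots> = exp (n * (V / z + B / z\<^sup>2 - L)) * exp (- of_real a * B) * (exp (n * saddle_phase (z * V) s) * saddle_amp a (z * V) s)"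
    unfolding p saddle_amp_def exp_add by (simp add: A_def B_def E_def mult_ac)
  finally show ?thesis by (simp add: B_def saddle_value_def)
qed

text \<open>On the disk of radius 1/2 the third derivative is at most 16. In
  \<open>n * u / z + n / z\<^sup>2 * Ln (1 - z * u)\<close> the linear term cancels the pole and the
  quadratic one gives \<open>- n * u\<^sup>2 / 2\<close>, so the cubic remainder measures the
  distance from \<open>z = 0\<close>.\<close>

lemma Ln_one_minus_cubic:
  fixes w :: complex
  assumes "norm w \<le> 1 / 2"
  shows "norm (Ln (1 - w) + w + w\<^sup>2 / 2) \<le> 8 * norm w ^ 3"
proof -
  define f where "f = (\<lambda>(k::nat) w::complex. if k = 0 then Ln (1 - w) else if k = 1 then - 1 / (1 - w)
     else if k = 2 then - 1 / (1 - w)\<^sup>2 else - 2 / (1 - w) ^ 3)"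
  have nz: "1 - x \<notin> \<real>\<^sub>\<le>\<^sub>0" "1 - x \<noteq> 0" "norm (1 - x) \<ge> 1 / 2" if "norm x \<le> 1 / 2" for x :: complex
  proof -
    show "1 - x \<notin> \<real>\<^sub>\<le>\<^sub>0" using that by (intro one_minus_notin_nonpos_Reals) simp
    then show "1 - x \<noteq> 0" by auto
    show "norm (1 - x) \<ge> 1 / 2" using norm_triangle_ineq2[of 1 x] that by simp
  qed
  have "cmod (f 0 w - (\<Sum>i\<le>2. f i 0 * (w - 0) ^ i / fact i)) \<le> 16 * cmod (w - 0) ^ Suc 2 / fact 2"
  proof (rule complex_Taylor[where S = "cball 0 (1/2)"])
    show "(f i has_field_derivative f (Suc i) x) (at x within cball 0 (1/2))" if "x \<in> cball 0 (1/2)" "i \<le> 2" for i x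
    proof (rule has_field_derivative_at_within)
      have x: "1 - x \<notin> \<real>\<^sub>\<le>\<^sub>0" "1 - x \<noteq> 0" using nz that by auto
      consider "i = 0" | "i = 1" | "i = 2" using \<open>i \<le> 2\<close> by linarith
      then show "(f i has_field_derivative f (Suc i) x) (at x)"
      proof cases
        case 1
        then have f: "f i = (\<lambda>w. Ln (1 - w))" "f (Suc i) x = - 1 / (1 - x)" by (simp_all add: f_def fun_eq_iff)
        show ?thesis unfolding f using x by (auto intro!: derivative_eq_intros simp: divide_inverse)
      next
        case 2
        then have f: "f i = (\<lambda>w. - 1 / (1 - w))" "f (Suc i) x = - 1 / (1 - x)\<^sup>2" by (simp_all add: f_def fun_eq_iff)
        show ?thesis unfolding f using x by (auto intro!: derivative_eq_intros simp: power2_eq_square)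
      next
        case 3
        then have f: "f i = (\<lambda>w. - 1 / (1 - w)\<^sup>2)" "f (Suc i) x = - 2 / (1 - x) ^ 3" by (simp_all add: f_def fun_eq_iff)
        have "((\<lambda>w. - 1 / (1 - w)\<^sup>2) has_field_derivative - (2 * (1 - x)) / ((1 - x)\<^sup>2 * (1 - x)\<^sup>2)) (at x)"
          using x by (auto intro!: derivative_eq_intros simp: minus_divide_left simp del: divide_minus_left)
        also have "- (2 * (1 - x)) / ((1 - x)\<^sup>2 * (1 - x)\<^sup>2) = - 2 / (1 - x) ^ 3"
        proof -
          have "- (2 * w) / (w\<^sup>2 * w\<^sup>2) = - 2 / w ^ 3" if "w \<noteq> 0" for w :: complex
            using that by (simp add: field_simps power2_eq_square power3_eq_cube)
          then show ?thesis using x(2) .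
        qed
        finally show ?thesis unfolding f .
      qed
    qed
    show "norm (f (Suc 2) x) \<le> 16" if "x \<in> cball 0 (1/2)" for x
    proof -
      have "(1 / 2) ^ 3 \<le> norm (1 - x) ^ 3" using nz(3)[of x] that by (intro power_mono) auto
      then have "norm (1 - x) ^ 3 \<ge> 1 / 8" by (simp add: power_divide)
      then have "2 / norm (1 - x) ^ 3 \<le> 2 / (1 / 8)" by (intro divide_left_mono) auto
      then show ?thesis by (simp add: f_def norm_divide norm_power)
    qed
  qed (use assms in auto)
  also have "(\<Sum>i\<le>2. f i 0 * (w - 0) ^ i / fact i) = - w - w\<^sup>2 / 2"
    by (simp add: f_def eval_nat_numeral)
  also have "f 0 w = Ln (1 - w)" by (simp add: f_def)
  finally show ?thesis by (simp add: eval_nat_numeral algebra_simps)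
qed

text \<open>At \<open>z = 0\<close> the exponent per unit of \<open>n\<close> is
  \<open>- u\<^sup>2 / 2 - \<i> * \<theta>\<close>, with real part -1/2 at the angles 0 and
  \<open>pi\<close>. It stays below -1/4 nearby, and the correction for small \<open>z\<close> is at
  most 1/4, so only the amplitude remains.\<close>

lemma coeff_integrand_bound:
  "\<exists>\<delta>>0. \<delta> < 1 / 2 \<and> (\<forall>n z \<theta>. z \<noteq> 0 \<and> norm z < \<delta> \<and> (norm \<theta> < \<delta> \<or> norm (\<theta> - of_real pi) < \<delta>) \<longrightarrow>
     norm (coeff_integrand a n z \<theta>) \<le> exp \<bar>a\<bar>)"
proof -
  define f where "f = (\<lambda>\<theta>::complex. Re (- (exp (\<i> * \<theta>))\<^sup>2 / 2 - \<i> * \<theta>))"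
  have "continuous_on UNIV f" unfolding f_def by (intro continuous_intros) auto
  then have cont: "isCont f \<theta>" for \<theta> by (simp add: continuous_on_eq_continuous_at)
  have f0: "f 0 = - 1 / 2" by (simp add: f_def)
  have fpi: "f (of_real pi) = - 1 / 2" by (simp add: f_def)
  have ev: "\<exists>d>0. \<forall>\<theta>. norm (\<theta> - c) < d \<longrightarrow> f \<theta> < - 1 / 4" if "f c = - 1 / 2" for c
  proof -
    have "(f \<longlongrightarrow> f c) (nhds c)" using cont[of c] by (simp add: continuous_within tendsto_at_iff_tendsto_nhds)
    then have "eventually (\<lambda>\<theta>. f \<theta> < - 1 / 4) (nhds c)" using that by (intro order_tendstoD) auto
    then show ?thesis by (simp add: eventually_nhds_metric dist_norm)
  qed
  obtain d1 where d1: "d1 > 0" "\<And>\<theta>. norm (\<theta> - 0) < d1 \<Longrightarrow> f \<theta> < - 1 / 4" using ev[OF f0] by blast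
  obtain d2 where d2: "d2 > 0" "\<And>\<theta>. norm (\<theta> - of_real pi) < d2 \<Longrightarrow> f \<theta> < - 1 / 4" using ev[OF fpi] by blast
  \<comment> \<open>With \<open>norm u \<le> 2\<close> the cubic remainder divided by
    \<open>norm z ^ 2\<close> is at most \<open>8 * norm z * 2 ^ 3\<close>, and the radius 1/256
    turns this into 1/4.\<close>
  define \<delta> where "\<delta> = min (min d1 d2) (1 / 256)"
  show ?thesis
  proof (intro exI[of _ \<delta>] conjI allI impI)
    show "\<delta> > 0" "\<delta> < 1 / 2" using d1 d2 by (auto simp: \<delta>_def)
    fix n :: nat and z \<theta> :: complex
    assume A: "z \<noteq> 0 \<and> norm z < \<delta> \<and> (norm \<theta> < \<delta> \<or> norm (\<theta> - of_real pi) < \<delta>)"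
    then have z: "z \<noteq> 0" "norm z \<le> 1 / 256" by (auto simp: \<delta>_def)
    have f: "f \<theta> < - 1 / 4" using A d1(2)[of \<theta>] d2(2)[of \<theta>] by (auto simp: \<delta>_def)
    define u where "u = exp (\<i> * \<theta>)"
    have "\<bar>Im \<theta>\<bar> < 1 / 2"
      using A abs_Im_le_cmod[of \<theta>] abs_Im_le_cmod[of "\<theta> - of_real pi"] by (auto simp: \<delta>_def)
    then have u: "norm u \<le> 2" unfolding u_def using norm_exp_strip less_imp_le by blast
    have "norm z * norm u \<le> 1 / 256 * 2" using z u by (intro mult_mono) auto
    then have zu: "norm (z * u) \<le> 1 / 128" by (simp add: norm_mult)
    define D where "D = Ln (1 - z * u) + z * u + (z * u)\<^sup>2 / 2"
    have "norm (D / z\<^sup>2) \<le> 8 * norm (z * u) ^ 3 / norm z ^ 2"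
      unfolding norm_divide norm_power D_def using zu by (intro divide_right_mono Ln_one_minus_cubic) auto
    also have "\<dots> = 8 * norm z * norm u ^ 3"
      using z by (simp add: norm_mult power_mult_distrib power2_eq_square power3_eq_cube)
    also have "\<dots> \<le> 8 * (1 / 256) * 2 ^ 3"
      using z u by (intro mult_mono power_mono) auto
    finally have D: "norm (D / z\<^sup>2) \<le> 1 / 4" by simp
    have "norm (Ln (1 - z * u)) \<le> 1"
      using norm_Ln_le[of "- (z * u)"] zu by simp
    then have "norm (of_real a * Ln (1 - z * u)) \<le> \<bar>a\<bar> * 1"
      unfolding norm_mult by (intro mult_mono) auto
    then have aL: "Re (- (of_real a * Ln (1 - z * u))) \<le> \<bar>a\<bar>"
      using complex_Re_le_cmod[of "- (of_real a * Ln (1 - z * u))"] by simp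
    have "coeff_integrand a n z \<theta> = exp (n * (u / z) + (n / z\<^sup>2 - a) * Ln (1 - z * u) + (- \<i> * of_nat n * \<theta>))"
      unfolding coeff_integrand_def gen_fun_def u_def exp_add by simp
    also have "n * (u / z) + (n / z\<^sup>2 - a) * Ln (1 - z * u) + (- \<i> * of_nat n * \<theta>) =
        of_nat n * (D / z\<^sup>2 + (- u\<^sup>2 / 2 - \<i> * \<theta>)) + - (of_real a * Ln (1 - z * u))"
    proof -
      have L: "Ln (1 - z * u) = D - z * u - (z * u)\<^sup>2 / 2" by (simp add: D_def)
      have "n * (u / z) + n / z\<^sup>2 * Ln (1 - z * u) = of_nat n * (D / z\<^sup>2 - u\<^sup>2 / 2)"
        unfolding L using z by (simp add: field_simps power2_eq_square)
      then show ?thesis by (simp add: algebra_simps)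
    qed
    also have "norm (exp \<dots>) = exp (n * Re (D / z\<^sup>2 + (- u\<^sup>2 / 2 - \<i> * \<theta>)) + Re (- (of_real a * Ln (1 - z * u))))"
      by simp
    also have "\<dots> \<le> exp (0 + \<bar>a\<bar>)"
    proof -
      have "Re (D / z\<^sup>2 + (- u\<^sup>2 / 2 - \<i> * \<theta>)) = Re (D / z\<^sup>2) + f \<theta>"
        unfolding f_def u_def by (simp only: plus_complex.sel)
      also have "\<dots> \<le> 0" using f D complex_Re_le_cmod[of "D / z\<^sup>2"] by linarith
      finally have "n * Re (D / z\<^sup>2 + (- u\<^sup>2 / 2 - \<i> * \<theta>)) \<le> 0" by (simp add: mult_nonneg_nonpos)
      then show ?thesis using aL unfolding exp_le_cancel_iff by (rule add_mono)
    qed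
    finally show "norm (coeff_integrand a n z \<theta>) \<le> exp \<bar>a\<bar>" by simp
  qed
qed

section \<open>The Joukowski parameter and the root factor near the origin\<close>

definition joukowski_inv :: "complex \<Rightarrow> complex" where
  "joukowski_inv z = z / 2 + \<i> * (csqrt (1 - z / 2) * csqrt (1 + z / 2))"

definition quartic_root_factor :: "complex \<Rightarrow> complex" where
  "quartic_root_factor z = (2 - z) powr (-1/4) * (z + 2) powr (-1/4)"

text \<open>For \<open>z\<close> in the upper half plane \<open>1 - z / 2\<close> lies in the lower
  one, where changing the sign multiplies the principal root by \<open>\<i>\<close>. The form on the
  right is analytic at \<open>z = 0\<close>, whereas \<open>csqrt (z / 2 - 1)\<close> meets its
  branch cut there.\<close>

lemma varphi_eq_joukowski_inv:
  assumes "Im z > 0"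
  shows "varphi (z / 2) = joukowski_inv z"
proof -
  have "csqrt (- (1 - z / 2)) = \<i> * csqrt (1 - z / 2)"
    using assms by (intro csqrt_minus) auto
  then show ?thesis by (simp add: varphi_def joukowski_inv_def add.commute del: csqrt.simps)
qed

lemma joukowski_inv_sum:
  "joukowski_inv z + 1 / joukowski_inv z = z" "joukowski_inv z \<noteq> 0"
proof -
  define w where "w = \<i> * (csqrt (1 - z / 2) * csqrt (1 + z / 2))"
  have w2: "w\<^sup>2 = z\<^sup>2 / 4 - 1"
    unfolding w_def power_mult_distrib power2_csqrt by (simp add: power2_eq_square field_simps)
  have J: "joukowski_inv z = z / 2 + w" by (simp add: joukowski_inv_def w_def)
  have "(z / 2 + w) * (z / 2 - w) = z\<^sup>2 / 4 - w\<^sup>2" by (simp add: power2_eq_square algebra_simps)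
  then have 1: "(z / 2 + w) * (z / 2 - w) = 1" by (simp add: w2)
  then show nz: "joukowski_inv z \<noteq> 0" unfolding J by auto
  have "1 / (z / 2 + w) = z / 2 - w" using 1 nz unfolding J by (simp add: divide_eq_eq mult.commute)
  then show "joukowski_inv z + 1 / joukowski_inv z = z" unfolding J by simp
qed

text \<open>The fourth power of the root factor is \<open>1 / (4 - z\<^sup>2)\<close>, while the
  square of \<open>U - 1 / U\<close> is \<open>z\<^sup>2 - 4\<close> for
  \<open>U = joukowski_inv z\<close>. With the sign settled, this links the prefactor of the
  expansion to the steepest descent normalisation.\<close>

lemma quartic_root_identity:
  assumes "z \<noteq> 2" "z \<noteq> -2"
  shows "((quartic_root_factor z)\<^sup>2 * (joukowski_inv z - 1 / joukowski_inv z))\<^sup>2 = -1"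
proof -
  define q where "q = quartic_root_factor z"
  define U where "U = joukowski_inv z"
  have U: "U + 1 / U = z" "U \<noteq> 0" using joukowski_inv_sum unfolding U_def by auto
  have p4: "(w powr (-1/4)) ^ 4 = 1 / w" if "w \<noteq> 0" for w :: complex
  proof -
    have "(w powr (-1/4)) ^ 4 = exp (- Ln w)"
      using that by (simp add: powr_def exp_of_nat_mult[symmetric])
    then show ?thesis using that by (simp add: exp_minus field_simps)
  qed
  have nz: "2 - z \<noteq> 0" "z + 2 \<noteq> 0" using assms by (auto simp: eq_neg_iff_add_eq_0)
  have q4: "q ^ 4 = 1 / ((2 - z) * (z + 2))"
    unfolding q_def quartic_root_factor_def power_mult_distrib p4[OF nz(1)] p4[OF nz(2)] by simp
  have "(U - 1 / U)\<^sup>2 = (U + 1 / U)\<^sup>2 - 4"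
    using U(2) by (simp add: power2_eq_square field_simps)
  then have "(U - 1 / U)\<^sup>2 = - ((2 - z) * (z + 2))" unfolding U(1) by (simp add: power2_eq_square algebra_simps)
  then have "(q\<^sup>2 * (U - 1 / U))\<^sup>2 = q ^ 4 * - ((2 - z) * (z + 2))"
    by (simp add: power_mult_distrib)
  also have "\<dots> = -1" unfolding q4 using nz by simp
  finally show ?thesis unfolding q_def U_def .
qed

lemma quartic_root_factor_0: "quartic_root_factor 0 = of_real (1 / sqrt 2)"
proof -
  have "quartic_root_factor 0 = 2 powr (-1/4) * 2 powr (-1/4)" by (simp add: quartic_root_factor_def)
  also have "\<dots> = (2::complex) powr (-1/4 + -1/4)" by (simp only: powr_add)
  also have "(2::complex) powr (-1/4 + -1/4) = of_real 2 powr of_real (-1/2)" by simp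
  also have "\<dots> = of_real (2 powr (-1/2))" by (intro powr_of_real) auto
  also have "2 powr (-1/2) = 1 / sqrt 2" by (simp add: powr_minus_divide powr_half_sqrt)
  finally show ?thesis .
qed

text \<open>All closeness conditions for the contour at once. The products of \<open>z\<close> with
  \<open>U\<close> and \<open>1 / U\<close> are the values of \<open>X\<close> at the two saddles,
  \<open>- \<i> * Ln U\<close> is the saddle near \<open>pi / 2\<close>, and the last two lines
  concern the directions of the segments.\<close>

definition saddle_parameters :: "real \<Rightarrow> complex \<Rightarrow> bool" where
  "saddle_parameters \<eta> z \<longleftrightarrow>
    Im (joukowski_inv z) > 0 \<and>
    (quartic_root_factor z)\<^sup>2 * (joukowski_inv z - 1 / joukowski_inv z) = \<i> \<and>
    norm (quartic_root_factor z) ^ 2 > 1 / 4 \<and>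
    norm (z * joukowski_inv z) < \<eta> \<and> norm (z * (1 / joukowski_inv z)) < \<eta> \<and>
    norm (- \<i> * Ln (joukowski_inv z) - pi / 2) < \<eta> \<and>
    norm (sqrt 2 * quartic_root_factor z * exp (\<i> * pi / 4 - Ln (joukowski_inv z) / 2) - 1) < \<eta> \<and>
    norm (sqrt 2 * quartic_root_factor z * exp (- \<i> * pi / 4 + Ln (joukowski_inv z) / 2) - 1) < \<eta>"

text \<open>In the limit \<open>z = 0\<close> the parameter is \<open>\<i>\<close>, the root factor
  \<open>1 / sqrt 2\<close> and both directions are 1, so every strict inequality holds nearby by
  continuity. Only the equation requires \<open>quartic_root_identity\<close>.\<close>

lemma saddle_parameters_near_0:
  fixes \<eta> :: real
  assumes "\<eta> > 0"
  shows "\<exists>\<epsilon>>0. \<forall>z. norm z < \<epsilon> \<longrightarrow>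
    saddle_parameters \<eta> z"
proof -
  let ?F = "nhds (0::complex)"
  have id: "((\<lambda>z. z) \<longlongrightarrow> 0) ?F" by (rule filterlim_ident)
  have c1: "((\<lambda>z. csqrt (1 - z / 2)) \<longlongrightarrow> csqrt (1 - 0 / 2)) ?F"
    by (rule isCont_tendsto_compose[where g = csqrt]) (auto intro!: continuous_at_csqrt tendsto_eq_intros id)
  have c2: "((\<lambda>z. csqrt (1 + z / 2)) \<longlongrightarrow> csqrt (1 + 0 / 2)) ?F"
    by (rule isCont_tendsto_compose[where g = csqrt]) (auto intro!: continuous_at_csqrt tendsto_eq_intros id)
  have "((\<lambda>z. z / 2 + \<i> * (csqrt (1 - z / 2) * csqrt (1 + z / 2))) \<longlongrightarrow> 0 / 2 + \<i> * (csqrt (1 - 0 / 2) * csqrt (1 + 0 / 2))) ?F"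
    by (intro tendsto_add tendsto_mult tendsto_divide tendsto_const id c1 c2) auto
  then have J: "(joukowski_inv \<longlongrightarrow> \<i>) ?F" unfolding joukowski_inv_def by simp
  have "((\<lambda>z. (2 - z) powr (-1/4) * (z + 2) powr (-1/4)) \<longlongrightarrow> (2 - 0) powr (-1/4) * (0 + 2) powr (-1/4)) ?F"
    by (intro tendsto_mult tendsto_powr_complex tendsto_diff tendsto_add tendsto_const id) auto
  then have q: "(quartic_root_factor \<longlongrightarrow> of_real (1 / sqrt 2)) ?F"
    unfolding quartic_root_factor_0[symmetric] quartic_root_factor_def .
  have L: "((\<lambda>z. Ln (joukowski_inv z)) \<longlongrightarrow> \<i> * pi / 2) ?F"
  proof -
    have "\<i> \<notin> \<real>\<^sub>\<le>\<^sub>0" by (simp add: complex_nonpos_Reals_iff)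
    from tendsto_Ln[OF J this] show ?thesis by simp
  qed
  have e1: "eventually (\<lambda>z. Im (joukowski_inv z) > 0) ?F"
    by (rule order_tendstoD(1)[OF tendsto_Im[OF J]]) simp
  have "((\<lambda>z. (quartic_root_factor z)\<^sup>2 * (joukowski_inv z - 1 / joukowski_inv z)) \<longlongrightarrow> (of_real (1 / sqrt 2))\<^sup>2 * (\<i> - 1 / \<i>)) ?F"
    by (intro tendsto_mult tendsto_power tendsto_diff tendsto_divide tendsto_const q J) auto
  from tendsto_Im[OF this]
  have "((\<lambda>z. Im ((quartic_root_factor z)\<^sup>2 * (joukowski_inv z - 1 / joukowski_inv z))) \<longlongrightarrow> 1) ?F"
    by (simp add: power_divide flip: of_real_power)
  then have e2: "eventually (\<lambda>z. Im ((quartic_root_factor z)\<^sup>2 * (joukowski_inv z - 1 / joukowski_inv z)) > 0) ?F"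
    by (rule order_tendstoD(1)) simp
  have "((\<lambda>z. norm (quartic_root_factor z) ^ 2) \<longlongrightarrow> norm (complex_of_real (1 / sqrt 2)) ^ 2) ?F"
    by (intro tendsto_power tendsto_norm q)
  then have e3: "eventually (\<lambda>z. norm (quartic_root_factor z) ^ 2 > 1 / 4) ?F"
    by (rule order_tendstoD(1)) (simp add: norm_divide power_divide)
  have small: "eventually (\<lambda>z. norm (f z - c) < \<eta>) ?F" if "(f \<longlongrightarrow> c) ?F" for f :: "complex \<Rightarrow> complex" and c
    using tendstoD[OF that assms] by (simp add: dist_norm)
  have e4: "eventually (\<lambda>z. norm (z * joukowski_inv z - 0 * \<i>) < \<eta>) ?F"
    by (intro small tendsto_mult id J)
  have e5: "eventually (\<lambda>z. norm (z * (1 / joukowski_inv z) - 0 * (1 / \<i>)) < \<eta>) ?F"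
    by (intro small tendsto_mult tendsto_divide tendsto_const id J) auto
  have "((\<lambda>z. - \<i> * Ln (joukowski_inv z)) \<longlongrightarrow> - \<i> * (\<i> * pi / 2)) ?F"
    by (intro tendsto_mult tendsto_const L)
  then have "((\<lambda>z. - \<i> * Ln (joukowski_inv z)) \<longlongrightarrow> of_real pi / 2) ?F" by simp
  then have e6: "eventually (\<lambda>z. norm (- \<i> * Ln (joukowski_inv z) - of_real pi / 2) < \<eta>) ?F" by (rule small)
  have s2: "complex_of_real (sqrt 2) * of_real (1 / sqrt 2) = 1" by (simp flip: of_real_mult)
  have "((\<lambda>z. complex_of_real (sqrt 2) * quartic_root_factor z * exp (\<i> * pi / 4 - Ln (joukowski_inv z) / 2)) \<longlongrightarrow>
      complex_of_real (sqrt 2) * complex_of_real (1 / sqrt 2) * exp (\<i> * pi / 4 - (\<i> * pi / 2) / 2)) ?F"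
    by (intro tendsto_mult tendsto_exp tendsto_diff tendsto_divide tendsto_const q L) auto
  then have "((\<lambda>z. complex_of_real (sqrt 2) * quartic_root_factor z * exp (\<i> * pi / 4 - Ln (joukowski_inv z) / 2)) \<longlongrightarrow> 1) ?F"
    unfolding s2 by simp
  then have e7: "eventually (\<lambda>z. norm (sqrt 2 * quartic_root_factor z * exp (\<i> * pi / 4 - Ln (joukowski_inv z) / 2) - 1) < \<eta>) ?F"
    by (rule small)
  have "((\<lambda>z. complex_of_real (sqrt 2) * quartic_root_factor z * exp (- \<i> * pi / 4 + Ln (joukowski_inv z) / 2)) \<longlongrightarrow>
      complex_of_real (sqrt 2) * complex_of_real (1 / sqrt 2) * exp (- \<i> * pi / 4 + (\<i> * pi / 2) / 2)) ?F"
    by (intro tendsto_mult tendsto_exp tendsto_add tendsto_divide tendsto_const q L) auto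
  then have "((\<lambda>z. complex_of_real (sqrt 2) * quartic_root_factor z * exp (- \<i> * pi / 4 + Ln (joukowski_inv z) / 2)) \<longlongrightarrow> 1) ?F"
    unfolding s2 by simp
  then have e8: "eventually (\<lambda>z. norm (sqrt 2 * quartic_root_factor z * exp (- \<i> * pi / 4 + Ln (joukowski_inv z) / 2) - 1) < \<eta>) ?F"
    by (rule small)
  have e9: "eventually (\<lambda>z::complex. norm (z - 0) < 2) ?F"
    using tendstoD[OF id, of 2] by (simp add: dist_norm)
  have "eventually (\<lambda>z. saddle_parameters \<eta> z) ?F"
    using e1 e2 e3 e4 e5 e6 e7 e8 e9
  proof eventually_elim
    case (elim z)
    define D where "D = (quartic_root_factor z)\<^sup>2 * (joukowski_inv z - 1 / joukowski_inv z)"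
    have "z \<noteq> 2" "z \<noteq> -2" using elim(9) by auto
    then have "D\<^sup>2 = \<i>\<^sup>2" unfolding D_def using quartic_root_identity by simp
    \<comment> \<open>The sign is the one at \<open>z = 0\<close>, by continuity.\<close>
    then have "D = \<i> \<or> D = - \<i>" by (simp only: power2_eq_iff)
    moreover have "Im D > 0" using elim(2) unfolding D_def .
    ultimately have "D = \<i>" by auto
    with elim show ?case unfolding D_def saddle_parameters_def by simp
  qed
  then show ?thesis unfolding eventually_nhds_metric by (simp only: dist_norm diff_0_right)
qed

text \<open>
  In the application \<open>T1 * T2\<close> is bounded away from \<open>0\<close>, so an error that is small relative to the larger term can be absorbed
  in that term alone.
\<close>

lemma split_error:
  fixes T1 T2 D :: complex
  assumes "norm D \<le> k * max (norm T1) (norm T2)" "max (norm T1) (norm T2) > 0"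
  shows "\<exists>e1 e2. norm e1 \<le> k \<and> norm e2 \<le> k \<and> T1 + T2 + D = T1 * (1 + e1) + T2 * (1 + e2)"
proof -
  have k: "k \<ge> 0"
  proof (rule ccontr)
    assume "\<not> k \<ge> 0"
    then have "k * max (norm T1) (norm T2) < 0" using assms(2) by (intro mult_neg_pos) auto
    then show False using assms(1) norm_ge_zero[of D] by linarith
  qed
  show ?thesis
  proof (cases "norm T1 \<ge> norm T2")
    case True
    then have "T1 \<noteq> 0" "norm (D / T1) \<le> k" using assms by (auto simp: norm_divide divide_simps max_def split: if_splits)
    then show ?thesis using k by (intro exI[of _ "D / T1"] exI[of _ 0]) (simp add: algebra_simps)
  next
    case False
    then have "T2 \<noteq> 0" "norm (D / T2) \<le> k" using assms by (auto simp: norm_divide divide_simps max_def split: if_splits)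
    then show ?thesis using k by (intro exI[of _ 0] exI[of _ "D / T2"]) (simp add: algebra_simps)
  qed
qed

section \<open>The contributions of the two saddles\<close>

lemma sqrt_times_exp_bound:
  assumes "n > 0"
  shows "sqrt (real n) * exp (- real n / 2) \<le> 8 / real n"
proof -
  have n: "real n \<ge> 1" using assms by simp
  have "1 + real n / 2 + (real n / 2)\<^sup>2 / 2 \<le> exp (real n / 2)"
    by (rule exp_lower_Taylor_quadratic) simp
  then have 1: "real n * real n \<le> 8 * exp (real n / 2)" by (simp add: power2_eq_square)
  have "sqrt (real n) \<le> real n" using n by (intro real_le_lsqrt) (auto simp: power2_eq_square)
  then have "sqrt (real n) * real n \<le> real n * real n" by (intro mult_right_mono) auto
  also note 1
  finally show ?thesis using n by (simp add: exp_minus field_simps)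
qed

text \<open>The first summand of the expansion with the root factor included; it belongs to the
  saddle \<open>1 / U\<close>. Its companion \<open>conj_term\<close> belongs to
  \<open>U\<close>.\<close>

definition main_term :: "real \<Rightarrow> nat \<Rightarrow> complex \<Rightarrow> complex" where
  "main_term a n z = quartic_root_factor z *
     (exp (\<i> * of_real (pi * (1/4 - a)) - of_nat n * phi_fun z) * varphi (z / 2) powr of_real (2 * a - 1/2))"

definition conj_term :: "real \<Rightarrow> nat \<Rightarrow> complex \<Rightarrow> complex" where
  "conj_term a n z = quartic_root_factor z *
     (exp (- \<i> * of_real (pi * (1/4 - a)) + of_nat n * phi_fun z) * varphi (z / 2) powr of_real (- 2 * a + 1/2))"

text \<open>Exponentials and powers are mutually inverse, so all dependence on \<open>n\<close>
  cancels. As the squared modulus of the root factor exceeds 1/4 near 0, the larger term has modulus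
  at least 1/2.\<close>

lemma main_term_mult_conj_term:
  assumes "Im z > 0"
  shows "main_term a n z * conj_term a n z = (quartic_root_factor z)\<^sup>2"
proof -
  have U: "varphi (z / 2) \<noteq> 0" using varphi_half(4)[OF assms] .
  have A: "varphi (z / 2) powr of_real (2 * a - 1/2) * varphi (z / 2) powr of_real (- 2 * a + 1/2) = 1"
    unfolding powr_add[symmetric] using U by simp
  have B: "exp (\<i> * of_real (pi * (1/4 - a)) - of_nat n * phi_fun z) * exp (- \<i> * of_real (pi * (1/4 - a)) + of_nat n * phi_fun z) = 1"
    unfolding exp_add[symmetric] by simp
  have "q * (e * p) * (q * (f * r)) = q\<^sup>2 * (e * f) * (p * r)" for q e f p r :: complex
    by (simp add: power2_eq_square mult_ac)
  then show ?thesis unfolding main_term_def conj_term_def by (simp only: A B mult_1_right)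
qed

text \<open>The factors in front of \<open>saddle_value\<close> are the directions of the segments.
  They contribute the phases with \<open>pi / 4\<close> and the half powers of \<open>U\<close>,
  while the amplitude contributes the powers with exponent \<open>2 * a\<close> and the phases
  \<open>pi * a\<close>.\<close>

lemma saddle_terms_eq:
  fixes a :: real and q :: complex
  assumes z: "Im z > 0" and U: "U = varphi (z / 2)" and q: "q = quartic_root_factor z"
  shows "sqrt 2 * q * exp (\<i> * pi / 4 - Ln U / 2) * saddle_value a n z (1 / U) (- Ln U) =
      of_real (sqrt 2 * exp (real n / 2)) * main_term a n z"
    and "sqrt 2 * q * exp (- \<i> * pi / 4 + Ln U / 2) * saddle_value a n z U (Ln U) =
      of_real (sqrt 2 * exp (real n / 2)) * conj_term a n z"
proof -
  note V = varphi_half[OF z, folded U]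
  have z0: "z \<noteq> 0" using z by auto
  define L where "L = Ln U"
  have U2: "1 - z * U = - U\<^sup>2" using V(4) by (subst V(1)[symmetric]) (simp add: field_simps power2_eq_square)
  have L2: "Ln (1 - z * U) = 2 * L - \<i> * pi" unfolding U2 L_def by (rule Ln_minus_square[OF V(3)])
  have iU2: "1 - z * (1 / U) = - (1 / U\<^sup>2)" using V(4) by (subst V(1)[symmetric]) (simp add: field_simps power2_eq_square)
  \<comment> \<open>The numbers \<open>- U\<^sup>2\<close> and \<open>- (1 / U\<^sup>2)\<close> are
    reciprocal, and their principal logarithms are opposite because \<open>2 * Im L - pi\<close>
    stays strictly between \<open>- pi\<close> and \<open>pi\<close>.\<close>
  have L1: "Ln (1 - z * (1 / U)) = - (2 * L - \<i> * pi)"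
  proof (rule Ln_unique)
    have "exp (2 * L - \<i> * pi) = - U\<^sup>2"
      unfolding L2[symmetric] U2 using V(4) by simp
    then show "exp (- (2 * L - \<i> * pi)) = 1 - z * (1 / U)"
      unfolding exp_minus iU2 by (simp add: divide_inverse)
    have "0 < Im L" "Im L < pi" using V(3,4) Im_Ln_pos_lt[of U] by (auto simp: L_def)
    then show "- pi < Im (- (2 * L - \<i> * pi))" "Im (- (2 * L - \<i> * pi)) \<le> pi" by auto
  qed
  have phi: "phi_fun z = U / z + Ln (1 - z * U) / z\<^sup>2 - L - 1 / 2"
    using phi_fun_eq[OF z U] by (simp add: L_def)
  have S2: "U / z + Ln (1 - z * U) / z\<^sup>2 - L = 1 / 2 + phi_fun z" unfolding phi by simp
  have iU: "1 / U / z = 1 - U / z"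
  proof -
    have "1 / U = z - U" using V(1) by (simp add: algebra_simps)
    then show ?thesis using z0 by (simp add: diff_divide_distrib)
  qed
  have S1: "1 / U / z + Ln (1 - z * (1 / U)) / z\<^sup>2 - (- L) = 1 / 2 - phi_fun z"
    unfolding phi iU L1 L2 by (simp add: minus_divide_left[symmetric] del: minus_diff_eq)
  have pw: "U powr of_real x = exp (of_real x * L)" for x using V(4) by (simp add: powr_def L_def)
  have e2: "complex_of_real (exp (real n / 2)) = exp (of_nat n / 2)" by (simp flip: exp_of_real)
  have "exp (\<i> * pi / 4 - L / 2) * (exp (n * (1 / 2 - phi_fun z)) * exp (- of_real a * - (2 * L - \<i> * pi))) =
      exp (of_nat n / 2) * (exp (\<i> * of_real (pi * (1/4 - a)) - of_nat n * phi_fun z) * exp (of_real (2 * a - 1/2) * L))"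
    unfolding exp_add[symmetric] by (rule arg_cong[where f = exp]) (simp add: algebra_simps)
  then show "sqrt 2 * q * exp (\<i> * pi / 4 - Ln U / 2) * saddle_value a n z (1 / U) (- Ln U) =
      of_real (sqrt 2 * exp (real n / 2)) * main_term a n z"
    unfolding main_term_def saddle_value_def U[symmetric] q[symmetric] pw L_def[symmetric] S1
    unfolding L1 e2 by (simp add: mult_ac e2)
  have "exp (- \<i> * pi / 4 + L / 2) * (exp (n * (1 / 2 + phi_fun z)) * exp (- of_real a * (2 * L - \<i> * pi))) =
      exp (of_nat n / 2) * (exp (- \<i> * of_real (pi * (1/4 - a)) + of_nat n * phi_fun z) * exp (of_real (- 2 * a + 1/2) * L))"
    unfolding exp_add[symmetric] by (rule arg_cong[where f = exp]) (simp add: algebra_simps)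
  then show "sqrt 2 * q * exp (- \<i> * pi / 4 + Ln U / 2) * saddle_value a n z U (Ln U) =
      of_real (sqrt 2 * exp (real n / 2)) * conj_term a n z"
    unfolding conj_term_def saddle_value_def U[symmetric] q[symmetric] pw L_def[symmetric] S2
    unfolding L2 e2 by (simp add: mult_ac e2)
qed

text \<open>The increment of the primitive over a period splits into two saddle segments, which give
  the terms with relative error of order \<open>1 / n\<close>, and two connecting segments of
  bounded size. The lower bound on the larger term converts the latter into a relative
  error.\<close>

lemma coeff_asymptotics:
  fixes a :: real
  shows "\<exists>\<epsilon>>0. \<exists>C\<ge>0. \<forall>n>0. \<forall>z. Im z > 0 \<and> norm z < \<epsilon> \<longrightarrow>
    max (norm (main_term a n z)) (norm (conj_term a n z)) \<ge> 1 / 2 \<and>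
    norm (of_real (sqrt (2 * pi * n) * exp (- real n / 2)) * ((deriv ^^ n) (gen_fun a n z) 0 / fact n)
      - (main_term a n z + conj_term a n z))
    \<le> C / n * max (norm (main_term a n z)) (norm (conj_term a n z))"
proof -
  obtain \<eta>1 C1 where \<eta>1: "\<eta>1 > 0" and C1: "C1 \<ge> 0" and
    saddle: "\<And>n X l. (n::nat) > 0 \<Longrightarrow> X \<noteq> 0 \<Longrightarrow> norm X < \<eta>1 \<Longrightarrow> norm (l - 1) < \<eta>1 \<Longrightarrow> l\<^sup>2 * ((2 - X) / (1 - X)) = 2 \<Longrightarrow>
    norm (saddle_int a n X l - sqrt (pi / n))
      \<le> C1 * sqrt (pi / n) / n"
    using saddle_integral[of a] by (elim exE conjE) (rule that, assumption+, blast)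
  obtain \<delta> where \<delta>: "\<delta> > 0" "\<delta> < 1 / 2" and
    bound: "\<And>n z \<theta>. z \<noteq> 0 \<Longrightarrow> norm z < \<delta> \<Longrightarrow> norm \<theta> < \<delta> \<or> norm (\<theta> - of_real pi) < \<delta> \<Longrightarrow>
     norm (coeff_integrand a n z \<theta>) \<le> exp \<bar>a\<bar>"
    using coeff_integrand_bound[of a] by blast
  \<comment> \<open>End points of the segments miss 0 or \<open>pi\<close> by less than
    \<open>\<eta> + 2 * \<eta>\<close>, so a quarter of \<open>\<delta>\<close> suffices. The bound
    1/32 keeps the path in the strip of half width 1/2.\<close>
  define \<eta> where "\<eta> = min (min \<eta>1 \<delta>) (1 / 8) / 4"
  have \<eta>: "\<eta> > 0" "\<eta> \<le> \<eta>1" "4 * \<eta> \<le> \<delta>" "\<eta> \<le> 1 / 32" using \<eta>1 \<delta> by (auto simp: \<eta>_def)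
  obtain \<epsilon>1 where \<epsilon>1: "\<epsilon>1 > 0" and
    par: "\<And>z. norm z < \<epsilon>1 \<Longrightarrow> saddle_parameters \<eta> z"
    using saddle_parameters_near_0[OF \<eta>(1)] by blast
  define \<epsilon> where "\<epsilon> = min \<epsilon>1 \<delta>"
  define C where "C = 2 * C1 + 32 * exp \<bar>a\<bar>"
  have C: "C \<ge> 0" using C1 by (simp add: C_def)
  have \<epsilon>: "\<epsilon> > 0" using \<epsilon>1 \<delta> by (simp add: \<epsilon>_def)
  have main: "max (norm (main_term a n z)) (norm (conj_term a n z)) \<ge> 1 / 2 \<and>
    norm (of_real (sqrt (2 * pi * n) * exp (- real n / 2)) * ((deriv ^^ n) (gen_fun a n z) 0 / fact n)
      - (main_term a n z + conj_term a n z))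
    \<le> C / n * max (norm (main_term a n z)) (norm (conj_term a n z))"
    if n: "n > 0" and imz: "Im z > 0" and nz: "norm z < \<epsilon>" for n z
  proof -
    define U where "U = joukowski_inv z"
    define q where "q = quartic_root_factor z"
    define L where "L = Ln U"
    \<comment> \<open>The steepest descent directions in the angle plane at \<open>- b\<close> and
      \<open>b\<close>; their normalisation is checked in \<open>s1\<close> and
      \<open>s2\<close>.\<close>
    define l1 where "l1 = sqrt 2 * q * exp (\<i> * pi / 4 - L / 2)"
    define l2 where "l2 = sqrt 2 * q * exp (- \<i> * pi / 4 + L / 2)"
    define T1 where "T1 = main_term a n z"
    define T2 where "T2 = conj_term a n z"
    define m where "m = max (norm T1) (norm T2)"
    define c where "c = (deriv ^^ n) (gen_fun a n z) 0 / fact n"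
    have z: "z \<noteq> 0" "norm z < 1 / 2" "norm z < \<epsilon>1" "norm z < \<delta>" using imz nz \<delta> by (auto simp: \<epsilon>_def)
    have U: "U = varphi (z / 2)" unfolding U_def using varphi_eq_joukowski_inv[OF imz] by simp
    have U1: "U + 1 / U = z" "U \<noteq> 0" unfolding U_def by (rule joukowski_inv_sum)+
    have par': "q\<^sup>2 * (U - 1 / U) = \<i>" "norm q ^ 2 > 1 / 4" "norm (z * U) < \<eta>" "norm (z * (1 / U)) < \<eta>"
      "norm (- \<i> * L - pi / 2) < \<eta>" "norm (l1 - 1) < \<eta>" "norm (l2 - 1) < \<eta>"
      using par[OF z(3)] unfolding saddle_parameters_def U_def[symmetric] q_def[symmetric] L_def[symmetric] l1_def[symmetric] l2_def[symmetric]
      by auto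
    have eL: "exp L = U" "exp (- L) = 1 / U" using U1(2) by (auto simp: L_def exp_minus divide_inverse)
    have "norm T1 * norm T2 = norm q ^ 2"
      using main_term_mult_conj_term[OF imz, of a n] unfolding T1_def T2_def q_def
      by (metis norm_mult norm_power)
    then have "1 / 4 < norm T1 * norm T2" using par'(2) by simp
    also have "\<dots> \<le> m * m" unfolding m_def by (intro mult_mono) (auto simp: le_max_iff_disj)
    finally have m: "m \<ge> 1 / 2"
    proof -
      assume *: "1 / 4 < m * m"
      have "m \<ge> 0" unfolding m_def by (rule max.coboundedI1) simp
      show ?thesis
      proof (rule ccontr)
        assume "\<not> m \<ge> 1 / 2"
        then have "m * m \<le> 1 / 2 * (1 / 2)" using \<open>m \<ge> 0\<close> by (intro mult_mono) auto
        then show False using * by simp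
      qed
    qed
    have ei: "exp (\<i> * of_real (pi / 2)) = \<i>" by (simp only: cis_conv_exp[symmetric] cis_pi_half)
    have l1sq: "l1\<^sup>2 = 2 * q\<^sup>2 * (\<i> / U)"
    proof -
      have "(exp (\<i> * pi / 4 - L / 2))\<^sup>2 = exp (\<i> * of_real (pi / 2) - L)"
        unfolding power2_eq_square exp_add[symmetric] by (rule arg_cong[where f = exp]) (simp add: field_simps)
      also have "\<dots> = \<i> / U" unfolding exp_diff eL(1) ei ..
      finally show ?thesis unfolding l1_def power_mult_distrib by (simp flip: of_real_power)
    qed
    have l2sq: "l2\<^sup>2 = 2 * q\<^sup>2 * (- \<i> * U)"
    proof -
      have "(exp (- \<i> * pi / 4 + L / 2))\<^sup>2 = exp (L - \<i> * of_real (pi / 2))"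
        unfolding power2_eq_square exp_add[symmetric] by (rule arg_cong[where f = exp]) (simp add: field_simps)
      also have "\<dots> = U / \<i>" unfolding exp_diff eL(1) ei ..
      finally show ?thesis unfolding l2_def power_mult_distrib by (simp flip: of_real_power)
    qed
    have s1: "l1\<^sup>2 * ((2 - z * (1 / U)) / (1 - z * (1 / U))) = 2"
    proof -
      have f: "(2 - z * (1 / U)) / (1 - z * (1 / U)) = 1 - U\<^sup>2"
        using U1(2) by (subst (1 2) U1(1)[symmetric]) (simp add: field_simps power2_eq_square)
      have "l1\<^sup>2 * ((2 - z * (1 / U)) / (1 - z * (1 / U))) = - 2 * \<i> * (q\<^sup>2 * (U - 1 / U))"
        unfolding f unfolding l1sq using U1(2) by (simp add: field_simps power2_eq_square)
      then show ?thesis unfolding par'(1) by (simp add: mult.assoc)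
    qed
    have s2: "l2\<^sup>2 * ((2 - z * U) / (1 - z * U)) = 2"
    proof -
      have f: "(2 - z * U) / (1 - z * U) = 1 - 1 / U\<^sup>2"
        using U1(2) by (subst (1 2) U1(1)[symmetric]) (simp add: field_simps power2_eq_square)
      have "l2\<^sup>2 * ((2 - z * U) / (1 - z * U)) = - 2 * \<i> * (q\<^sup>2 * (U - 1 / U))"
        unfolding f unfolding l2sq using U1(2) by (simp add: field_simps power2_eq_square)
      then show ?thesis unfolding par'(1) by (simp add: mult.assoc)
    qed
    define I1 where "I1 = saddle_int a n (z * (1 / U)) l1"
    define I2 where "I2 = saddle_int a n (z * U) l2"
    define s where "s = sqrt (pi / n)"
    have s: "s > 0" using n by (simp add: s_def)
    have I: "norm (I1 - s) \<le> C1 * s / n" "norm (I2 - s) \<le> C1 * s / n"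
      unfolding I1_def I2_def s_def using n z(1) U1(2) par' s1 s2 \<eta>(2)
      by (intro saddle; simp)+
    obtain \<Phi> where \<Phi>: "\<And>\<theta>. \<bar>Im \<theta>\<bar> < 1 / 2 \<Longrightarrow> (\<Phi> has_field_derivative coeff_integrand a n z \<theta>) (at \<theta>)"
      and period: "\<And>\<theta> :: complex. \<bar>Im \<theta>\<bar> < 1 / 2 \<Longrightarrow> \<Phi> (\<theta> + 2 * pi) - \<Phi> \<theta> = 2 * pi * c"
      using coeff_integrand_primitive[OF z(1,2), of a n] unfolding c_def by blast
    define b where "b = - \<i> * L"
    have b: "norm (b - pi / 2) < \<eta>" using par'(5) by (simp add: b_def)
    have imb: "\<bar>Im b\<bar> \<le> 1 / 32" using b \<eta>(4) abs_Im_le_cmod[of "b - pi / 2"] by simp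
    have pi: "pi / 2 \<le> 2" using pi_less_4 by simp
    have iml: "\<bar>Im (l * of_real t)\<bar> \<le> 1 / 16" if "norm (l - 1) < \<eta>" "\<bar>t\<bar> \<le> pi / 2" for l t
    proof -
      have "\<bar>Im l\<bar> \<le> 1 / 32" using that \<eta>(4) abs_Im_le_cmod[of "l - 1"] by simp
      then have "\<bar>Im l\<bar> * \<bar>t\<bar> \<le> 1 / 32 * 2" using that pi by (intro mult_mono) auto
      then show ?thesis by (simp add: abs_mult)
    qed
    have strip: "\<bar>Im (- b + l * of_real t)\<bar> < 1 / 2" "\<bar>Im (b + l * of_real t)\<bar> < 1 / 2"
      if "norm (l - 1) < \<eta>" "\<bar>t\<bar> \<le> pi / 2" for l t
      using iml[OF that] imb unfolding plus_complex.sel uminus_complex.sel by linarith+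
    \<comment> \<open>The contour runs through both saddles \<open>- b\<close> and \<open>b\<close>; the end points near \<open>0\<close> and near \<open>pi\<close> are joined by
      segments on which the integrand is bounded.\<close>
    have D1: "\<Phi> (- b + l1 * of_real (pi / 2)) - \<Phi> (- b - l1 * of_real (pi / 2)) = of_real (sqrt 2 * exp (real n / 2)) * T1 * I1"
    proof -
      have "\<Phi> (- b + l1 * of_real (pi / 2)) - \<Phi> (- b - l1 * of_real (pi / 2)) =
          l1 * integral {-(pi/2)..pi/2} (\<lambda>t. coeff_integrand a n z (- b + l1 * of_real t))"
        by (rule primitive_segment_integral) (use strip[OF par'(6)] \<Phi> in auto)
      also have "(\<lambda>t. coeff_integrand a n z (- b + l1 * of_real t)) = (\<lambda>t. saddle_value a n z (1 / U) (- L) *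
          (exp (n * saddle_phase (z * (1 / U)) (l1 * of_real t)) * saddle_amp a (z * (1 / U)) (l1 * of_real t)))"
      proof
        fix t
        have V: "1 / U + 1 / (1 / U) = z" "1 / U \<noteq> 0" using U1 by (auto simp: add.commute)
        have "- b = - \<i> * (- L)" by (simp add: b_def)
        then show "coeff_integrand a n z (- b + l1 * of_real t) = saddle_value a n z (1 / U) (- L) *
          (exp (n * saddle_phase (z * (1 / U)) (l1 * of_real t)) * saddle_amp a (z * (1 / U)) (l1 * of_real t))"
          using coeff_integrand_saddle[OF V z(1) eL(2), of a n "l1 * of_real t"] by simp
      qed
      also have "l1 * integral {-(pi/2)..pi/2} \<dots> = l1 * saddle_value a n z (1 / U) (- L) * I1"
        unfolding I1_def saddle_int_def integral_mult_right by (simp only: mult.assoc)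
      also have "l1 * saddle_value a n z (1 / U) (- L) = of_real (sqrt 2 * exp (real n / 2)) * T1"
        unfolding l1_def T1_def L_def by (rule saddle_terms_eq(1)[OF imz U q_def])
      finally show ?thesis .
    qed
    have D2: "\<Phi> (b + l2 * of_real (pi / 2)) - \<Phi> (b - l2 * of_real (pi / 2)) = of_real (sqrt 2 * exp (real n / 2)) * T2 * I2"
    proof -
      have "\<Phi> (b + l2 * of_real (pi / 2)) - \<Phi> (b - l2 * of_real (pi / 2)) =
          l2 * integral {-(pi/2)..pi/2} (\<lambda>t. coeff_integrand a n z (b + l2 * of_real t))"
        by (rule primitive_segment_integral) (use strip[OF par'(7)] \<Phi> in auto)
      also have "(\<lambda>t. coeff_integrand a n z (b + l2 * of_real t)) = (\<lambda>t. saddle_value a n z U L *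
          (exp (n * saddle_phase (z * U) (l2 * of_real t)) * saddle_amp a (z * U) (l2 * of_real t)))"
        unfolding b_def by (rule ext) (rule coeff_integrand_saddle[OF U1 z(1) eL(1)])
      also have "l2 * integral {-(pi/2)..pi/2} \<dots> = l2 * saddle_value a n z U L * I2"
        unfolding I2_def saddle_int_def integral_mult_right by (simp only: mult.assoc)
      also have "l2 * saddle_value a n z U L = of_real (sqrt 2 * exp (real n / 2)) * T2"
        unfolding l2_def T2_def L_def by (rule saddle_terms_eq(2)[OF imz U q_def])
      finally show ?thesis .
    qed
    have short: "norm (\<Phi> x - \<Phi> y) \<le> exp \<bar>a\<bar>"
      if "norm (x - p) < \<delta>" "norm (y - p) < \<delta>" "p = 0 \<or> p = of_real pi" for x y p
    proof -
      have "norm (\<Phi> x - \<Phi> y) \<le> exp \<bar>a\<bar> * norm (x - y)"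
      proof (rule field_differentiable_bound[of "ball p \<delta>"])
        fix w assume "w \<in> ball p \<delta>"
        then have w: "norm (w - p) < \<delta>" by (simp add: dist_norm norm_minus_commute)
        have "Im p = 0" using that(3) by auto
        then have "\<bar>Im w\<bar> < 1 / 2" using w \<delta>(2) abs_Im_le_cmod[of "w - p"] by simp
        then show "(\<Phi> has_field_derivative coeff_integrand a n z w) (at w within ball p \<delta>)"
          by (rule has_field_derivative_at_within[OF \<Phi>])
        show "norm (coeff_integrand a n z w) \<le> exp \<bar>a\<bar>"
        proof (rule bound[OF z(1,4)])
          show "norm w < \<delta> \<or> norm (w - of_real pi) < \<delta>"
            using that(3) w by (elim disjE) simp_all
        qed
      next
        show "x \<in> ball p \<delta>" "y \<in> ball p \<delta>"
          using that(1,2) by (simp_all add: dist_norm norm_minus_commute)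
      qed (rule convex_ball)
      moreover have "norm (x - y) \<le> 1"
        using norm_triangle_ineq4[of "x - p" "y - p"] that(1,2) \<delta>(2) by simp
      then have "exp \<bar>a\<bar> * norm (x - y) \<le> exp \<bar>a\<bar> * 1" by (intro mult_left_mono) auto
      ultimately show ?thesis by linarith
    qed
    \<comment> \<open>With the four choices of signs for \<open>e1\<close> and \<open>e2\<close>
      this expression is the offset of a segment end point from 0 or \<open>pi\<close>.\<close>
    have near: "norm (e1 * (b - of_real (pi / 2)) + e2 * ((l - 1) * of_real (pi / 2))) < \<delta>"
      if "norm (l - 1) < \<eta>" "norm e1 = 1" "norm e2 = 1" for l e1 e2 :: complex
    proof -
      have "norm (e1 * (b - of_real (pi / 2)) + e2 * ((l - 1) * of_real (pi / 2))) \<le> norm (b - of_real (pi / 2)) + norm (l - 1) * (pi / 2)"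
        by (rule norm_triangle_le) (simp add: norm_mult that)
      also have "norm (l - 1) * (pi / 2) \<le> norm (l - 1) * 2" using pi by (intro mult_left_mono) auto
      finally show ?thesis using b that(1) \<eta>(1,3) by simp
    qed
    have near0: "norm w < \<delta>"
      if "w = e1 * (b - of_real (pi / 2)) + e2 * ((l - 1) * of_real (pi / 2))" "norm (l - 1) < \<eta>" "norm e1 = 1" "norm e2 = 1"
      for w l e1 e2 :: complex
      unfolding that(1) by (rule near[OF that(2-4)])
    have S1: "norm (\<Phi> (b - l2 * of_real (pi / 2)) - \<Phi> (- b + l1 * of_real (pi / 2))) \<le> exp \<bar>a\<bar>"
    proof (rule short[where p = 0])
      show "norm (b - l2 * of_real (pi / 2) - 0) < \<delta>"
        by (rule near0[OF _ par'(7), where ?e1.0 = 1 and ?e2.0 = "-1"]) (simp_all add: field_simps)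
      show "norm (- b + l1 * of_real (pi / 2) - 0) < \<delta>"
        by (rule near0[OF _ par'(6), where ?e1.0 = "-1" and ?e2.0 = 1]) (simp_all add: field_simps)
    qed simp
    have S2: "norm (\<Phi> (- b - l1 * of_real (pi / 2) + 2 * pi) - \<Phi> (b + l2 * of_real (pi / 2))) \<le> exp \<bar>a\<bar>"
    proof (rule short[where p = "of_real pi"])
      show "norm (- b - l1 * of_real (pi / 2) + 2 * pi - of_real pi) < \<delta>"
        by (rule near0[OF _ par'(6), where ?e1.0 = "-1" and ?e2.0 = "-1"]) (simp_all add: field_simps)
      show "norm (b + l2 * of_real (pi / 2) - of_real pi) < \<delta>"
        by (rule near0[OF _ par'(7), where ?e1.0 = 1 and ?e2.0 = 1]) (simp_all add: field_simps)
    qed simp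
    define Err where "Err = (\<Phi> (b - l2 * of_real (pi / 2)) - \<Phi> (- b + l1 * of_real (pi / 2))) +
       (\<Phi> (- b - l1 * of_real (pi / 2) + 2 * pi) - \<Phi> (b + l2 * of_real (pi / 2)))"
    have Err: "norm Err \<le> 2 * exp \<bar>a\<bar>" unfolding Err_def by (rule norm_triangle_le) (use S1 S2 in linarith)
    have "\<bar>Im (- b - l1 * of_real (pi / 2))\<bar> < 1 / 2" using strip(1)[OF par'(6), of "- (pi / 2)"] by simp
    \<comment> \<open>The differences telescope from the start of the first segment to its translate
      by \<open>2 * pi\<close>.\<close>
    from period[OF this]
    have tot: "2 * pi * c = of_real (sqrt 2 * exp (real n / 2)) * T1 * I1 + of_real (sqrt 2 * exp (real n / 2)) * T2 * I2 + Err"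
      unfolding D1[symmetric] D2[symmetric] Err_def by simp
    \<comment> \<open>With this scaling the common factor becomes \<open>2 * pi / s\<close>. Each
      saddle integral is close to \<open>s\<close>, so after division by \<open>2 * pi\<close> the
      terms appear with coefficient close to 1.\<close>
    define k where "k = sqrt (2 * pi * n) * exp (- real n / 2)"
    have k: "k * (sqrt 2 * exp (n / 2)) = 2 * pi / s"
    proof -
      have "k * (sqrt 2 * exp (n / 2)) = sqrt (2 * pi * n) * sqrt 2 * (exp (- real n / 2) * exp (n / 2))"
        by (simp add: k_def)
      also have "exp (- real n / 2) * exp (n / 2) = 1" by (simp add: exp_minus)
      also have "sqrt (2 * pi * n) * sqrt 2 * 1 = 2 * (sqrt pi * sqrt n)" by (simp add: real_sqrt_mult)
      also have "\<dots> = 2 * pi / s"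
      proof -
        have "2 * pi / s = 2 * (pi / sqrt pi) * sqrt n" by (simp add: s_def real_sqrt_divide)
        then show ?thesis by (simp add: real_div_sqrt)
      qed
      finally show ?thesis .
    qed
    have "of_real k * c = of_real k * (2 * pi * c) / (2 * pi)" by simp
    also have "\<dots> = (of_real (k * (sqrt 2 * exp (n / 2))) * (T1 * I1 + T2 * I2) + of_real k * Err) / (2 * pi)"
      unfolding tot by (simp add: algebra_simps)
    also have "\<dots> = (T1 * I1 + T2 * I2) / s + of_real k * Err / (2 * pi)"
      unfolding k using s by (simp add: field_simps)
    finally have kc: "of_real k * c = (T1 * I1 + T2 * I2) / s + of_real k * Err / (2 * pi)" .
    have "of_real k * c - (T1 + T2) = T1 * ((I1 - s) / s) + T2 * ((I2 - s) / s) + of_real k * Err / (2 * pi)"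
      unfolding kc using s by (simp add: diff_divide_distrib add_divide_distrib right_diff_distrib)
    also have "norm \<dots> \<le> m * (C1 / n) + m * (C1 / n) + 32 * exp \<bar>a\<bar> / n * m"
    proof (intro norm_triangle_le add_mono)
      have *: "norm ((I1 - s) / s) \<le> C1 / n" "norm ((I2 - s) / s) \<le> C1 / n"
        using I s by (auto simp: norm_divide divide_simps mult_ac)
      show "norm (T1 * ((I1 - s) / s)) \<le> m * (C1 / n)" "norm (T2 * ((I2 - s) / s)) \<le> m * (C1 / n)"
      proof -
        have mm: "norm T1 \<le> m" "norm T2 \<le> m" "0 \<le> m" using m by (auto simp: m_def)
        show "norm (T1 * ((I1 - s) / s)) \<le> m * (C1 / n)" unfolding norm_mult
          by (rule mult_mono[OF mm(1) *(1) mm(3) norm_ge_zero])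
        show "norm (T2 * ((I2 - s) / s)) \<le> m * (C1 / n)" unfolding norm_mult
          by (rule mult_mono[OF mm(2) *(2) mm(3) norm_ge_zero])
      qed
      have "sqrt (2 * pi) \<le> 2 * pi" using pi_gt3 by (intro real_le_lsqrt) (auto simp: power2_eq_square)
      then have p1: "sqrt (2 * pi) / (2 * pi) \<le> 1" by simp
      have "norm (of_real k * Err / (2 * pi)) = k * norm Err / (2 * pi)"
        by (simp add: norm_mult norm_divide k_def)
      also have "\<dots> = (sqrt n * exp (- real n / 2)) * (sqrt (2 * pi) / (2 * pi)) * norm Err"
        by (simp add: k_def real_sqrt_mult)
      also have "\<dots> \<le> (8 / n) * 1 * (2 * exp \<bar>a\<bar>)"
        using Err sqrt_times_exp_bound[OF n] p1 by (intro mult_mono) auto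
      \<comment> \<open>The absolute error becomes relative to the larger term through
        \<open>m \<ge> 1 / 2\<close>.\<close>
      also have "\<dots> = 32 * exp \<bar>a\<bar> / n * (1 / 2)" by simp
      also have "\<dots> \<le> 32 * exp \<bar>a\<bar> / n * m" using m by (intro mult_left_mono) auto
      finally show "norm (of_real k * Err / (2 * pi)) \<le> 32 * exp \<bar>a\<bar> / n * m" .
    qed
    also have "\<dots> = C / n * m" by (simp add: C_def add_divide_distrib algebra_simps)
    finally show ?thesis using m by (simp add: m_def T1_def T2_def k_def c_def)
  qed
  show ?thesis
    by (rule exI[of _ \<epsilon>], rule conjI[OF \<epsilon>], rule exI[of _ C], rule conjI[OF C]) (use main in blast)
qed

section \<open>The expansion\<close>

lemma tc_expansion_eq:
  "tc_expansion a n z e1 e2 =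
     of_real (Gamma a / sqrt (2 * pi) * real n powr (1/2 - real n / 2 - a) * exp (real n / 2)) *
     (main_term a n z * (1 + e1) + conj_term a n z * (1 + e2))"
  unfolding tc_expansion_def main_term_def conj_term_def quartic_root_factor_def by (simp only: distrib_left mult.assoc)

text \<open>Inverting \<open>tc_gamma\<close> leaves the prefactor of the expansion times a Gamma
  ratio that tends to 1; the exponents of \<open>n\<close>, including those from
  \<open>sqrt (2 * pi * n)\<close> and the rescaled coefficient, add up to 0.\<close>

lemma tc_monic_eq_coeff:
  assumes "a > 0" "z \<noteq> 0" "n > 0"
  shows "poly (map_poly complex_of_real (tc_monic a n)) (of_real (real n powr (-1/2)) * z) =
    of_real (Gamma a / sqrt (2 * pi) * real n powr (1/2 - real n / 2 - a) * exp (real n / 2)) *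
    (of_real (Gamma (real n + 1) / Gamma (real n + a) * real n powr (a - 1)) *
     (of_real (sqrt (2 * pi * n) * exp (- real n / 2)) * ((deriv ^^ n) (gen_fun a n z) 0 / fact n)))"
proof -
  define t where "t = tc_eval a n (of_real (real n powr (-1/2)) * z)"
  have n: "real n > 0" using assms by simp
  have G: "Gamma a > 0" "Gamma (real n + a) > 0" "Gamma (real n + 1) > 0"
    using assms by (auto intro!: Gamma_real_pos)
  have "poly (map_poly complex_of_real (tc_monic a n)) (of_real (real n powr (-1/2)) * z) = of_real (1 / tc_gamma a n) * t"
    unfolding t_def by (rule tc_monic_eval[OF assms(1)])
  moreover have "1 / tc_gamma a n = (Gamma a / sqrt (2 * pi) * real n powr (1/2 - real n / 2 - a) * exp (real n / 2)) *
     ((Gamma (real n + 1) / Gamma (real n + a) * real n powr (a - 1)) * ((sqrt (2 * pi * n) * exp (- real n / 2)) * real n powr (n / 2)))"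
  proof -
    have "real n powr (1/2 - real n / 2 - a) * real n powr (a - 1) * sqrt (real n) * real n powr (n / 2) =
       real n powr (1/2 - real n / 2 - a + (a - 1) + 1/2 + n / 2)"
      by (simp only: powr_add powr_half_sqrt of_nat_0_le_iff)
    also have "1/2 - real n / 2 - a + (a - 1) + 1/2 + n / 2 = 0" by simp
    finally have p: "real n powr (1/2 - real n / 2 - a) * real n powr (a - 1) * sqrt (real n) * real n powr (n / 2) = 1"
      using n by simp
    have e: "exp (real n / 2) * exp (- real n / 2) = 1" by (simp add: exp_minus)
    have "(Gamma a / sqrt (2 * pi) * real n powr (1/2 - real n / 2 - a) * exp (real n / 2)) *
     ((Gamma (real n + 1) / Gamma (real n + a) * real n powr (a - 1)) * ((sqrt (2 * pi * n) * exp (- real n / 2)) * real n powr (n / 2)))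
     = Gamma a * Gamma (real n + 1) / Gamma (real n + a) * (sqrt (2 * pi) / sqrt (2 * pi)) * (exp (real n / 2) * exp (- real n / 2)) *
       (real n powr (1/2 - real n / 2 - a) * real n powr (a - 1) * sqrt (real n) * real n powr (n / 2))"
      by (simp only: real_sqrt_mult) (simp only: times_divide_eq_right times_divide_eq_left divide_divide_eq_left mult_ac)
    also have "\<dots> = Gamma a * Gamma (real n + 1) / Gamma (real n + a)"
      unfolding p e by simp
    finally show ?thesis by (simp add: tc_gamma_def)
  qed
  moreover have "(deriv ^^ n) (gen_fun a n z) 0 / fact n = of_real (real n powr (n / 2)) * t"
    unfolding t_def by (rule gen_fun_coeff[OF assms(2,3)])
  ultimately show ?thesis by (simp only: of_real_mult mult.assoc)
qed

lemma tc_monic_expansion_upper: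
  fixes a :: real
  assumes "a > 0"
  shows "\<exists>\<epsilon>>0. \<exists>C\<ge>0. \<forall>n>0. \<forall>z. Im z > 0 \<and> norm z < \<epsilon> \<longrightarrow>
    (\<exists>e1 e2. norm e1 \<le> C / real n \<and> norm e2 \<le> C / real n \<and>
      poly (map_poly complex_of_real (tc_monic a n)) (of_real (real n powr (-1/2)) * z) = tc_expansion a n z e1 e2)"
proof -
  obtain G where G: "G \<ge> 0" "\<And>x. x \<ge> 1 \<Longrightarrow> \<bar>Gamma (x + 1) / Gamma (x + a) * x powr (a - 1) - 1\<bar> \<le> G / x"
    using Gamma_ratio_asymp[OF assms] by blast
  obtain \<epsilon> C where \<epsilon>: "\<epsilon> > 0" and C: "C \<ge> 0" and asym: "\<And>n z. n > 0 \<Longrightarrow> Im z > 0 \<Longrightarrow> norm z < \<epsilon> \<Longrightarrow>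
    max (norm (main_term a n z)) (norm (conj_term a n z)) \<ge> 1 / 2 \<and>
    norm (of_real (sqrt (2 * pi * n) * exp (- real n / 2)) * ((deriv ^^ n) (gen_fun a n z) 0 / fact n)
      - (main_term a n z + conj_term a n z))
    \<le> C / n * max (norm (main_term a n z)) (norm (conj_term a n z))"
    using coeff_asymptotics[of a] by (elim exE conjE) (rule that, assumption+, blast)
  \<comment> \<open>The first part is the saddle error enlarged by the Gamma ratio. The second is
    the deviation of that ratio from 1, acting on a sum of modulus at most twice the larger
    term.\<close>
  define C' where "C' = (1 + G) * C + 2 * G"
  have C': "C' \<ge> 0" using G C by (simp add: C'_def)
  have main: "\<exists>e1 e2. norm e1 \<le> C' / real n \<and> norm e2 \<le> C' / real n \<and>
      poly (map_poly complex_of_real (tc_monic a n)) (of_real (real n powr (-1/2)) * z) = tc_expansion a n z e1 e2"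
    if n: "n > 0" and z: "Im z > 0" "norm z < \<epsilon>" for n z
  proof -
    define T1 where "T1 = main_term a n z"
    define T2 where "T2 = conj_term a n z"
    define m where "m = max (norm T1) (norm T2)"
    define R where "R = of_real (sqrt (2 * pi * n) * exp (- real n / 2)) * ((deriv ^^ n) (gen_fun a n z) 0 / fact n)"
    define \<rho> where "\<rho> = Gamma (real n + 1) / Gamma (real n + a) * real n powr (a - 1)"
    have n1: "real n \<ge> 1" using n by simp
    have m: "m \<ge> 1 / 2" and R: "norm (R - (T1 + T2)) \<le> C / n * m"
      using asym[OF n z] unfolding m_def T1_def T2_def R_def by auto
    have r: "\<bar>\<rho> - 1\<bar> \<le> G / n" unfolding \<rho>_def using G(2)[OF n1] .
    have "G / n \<le> G / 1" using G(1) n1 by (intro divide_left_mono) auto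
    then have r': "\<bar>\<rho>\<bar> \<le> 1 + G" using r by linarith
    define D where "D = of_real \<rho> * R - (T1 + T2)"
    have "D = of_real \<rho> * (R - (T1 + T2)) + of_real (\<rho> - 1) * (T1 + T2)"
      by (simp add: D_def algebra_simps)
    also have "norm \<dots> \<le> (1 + G) * (C / n * m) + G / n * (2 * m)"
    proof (intro norm_triangle_le add_mono)
      show "norm (of_real \<rho> * (R - (T1 + T2))) \<le> (1 + G) * (C / n * m)"
        unfolding norm_mult norm_of_real using r' R G by (intro mult_mono) auto
      have "norm (T1 + T2) \<le> 2 * m" unfolding m_def using norm_triangle_ineq[of T1 T2] by linarith
      then show "norm (of_real (\<rho> - 1) * (T1 + T2)) \<le> G / n * (2 * m)"
        unfolding norm_mult norm_of_real using r G by (intro mult_mono) auto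
    qed
    also have "\<dots> = C' / n * m" by (simp add: C'_def add_divide_distrib algebra_simps)
    finally have "norm D \<le> C' / n * max (norm T1) (norm T2)" by (simp only: m_def)
    moreover have "max (norm T1) (norm T2) > 0" using m by (simp only: m_def)
    ultimately obtain e1 e2 where e: "norm e1 \<le> C' / n" "norm e2 \<le> C' / n" "T1 + T2 + D = T1 * (1 + e1) + T2 * (1 + e2)"
      using split_error by blast
    have "z \<noteq> 0" using z by auto
    have "poly (map_poly complex_of_real (tc_monic a n)) (of_real (real n powr (-1/2)) * z) = tc_expansion a n z e1 e2"
      unfolding tc_monic_eq_coeff[OF assms \<open>z \<noteq> 0\<close> n] tc_expansion_eq R_def[symmetric] \<rho>_def[symmetric] T1_def[symmetric] T2_def[symmetric] e(3)[symmetric]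
      by (simp add: D_def)
    with e show ?thesis by blast
  qed
  show ?thesis
    by (rule exI[of _ \<epsilon>], rule conjI[OF \<epsilon>], rule exI[of _ C'], rule conjI[OF C']) (use main in blast)
qed

theorem theorem2p2:
  fixes \<alpha> :: real
  assumes "\<alpha> > 0"
  shows "\<exists>\<epsilon>\<^sub>0>0. \<forall>\<epsilon>. 0 < \<epsilon> \<and> \<epsilon> < \<epsilon>\<^sub>0 \<longrightarrow>
    (\<exists>(E\<^sub>1 :: nat \<Rightarrow> complex \<Rightarrow> complex) (E\<^sub>2 :: nat \<Rightarrow> complex \<Rightarrow> complex) (C :: real).
      \<forall>\<^sub>F n in sequentially.
        (\<forall>z \<in> ball 0 \<epsilon>. Im z > 0 \<longrightarrow>
           norm (E\<^sub>1 n z) \<le> C / real n \<and> norm (E\<^sub>2 n z) \<le> C / real n \<and>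
           poly (map_poly complex_of_real (tc_monic \<alpha> n)) (of_real (real n powr (-1/2)) * z) =
             tc_expansion \<alpha> n z (E\<^sub>1 n z) (E\<^sub>2 n z)) \<and>
        (\<forall>z \<in> ball 0 \<epsilon>. Im z < 0 \<longrightarrow>
           poly (map_poly complex_of_real (tc_monic \<alpha> n)) (of_real (real n powr (-1/2)) * z) =
             cnj (tc_expansion \<alpha> n (cnj z) (E\<^sub>1 n (cnj z)) (E\<^sub>2 n (cnj z)))))"
proof -
  define P where "P = (\<lambda>n z. poly (map_poly complex_of_real (tc_monic \<alpha> n)) (of_real (real n powr (-1/2)) * z))"
  \<comment> \<open>Both errors are chosen as one pair, because the expansion couples them. The
    constant depends on neither \<open>n\<close> nor \<open>z\<close>, so the choice keeps the bound
    uniform, and it serves every radius below \<open>\<epsilon>\<^sub>0\<close>.\<close>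
  define good where "good = (\<lambda>C n z (e :: complex \<times> complex). norm (fst e) \<le> C / real n \<and> norm (snd e) \<le> C / real n \<and>
    P n z = tc_expansion \<alpha> n z (fst e) (snd e))"
  have "\<exists>\<epsilon>>0. \<exists>C\<ge>0. \<forall>n>0. \<forall>z. Im z > 0 \<and> norm z < \<epsilon> \<longrightarrow> (\<exists>e1 e2. good C n z (e1, e2))"
    unfolding good_def P_def fst_conv snd_conv by (rule tc_monic_expansion_upper[OF assms])
  then obtain \<epsilon>\<^sub>0 C where \<epsilon>\<^sub>0: "\<epsilon>\<^sub>0 > 0" and ex: "\<And>n z. n > 0 \<Longrightarrow> Im z > 0 \<Longrightarrow> norm z < \<epsilon>\<^sub>0 \<Longrightarrow>
    \<exists>e1 e2. good C n z (e1, e2)"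
    by blast
  define E\<^sub>1 where "E\<^sub>1 = (\<lambda>n z. fst (SOME e. good C n z e))"
  define E\<^sub>2 where "E\<^sub>2 = (\<lambda>n z. snd (SOME e. good C n z e))"
  have E: "norm (E\<^sub>1 n z) \<le> C / real n \<and> norm (E\<^sub>2 n z) \<le> C / real n \<and> P n z = tc_expansion \<alpha> n z (E\<^sub>1 n z) (E\<^sub>2 n z)"
    if n: "n > 0" "Im z > 0" "norm z < \<epsilon>\<^sub>0" for n z
  proof -
    obtain e1 e2 where "good C n z (e1, e2)" using ex[OF n] by blast
    then have "good C n z (SOME e. good C n z e)" by (rule someI)
    then show ?thesis unfolding E\<^sub>1_def E\<^sub>2_def good_def .
  qed
  \<comment> \<open>The coefficients and the scaling factor are real, so conjugating the argument
    conjugates the value; this carries the expansion to the lower half plane.\<close>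
  have cnj_P: "P n z = cnj (P n (cnj z))" for n z
  proof -
    have "map_poly cnj (map_poly complex_of_real p) = map_poly complex_of_real p" for p
      by (simp add: poly_eq_iff coeff_map_poly)
    then show ?thesis by (simp add: P_def poly_cnj)
  qed
  show ?thesis
  proof (rule exI[of _ \<epsilon>\<^sub>0], intro conjI allI impI \<epsilon>\<^sub>0)
    fix \<epsilon> assume \<epsilon>: "0 < \<epsilon> \<and> \<epsilon> < \<epsilon>\<^sub>0"
    have "(\<forall>z \<in> ball 0 \<epsilon>. Im z > 0 \<longrightarrow>
           norm (E\<^sub>1 n z) \<le> C / real n \<and> norm (E\<^sub>2 n z) \<le> C / real n \<and> P n z = tc_expansion \<alpha> n z (E\<^sub>1 n z) (E\<^sub>2 n z)) \<and>
        (\<forall>z \<in> ball 0 \<epsilon>. Im z < 0 \<longrightarrow> P n z = cnj (tc_expansion \<alpha> n (cnj z) (E\<^sub>1 n (cnj z)) (E\<^sub>2 n (cnj z))))"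
      if "n > 0" for n
    proof (intro conjI ballI impI)
      fix z :: complex assume z: "z \<in> ball 0 \<epsilon>" "Im z > 0"
      then have "norm z < \<epsilon>\<^sub>0" using \<epsilon> by simp
      then show "norm (E\<^sub>1 n z) \<le> C / real n" "norm (E\<^sub>2 n z) \<le> C / real n" "P n z = tc_expansion \<alpha> n z (E\<^sub>1 n z) (E\<^sub>2 n z)"
        using E[OF that z(2)] by auto
    next
      fix z :: complex assume z: "z \<in> ball 0 \<epsilon>" "Im z < 0"
      then have "norm (cnj z) < \<epsilon>\<^sub>0" "Im (cnj z) > 0" using \<epsilon> by auto
      then have "P n (cnj z) = tc_expansion \<alpha> n (cnj z) (E\<^sub>1 n (cnj z)) (E\<^sub>2 n (cnj z))"
        using E[OF that] by blast
      then show "P n z = cnj (tc_expansion \<alpha> n (cnj z) (E\<^sub>1 n (cnj z)) (E\<^sub>2 n (cnj z)))"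
        using cnj_P[of n z] by simp
    qed
    then have "\<forall>\<^sub>F n in sequentially.
        (\<forall>z \<in> ball 0 \<epsilon>. Im z > 0 \<longrightarrow>
           norm (E\<^sub>1 n z) \<le> C / real n \<and> norm (E\<^sub>2 n z) \<le> C / real n \<and> P n z = tc_expansion \<alpha> n z (E\<^sub>1 n z) (E\<^sub>2 n z)) \<and>
        (\<forall>z \<in> ball 0 \<epsilon>. Im z < 0 \<longrightarrow> P n z = cnj (tc_expansion \<alpha> n (cnj z) (E\<^sub>1 n (cnj z)) (E\<^sub>2 n (cnj z))))"
      by (rule eventually_mono[OF eventually_gt_at_top[of 0]])
    then show "\<exists>(E\<^sub>1 :: nat \<Rightarrow> complex \<Rightarrow> complex) (E\<^sub>2 :: nat \<Rightarrow> complex \<Rightarrow> complex) (C :: real).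
      \<forall>\<^sub>F n in sequentially.
        (\<forall>z \<in> ball 0 \<epsilon>. Im z > 0 \<longrightarrow>
           norm (E\<^sub>1 n z) \<le> C / real n \<and> norm (E\<^sub>2 n z) \<le> C / real n \<and>
           poly (map_poly complex_of_real (tc_monic \<alpha> n)) (of_real (real n powr (-1/2)) * z) =
             tc_expansion \<alpha> n z (E\<^sub>1 n z) (E\<^sub>2 n z)) \<and>
        (\<forall>z \<in> ball 0 \<epsilon>. Im z < 0 \<longrightarrow>
           poly (map_poly complex_of_real (tc_monic \<alpha> n)) (of_real (real n powr (-1/2)) * z) =
             cnj (tc_expansion \<alpha> n (cnj z) (E\<^sub>1 n (cnj z)) (E\<^sub>2 n (cnj z))))"
      unfolding P_def by (intro exI)
  qed
qed

end
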